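(* Let $V$ be a five-dimensional complex vector space. For every smooth cubic form $F\in S^3V$ there exists $Q\in S^2V$ such that $Y=\{F=Q=0\}\subset\mathbb{P}V^*$ is smooth and $(J_{F,3}:Q)=0$, where $(J_{F,3}:Q)=\{a\in V: aQ\in J_{F,3}\}$.
   Context: $S^\bullet V=\mathrm{Sym}^\bullet V$ is the homogeneous coordinate ring of $\mathbb{P}V^*\cong\mathbb{P}^4$; choosing a basis, it is $\mathbb{C}[x_0,\dots,x_4]$. A form $F\in S^3V$ is called smooth if it is nonzero and the hypersurface $\{F=0\}\subset\mathbb{P}V^*$ is smooth, i.e. its first partial derivatives have no common zero in $\mathbb{P}V^*$. $J_F\subset S^\bullet V$ is the ideal generated by the first partial derivatives of $F$, and $J_{F,k}=J_F\cap S^kV$. $Y=\{F=Q=0\}$ is smooth if it is a smooth complete intersection surface, i.e. the gradients of $F$ and $Q$ are linearly independent at every common zero of $F$ and $Q$ in $\mathbb{P}V^*$. *)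

theory Defs
  imports "HOL-Analysis.Analysis" "HOL-Library.Poly_Mapping"
begin

text \<open>
  After choosing a basis of V, the ring Sym V is the polynomial ring in five variables, indexed by
  the five-element type 5. A polynomial is the finitely supported map sending an exponent vector to
  its coefficient; the ring operations are those of \<^theory>\<open>HOL-Library.Poly_Mapping\<close>.
  Vectors in \<^typ>\<open>complex^5\<close> are the coordinates of points of the dual space of V.
\<close>

type_synonym monomial = "5 \<Rightarrow>\<^sub>0 nat"
type_synonym polynomial = "monomial \<Rightarrow>\<^sub>0 complex"

definition total_degree :: "monomial \<Rightarrow> nat" where
  "total_degree m = (\<Sum>i\<in>UNIV. Poly_Mapping.lookup m i)"

text \<open>The graded piece of degree k of Sym V; it contains 0.\<close>

definition forms :: "nat \<Rightarrow> polynomial set" where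
  "forms k = {p. \<forall>m\<in>Poly_Mapping.keys p. total_degree m = k}"

definition eval_poly :: "polynomial \<Rightarrow> complex^5 \<Rightarrow> complex" where
  "eval_poly p x =
     (\<Sum>m\<in>Poly_Mapping.keys p. Poly_Mapping.lookup p m * (\<Prod>i\<in>UNIV. (x $ i) ^ Poly_Mapping.lookup m i))"

text \<open>
  Subtraction of exponent vectors is truncated, which is harmless: where it truncates, the
  coefficient is 0.
\<close>

definition partial_deriv :: "5 \<Rightarrow> polynomial \<Rightarrow> polynomial" where
  "partial_deriv i p =
     (\<Sum>m\<in>Poly_Mapping.keys p.
        Poly_Mapping.single (m - Poly_Mapping.single i 1)
          (of_nat (Poly_Mapping.lookup m i) * Poly_Mapping.lookup p m))"

definition gradient :: "polynomial \<Rightarrow> complex^5 \<Rightarrow> complex^5" where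
  "gradient p x = (\<chi> i. eval_poly (partial_deriv i p) x)"

text \<open>
  Points of projective 4-space are represented by nonzero vectors; for forms, the conditions below
  do not depend on the representative.
\<close>

definition smooth_form :: "polynomial \<Rightarrow> bool" where
  "smooth_form F \<longleftrightarrow> F \<noteq> 0 \<and>
     \<not> (\<exists>x. x \<noteq> 0 \<and> (\<forall>i. eval_poly (partial_deriv i F) x = 0))"

text \<open>
  Linear independence of the two gradients is that of the family, so equal gradients count as
  dependent (unlike independence of the set containing them).
\<close>

definition smooth_complete_intersection :: "polynomial \<Rightarrow> polynomial \<Rightarrow> bool" where
  "smooth_complete_intersection F Q \<longleftrightarrow>
     (\<forall>x. x \<noteq> 0 \<longrightarrow> eval_poly F x = 0 \<longrightarrow> eval_poly Q x = 0 \<longrightarrow>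
        (\<forall>a b. a *s gradient F x + b *s gradient Q x = 0 \<longrightarrow> a = 0 \<and> b = 0))"

text \<open>The span in the ring, regarded as a module over itself, is the generated ideal.\<close>

definition jacobian_ideal :: "polynomial \<Rightarrow> polynomial set" where
  "jacobian_ideal F = module.span (*) (range (\<lambda>i. partial_deriv i F))"

definition jacobian_piece :: "polynomial \<Rightarrow> nat \<Rightarrow> polynomial set" where
  "jacobian_piece F k = jacobian_ideal F \<inter> forms k"

text \<open>The colon space (W : Q) inside V, the space of linear forms.\<close>

definition linear_colon :: "polynomial set \<Rightarrow> polynomial \<Rightarrow> polynomial set" where
  "linear_colon W Q = {a \<in> forms 1. a * Q \<in> W}"

end

theory Submission
  imports Defs
begin

text \<open>
  Let \<open>J\<close> be the Jacobian ideal and \<open>V\<close> the linear forms. Choose a quadric \<open>Q\<close> for which the dimension of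
  \<open>V Q + J\<^sub>3\<close> is maximal, and suppose that \<open>a Q\<close> lies in \<open>J\<^sub>3\<close> for some nonzero \<open>a\<close>. That space then has
  dimension at most 29, and perturbing \<open>Q\<close> in an arbitrary direction shows that it contains
  \<open>a S\<^sup>2V\<close>. So the cubics \<open>V Q + J\<^sub>3\<close> restrict to a space of dimension at most 14 on the hyperplane
  \<open>a = 0\<close>. After another perturbation of \<open>Q\<close>, however, \<open>Q\<close> and \<open>J\<^sub>2\<close> restrict to a space of dimension at least 5
  of quadrics in four variables without a common zero, and the multiples of such quadrics by linear forms span
  at least 15 dimensions; this follows by restricting further to a plane and a line.

  The condition is open in \<open>Q\<close>, whereas the quadrics for which \<open>Y\<close> is singular form a null set: at a
  point with a coordinate normalized to 1, tangency can be solved for five coefficients of \<open>Q\<close> in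
  terms of the point, the multiplier and the other coefficients, which makes these quadrics the image of a
  null set (given by \<open>F = 0\<close>) under a differentiable map between spaces of equal dimension.
\<close>

section \<open>Linear independence of functions on a set\<close>

text \<open>The bound 29 is 5 + 25 - 1: five products of \<open>Q\<close> with the coordinates and
  twenty-five of the partial derivatives, less the relation given by \<open>a\<close>. The obstacle
  is that \<open>J\<^sub>2\<close> alone may have dimension only 4 on \<open>a = 0\<close>:
  smoothness still allows one combination of the partial derivatives, up to scalars, to vanish on a
  hyperplane. Then \<open>Q\<close> has to supply the fifth dimension, and it fails to do so exactly
  when \<open>Q = a m + q\<close> with \<open>m\<close> linear and \<open>q\<close> in
  \<open>J\<^sub>2\<close>. Hence the second perturbation, which must preserve both the maximal
  dimension and the membership of \<open>a Q\<close> in \<open>J\<^sub>3\<close>; so only directions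
  \<open>R\<close> with \<open>a R\<close> in \<open>J\<^sub>3\<close> are admissible. In the count
  in four variables, a quadric lost on restriction to a hyperplane \<open>b = 0\<close> is
  \<open>b\<close> times a linear form, and that factor yields additional cubics divisible by
  \<open>b\<close>. This compensation makes 15 available however the family restricts.\<close>

definition clin :: "(complex^'n \<Rightarrow> complex) \<Rightarrow> bool" where
  "clin f \<longleftrightarrow> (\<forall>x y. f (x + y) = f x + f y) \<and> (\<forall>c x. f (c *s x) = c * f x)"

definition indep_on :: "'i set \<Rightarrow> 'a set \<Rightarrow> ('i \<Rightarrow> 'a \<Rightarrow> complex) \<Rightarrow> bool" where
  "indep_on I X f \<longleftrightarrow> (\<forall>c. (\<forall>x\<in>X. (\<Sum>i\<in>I. c i * f i x) = 0) \<longrightarrow> (\<forall>i\<in>I. c i = 0))"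

text \<open>For the span of \<open>M\<close> restricted to \<open>X\<close>, this says that the
  dimension is at least \<open>n\<close>. Dimension counts are run with such lower bounds, and
  \<open>has_indep_le_card\<close> supplies the upper ones.\<close>

definition has_indep :: "nat \<Rightarrow> 'a set \<Rightarrow> ('a \<Rightarrow> complex) set \<Rightarrow> bool" where
  "has_indep n X M \<longleftrightarrow> (\<exists>f. (\<forall>i<n. f i \<in> M) \<and> indep_on {..<n} X f)"

lemma indep_onD: "indep_on I X f \<Longrightarrow> (\<And>x. x \<in> X \<Longrightarrow> (\<Sum>i\<in>I. c i * f i x) = 0) \<Longrightarrow> i \<in> I \<Longrightarrow> c i = 0"
  unfolding indep_on_def by blast

lemma has_indepI:
  assumes "finite I" "\<And>i. i \<in> I \<Longrightarrow> f i \<in> M" "indep_on I X f"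
  shows "has_indep (card I) X M"
proof -
  obtain h where h: "bij_betw h {..<card I} I"
    using assms(1) by (metis bij_betw_from_nat_into_finite)
  have "indep_on {..<card I} X (\<lambda>k. f (h k))"
    unfolding indep_on_def
  proof (intro allI impI ballI)
    fix c k assume c: "\<forall>x\<in>X. (\<Sum>k<card I. c k * f (h k) x) = 0" and k: "k \<in> {..<card I}"
    let ?g = "the_inv_into {..<card I} h"
    have inj: "inj_on h {..<card I}" using h by (auto simp: bij_betw_def)
    have g: "?g (h k) = k" if "k < card I" for k
      using the_inv_into_f_f[OF inj] that by auto
    have "(\<Sum>i\<in>I. c (?g i) * f i x) = 0" if "x \<in> X" for x
    proof -
      have "(\<Sum>i\<in>I. c (?g i) * f i x) = (\<Sum>k<card I. c (?g (h k)) * f (h k) x)"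
        by (rule sum.reindex_bij_betw[OF h, symmetric])
      also have "\<dots> = (\<Sum>k<card I. c k * f (h k) x)"
        using g by (intro sum.cong) auto
      finally show ?thesis using c that by simp
    qed
    then have "c (?g (h k)) = 0"
      using indep_onD[OF assms(3), of "\<lambda>i. c (?g i)"] h k by (auto simp: bij_betw_def)
    then show "c k = 0" using g k by simp
  qed
  then show ?thesis
    unfolding has_indep_def using assms(2) h
    by (intro exI[of _ "\<lambda>k. f (h k)"]) (auto simp: bij_betw_def)
qed

lemma has_indepE:
  assumes "has_indep n X M"
  obtains f where "\<And>i. i < n \<Longrightarrow> f i \<in> M" "indep_on {..<n} X f"
  using assms unfolding has_indep_def by blast

lemma has_indep_0: "has_indep 0 X M"
  unfolding has_indep_def indep_on_def by simp

lemma has_indep_mono: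
  assumes "has_indep n X M" "M \<subseteq> M'" "X \<subseteq> X'"
  shows "has_indep n X' M'"
  using assms unfolding has_indep_def indep_on_def by (metis subset_iff)

text \<open>Rank-nullity for restriction from \<open>X\<close> to \<open>X'\<close>:
  \<open>K\<close> lies in the kernel, and the second family has independent images.\<close>

lemma has_indep_add:
  assumes K: "has_indep p X K" and M: "has_indep r X' M" and "X' \<subseteq> X" "K \<subseteq> M"
    and van: "\<And>k x. k \<in> K \<Longrightarrow> x \<in> X' \<Longrightarrow> k x = 0"
  shows "has_indep (p + r) X M"
proof -
  obtain f where f: "\<And>i. i < p \<Longrightarrow> f i \<in> K" "indep_on {..<p} X f"
    using has_indepE[OF K] by metis
  obtain g where g: "\<And>i. i < r \<Longrightarrow> g i \<in> M" "indep_on {..<r} X' g"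
    using has_indepE[OF M] by metis
  let ?I = "{..<p} <+> {..<r}"
  have "indep_on ?I X (case_sum f g)"
    unfolding indep_on_def
  proof (intro allI impI)
    fix c assume c: "\<forall>x\<in>X. (\<Sum>i\<in>?I. c i * case_sum f g i x) = 0"
    have c': "(\<Sum>i<p. c (Inl i) * f i x) + (\<Sum>i<r. c (Inr i) * g i x) = 0" if "x \<in> X" for x
      using c that by (simp add: sum.Plus)
    have "(\<Sum>i<r. c (Inr i) * g i x) = 0" if "x \<in> X'" for x
    proof -
      have "(\<Sum>i<p. c (Inl i) * f i x) = 0"
        using that f(1) van by (intro sum.neutral) simp
      then show ?thesis using c'[of x] that assms(3) by auto
    qed
    then have r: "c (Inr i) = 0" if "i < r" for i
      using indep_onD[OF g(2), of "\<lambda>i. c (Inr i)"] that by auto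
    then have "(\<Sum>i<p. c (Inl i) * f i x) = 0" if "x \<in> X" for x
      using c'[OF that] by simp
    then have "c (Inl i) = 0" if "i < p" for i
      using indep_onD[OF f(2), of "\<lambda>i. c (Inl i)"] that by auto
    with r show "\<forall>i\<in>?I. c i = 0" by auto
  qed
  then have "has_indep (card ?I) X M"
    using f(1) g(1) assms(4) by (intro has_indepI[of _ "case_sum f g"]) auto
  then show ?thesis by (simp add: card_Plus)
qed

text \<open>Gaussian elimination: with a pivot \<open>c j g \<noteq> 0\<close>, equation
  \<open>g\<close> is solved for the unknown \<open>j\<close>, which leaves one equation and one
  unknown fewer.\<close>

lemma homogeneous_system_nontrivial:
  fixes c :: "'i \<Rightarrow> 'g \<Rightarrow> complex"
  assumes "finite G" "finite I" "card G < card I"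
  shows "\<exists>d. (\<exists>i\<in>I. d i \<noteq> 0) \<and> (\<forall>g\<in>G. (\<Sum>i\<in>I. d i * c i g) = 0)"
  using assms
proof (induction G arbitrary: I c rule: finite_induct)
  case empty
  then obtain i where "i \<in> I" by fastforce
  then show ?case by (intro exI[of _ "\<lambda>_. 1"]) auto
next
  case (insert g G)
  show ?case
  proof (cases "\<forall>i\<in>I. c i g = 0")
    case True
    moreover have "card G < card I" using insert.prems insert.hyps by simp
    ultimately show ?thesis using insert.IH[OF insert.prems(1), of c] by auto
  next
    case False
    then obtain j where j: "j \<in> I" "c j g \<noteq> 0" by blast
    let ?c = "\<lambda>i h. c i h - c i g / c j g * c j h"
    have "card G < card (I - {j})" using insert.prems insert.hyps j by simp
    then have "\<exists>d. (\<exists>i\<in>I-{j}. d i \<noteq> 0) \<and> (\<forall>h\<in>G. (\<Sum>i\<in>I-{j}. d i * ?c i h) = 0)"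
      using insert.prems(1) by (intro insert.IH) auto
    then obtain d where d: "\<exists>i\<in>I-{j}. d i \<noteq> 0" "\<And>h. h \<in> G \<Longrightarrow> (\<Sum>i\<in>I-{j}. d i * ?c i h) = 0"
      by blast
    let ?s = "\<Sum>i\<in>I-{j}. d i * c i g / c j g"
    let ?d = "d(j := - ?s)"
    have split: "(\<Sum>i\<in>I. ?d i * c i h) = (\<Sum>i\<in>I-{j}. d i * c i h) - ?s * c j h" for h
      using j insert.prems(1) by (subst sum.remove[of I j]) (auto intro: sum.cong)
    have "(\<Sum>i\<in>I. ?d i * c i h) = 0" if "h \<in> insert g G" for h
    proof (cases "h = g")
      case True
      then show ?thesis using j unfolding split by (simp add: sum_distrib_right)
    next
      case False
      then have "(\<Sum>i\<in>I-{j}. d i * ?c i h) = 0" using d(2) that by simp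
      then show ?thesis unfolding split
        by (simp add: sum_distrib_left sum_distrib_right right_diff_distrib sum_subtractf mult_ac)
    qed
    then show ?thesis using d(1) by (intro exI[of _ ?d]) auto
  qed
qed

lemma has_indep_le_card:
  assumes "has_indep n X M" "finite G"
    and sp: "\<And>f. f \<in> M \<Longrightarrow> \<exists>c. \<forall>x\<in>X. f x = (\<Sum>g\<in>G. c g * h g x)"
  shows "n \<le> card G"
proof (rule ccontr)
  assume "\<not> n \<le> card G"
  then have lt: "card G < card {..<n}" by simp
  obtain f where f: "\<And>i. i < n \<Longrightarrow> f i \<in> M" "indep_on {..<n} X f"
    using has_indepE[OF assms(1)] by metis
  from sp f(1) obtain c where c: "\<And>i x. i < n \<Longrightarrow> x \<in> X \<Longrightarrow> f i x = (\<Sum>g\<in>G. c i g * h g x)"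
    using bchoice[of "{..<n}" "\<lambda>i c. \<forall>x\<in>X. f i x = (\<Sum>g\<in>G. c g * h g x)"] by auto
  obtain d where d: "\<exists>i<n. d i \<noteq> 0" "\<And>g. g \<in> G \<Longrightarrow> (\<Sum>i<n. d i * c i g) = 0"
    using homogeneous_system_nontrivial[OF assms(2) _ lt, of c] by auto
  have "(\<Sum>i<n. d i * f i x) = 0" if "x \<in> X" for x
  proof -
    have "(\<Sum>i<n. d i * f i x) = (\<Sum>i<n. \<Sum>g\<in>G. d i * c i g * h g x)"
      using c that by (simp add: sum_distrib_left mult.assoc)
    also have "\<dots> = (\<Sum>g\<in>G. (\<Sum>i<n. d i * c i g) * h g x)"
      by (subst sum.swap) (simp add: sum_distrib_right)
    finally show ?thesis using d(2) by simp
  qed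
  then show False using indep_onD[OF f(2)] d(1) by blast
qed

text \<open>The functionals dual to an independent family are finite combinations of point evaluations, with
  nodes \<open>S\<close> and weights \<open>w k\<close>.\<close>

lemma indep_on_dual:
  assumes "indep_on {..<n::nat} X f"
  shows "\<exists>S w. finite S \<and> S \<subseteq> X \<and>
    (\<forall>k<n. \<forall>i<n. (\<Sum>x\<in>S. w k x * f i x) = (if i = k then 1 else (0::complex)))"
  using assms
proof (induction n)
  case 0
  show ?case by (intro exI[of _ "{}"]) auto
next
  case (Suc n)
  have "indep_on {..<n} X f"
    unfolding indep_on_def
  proof (intro allI impI ballI)
    fix c i assume c: "\<forall>x\<in>X. (\<Sum>i<n. c i * f i x) = 0" and i: "i \<in> {..<n}"
    have "(\<Sum>i<Suc n. (c(n:=0)) i * f i x) = 0" if "x \<in> X" for x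
      using c that by simp
    then have "(c(n:=0)) i = 0" using indep_onD[OF Suc.prems, of "c(n:=0)" i] i by simp
    then show "c i = 0" using i by simp
  qed
  then obtain S w where S: "finite S" "S \<subseteq> X"
    "\<And>k i. k < n \<Longrightarrow> i < n \<Longrightarrow> (\<Sum>x\<in>S. w k x * f i x) = (if i = k then 1 else 0)"
    using Suc.IH by metis
  define L where "L k g = (\<Sum>x\<in>S. w k x * g x)" for k g
  have L: "L k (f i) = (if i = k then 1 else 0)" if "k < n" "i < n" for k i
    using S(3) that by (simp add: L_def)
  \<comment> \<open>Coefficients of \<open>f n\<close> minus its projection to the earlier
    functions, a combination annihilated by every \<open>L k\<close>; independence provides a point
    \<open>y\<close> where it is nonzero.\<close>
  define c where "c i = (if i = n then 1 else - L i (f n))" for i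
  have "\<not> (\<forall>x\<in>X. (\<Sum>i<Suc n. c i * f i x) = 0)"
    using indep_onD[OF Suc.prems, of c n] by (auto simp: c_def)
  then obtain y where y: "y \<in> X" "(\<Sum>i<Suc n. c i * f i y) \<noteq> 0" by blast
  define g where "g = (\<Sum>i<Suc n. c i * f i y)"
  have g: "g = f n y - (\<Sum>j<n. L j (f n) * f j y)" "g \<noteq> 0"
    using y by (auto simp: g_def c_def sum_negf)
  define S' where "S' = insert y S"
  define w0 where "w0 k x = (if x \<in> S then w k x else 0)" for k x
  have S': "finite S'" "S' \<subseteq> X" "S \<subseteq> S'" using S y by (auto simp: S'_def)
  have L0: "(\<Sum>x\<in>S'. w0 k x * h x) = L k h" for k h
  proof -
    have "(\<Sum>x\<in>S'. w0 k x * h x) = (\<Sum>x\<in>S. w0 k x * h x)"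
      using S' by (intro sum.mono_neutral_right) (auto simp: w0_def)
    then show ?thesis by (simp add: L_def w0_def)
  qed
  \<comment> \<open>Evaluation at \<open>y\<close>, corrected to vanish on the earlier functions and
    scaled to be 1 on \<open>f n\<close>.\<close>
  define m where "m x = ((if x = y then 1 else 0) - (\<Sum>j<n. f j y * w0 j x)) / g" for x
  have m: "(\<Sum>x\<in>S'. m x * h x) = (h y - (\<Sum>j<n. f j y * L j h)) / g" for h
  proof -
    have "(\<Sum>x\<in>S'. m x * h x) =
        ((\<Sum>x\<in>S'. (if x = y then 1 else 0) * h x) - (\<Sum>x\<in>S'. \<Sum>j<n. f j y * (w0 j x * h x))) / g"
      by (simp add: m_def sum_subtractf[symmetric] sum_divide_distrib sum_distrib_right
          left_diff_distrib mult.assoc)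
    also have "(\<Sum>x\<in>S'. \<Sum>j<n. f j y * (w0 j x * h x)) = (\<Sum>j<n. f j y * L j h)"
      by (subst sum.swap) (simp add: sum_distrib_left[symmetric] L0)
    also have "(\<Sum>x\<in>S'. (if x = y then 1 else 0) * h x) = h y"
    proof -
      have "(\<Sum>x\<in>S'. (if x = y then 1 else 0) * h x) = (\<Sum>x\<in>S'. if x = y then h x else 0)"
        by (intro sum.cong) auto
      then show ?thesis using S'(1) by (simp add: S'_def)
    qed
    finally show ?thesis .
  qed
  have m_lt: "(\<Sum>x\<in>S'. m x * f i x) = 0" if "i < n" for i
  proof -
    have "(\<Sum>j<n. f j y * L j (f i)) = (\<Sum>j<n. if j = i then f j y else 0)"
      using L that by (intro sum.cong) auto
    then show ?thesis using that by (simp add: m)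
  qed
  have m_n: "(\<Sum>x\<in>S'. m x * f n x) = 1"
    using g by (simp add: m mult.commute)
  \<comment> \<open>The earlier functionals are corrected by multiples of \<open>m\<close> so that
    they vanish on \<open>f n\<close>.\<close>
  define w' where "w' k x = (if k = n then m x else w0 k x - L k (f n) * m x)" for k x
  have w': "(\<Sum>x\<in>S'. w' k x * h x) =
      (if k = n then (\<Sum>x\<in>S'. m x * h x) else L k h - L k (f n) * (\<Sum>x\<in>S'. m x * h x))" for k h
    by (auto simp: w'_def left_diff_distrib sum_subtractf L0 sum_distrib_left mult.assoc)
  have "(\<Sum>x\<in>S'. w' k x * f i x) = (if i = k then 1 else 0)" if "k < Suc n" "i < Suc n" for k i
    using that m_lt m_n L unfolding w' by (auto simp: less_Suc_eq)
  then show ?case using S' by blast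
qed

text \<open>The dual functionals applied to the perturbed family give a matrix close to the
  identity, and such a matrix is invertible once the error terms of each row add up to less than
  1.\<close>

lemma indep_on_eventually:
  assumes ind: "indep_on {..<n::nat} X (\<lambda>i. f i)"
    and lim: "\<And>i x. i < n \<Longrightarrow> x \<in> X \<Longrightarrow> ((\<lambda>p. g p i x) \<longlongrightarrow> f i x) \<F>"
  shows "\<forall>\<^sub>F p in \<F>. indep_on {..<n} X (g p)"
proof -
  obtain S w where S: "finite S" "S \<subseteq> X"
    "\<And>k i. k < n \<Longrightarrow> i < n \<Longrightarrow> (\<Sum>x\<in>S. w k x * f i x) = (if i = k then 1 else 0)"
    using indep_on_dual[OF ind] by metis
  define e where "e = 1 / (real n + 1)"
  have e: "e > 0" "real n * e < 1" by (auto simp: e_def field_simps)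
  have lim': "((\<lambda>p. \<Sum>x\<in>S. w k x * g p i x) \<longlongrightarrow> (if i = k then 1 else 0)) \<F>" if "k < n" "i < n" for k i
  proof -
    have "((\<lambda>p. \<Sum>x\<in>S. w k x * g p i x) \<longlongrightarrow> (\<Sum>x\<in>S. w k x * f i x)) \<F>"
      by (intro tendsto_sum tendsto_mult tendsto_const lim) (use S that in auto)
    then show ?thesis using S(3) that by simp
  qed
  have "\<forall>\<^sub>F p in \<F>. \<forall>k\<in>{..<n}. \<forall>i\<in>{..<n}. dist (\<Sum>x\<in>S. w k x * g p i x) (if i = k then 1 else 0) < e"
    by (intro eventually_ball_finite finite_lessThan ballI tendstoD[OF lim' e(1)]) auto
  then show ?thesis
  proof (rule eventually_mono)
    fix p assume p: "\<forall>k\<in>{..<n}. \<forall>i\<in>{..<n}. dist (\<Sum>x\<in>S. w k x * g p i x) (if i = k then 1 else 0) < e"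
    show "indep_on {..<n} X (g p)"
      unfolding indep_on_def
    proof (intro allI impI ballI)
      fix c j assume c: "\<forall>x\<in>X. (\<Sum>i<n. c i * g p i x) = 0" and j: "j \<in> {..<n}"
      \<comment> \<open>The row that belongs to a coefficient of largest modulus gives
        \<open>C \<le> n * e * C\<close>, and \<open>n * e < 1\<close> by the choice of
        \<open>e\<close>.\<close>
      define C where "C = Max ((\<lambda>i. cmod (c i)) ` {..<n})"
      have ne: "(\<lambda>i. cmod (c i)) ` {..<n} \<noteq> {}" using j by auto
      have C: "cmod (c i) \<le> C" if "i < n" for i using that by (auto simp: C_def)
      obtain k where k: "k < n" "C = cmod (c k)"
        using Max_in[OF _ ne] by (auto simp: C_def)
      have "0 = (\<Sum>x\<in>S. w k x * (\<Sum>i<n. c i * g p i x))"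
        using c S(2) by (intro sum.neutral[symmetric]) auto
      also have "\<dots> = (\<Sum>i<n. c i * (\<Sum>x\<in>S. w k x * g p i x))"
        by (simp add: sum_distrib_left mult_ac) (rule sum.swap)
      also have "\<dots> = (\<Sum>i<n. c i * ((\<Sum>x\<in>S. w k x * g p i x) - (if i = k then 1 else 0)))
          + (\<Sum>i<n. c i * (if i = k then 1 else 0))"
        by (simp add: right_diff_distrib sum_subtractf)
      also have "(\<Sum>i<n. c i * (if i = k then 1 else 0)) = (\<Sum>i<n. if i = k then c i else 0)"
        by (intro sum.cong) auto
      also have "\<dots> = c k" using k by simp
      finally have "c k = - (\<Sum>i<n. c i * ((\<Sum>x\<in>S. w k x * g p i x) - (if i = k then 1 else 0)))"
        unfolding eq_neg_iff_add_eq_0 by (simp only: add.commute)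
      then have "cmod (c k) = cmod (\<Sum>i<n. c i * ((\<Sum>x\<in>S. w k x * g p i x) - (if i = k then 1 else 0)))"
        by (simp only: norm_minus_cancel)
      also have "\<dots> \<le> (\<Sum>i<n. C * e)"
      proof (rule sum_norm_le)
        fix i assume i: "i \<in> {..<n}"
        show "cmod (c i * ((\<Sum>x\<in>S. w k x * g p i x) - (if i = k then 1 else 0))) \<le> C * e"
          unfolding norm_mult
        proof (rule mult_mono)
          show "cmod (c i) \<le> C" using C i by simp
          show "cmod ((\<Sum>x\<in>S. w k x * g p i x) - (if i = k then 1 else 0)) \<le> e"
          proof -
            have "dist (\<Sum>x\<in>S. w k x * g p i x) (if i = k then 1 else 0) < e"
              using p i k by blast
            then show ?thesis unfolding dist_norm by (rule less_imp_le)
          qed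
          show "0 \<le> C" using k by simp
        qed simp
      qed
      finally have "C \<le> (real n * e) * C" using k by (simp add: mult_ac)
      then have "C * (1 - real n * e) \<le> 0" by (simp add: algebra_simps)
      then have "C \<le> 0" using e(2) by (simp add: mult_le_0_iff)
      moreover have "cmod (c j) \<le> C" using C j by simp
      ultimately show "c j = 0" by (metis norm_le_zero_iff order_trans)
    qed
  qed
qed

lemma indep_on_subset:
  assumes "indep_on I X f" "finite I" "J \<subseteq> I"
  shows "indep_on J X f"
  unfolding indep_on_def
proof (intro allI impI ballI)
  fix c j assume c: "\<forall>x\<in>X. (\<Sum>i\<in>J. c i * f i x) = 0" and j: "j \<in> J"
  let ?c = "\<lambda>i. if i \<in> J then c i else 0"
  have "(\<Sum>i\<in>I. ?c i * f i x) = (\<Sum>i\<in>J. ?c i * f i x)" for x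
    using assms(2,3) by (intro sum.mono_neutral_right) auto
  then have "(\<Sum>i\<in>I. ?c i * f i x) = 0" if "x \<in> X" for x
    using c that by simp
  then have "?c j = 0" using indep_onD[OF assms(1), of ?c j] j assms(3) by blast
  then show "c j = 0" using j by simp
qed

lemma has_indep_le: "has_indep n X M \<Longrightarrow> k \<le> n \<Longrightarrow> has_indep k X M"
  unfolding has_indep_def
proof (elim exE conjE)
  fix f assume "\<forall>i<n. f i \<in> M" "indep_on {..<n} X f" "k \<le> n"
  then show "\<exists>f. (\<forall>i<k. f i \<in> M) \<and> indep_on {..<k} X f"
    using indep_on_subset[of "{..<n}" X f "{..<k}"] by (intro exI[of _ f]) auto
qed

lemma has_indep_1:
  assumes "f \<in> M" "x \<in> X" "f x \<noteq> 0"
  shows "has_indep 1 X M"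
  unfolding has_indep_def indep_on_def using assms by (intro exI[of _ "\<lambda>_. f"]) auto

lemma has_indep_2:
  assumes "f \<in> M" "g \<in> M" "y \<in> X" "z \<in> X" "f y \<noteq> 0" "f z = 0" "g z \<noteq> 0"
  shows "has_indep 2 X M"
  unfolding has_indep_def indep_on_def
proof (intro exI[of _ "\<lambda>i::nat. if i = 0 then f else g"] conjI allI impI ballI)
  fix i c assume c: "\<forall>x\<in>X. (\<Sum>i<2::nat. c i * (if i = 0 then f else g) x) = 0" and i: "i \<in> {..<2::nat}"
  have c': "c 0 * f x + c 1 * g x = 0" if "x \<in> X" for x
    using c that by (simp add: numeral_2_eq_2)
  have "c 1 = 0" using c'[OF assms(4)] assms by simp
  moreover from this have "c 0 = 0" using c'[OF assms(3)] assms by simp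
  ultimately show "c i = 0" using i by (auto simp: less_2_cases_iff)
qed (use assms in auto)

section \<open>Linear forms on subspaces\<close>

lemma clin_add: "clin f \<Longrightarrow> f (x + y) = f x + f y"
  and clin_scale: "clin f \<Longrightarrow> f (c *s x) = c * f x"
  by (auto simp: clin_def)

lemma clin_0: "clin f \<Longrightarrow> f 0 = 0"
  using clin_scale[of f 0 0] by simp

lemma clin_neg: "clin f \<Longrightarrow> f (- x) = - f x"
  using clin_scale[of f "-1" x] by (simp add: vector_sneg_minus1[symmetric])

lemma clin_diff: "clin f \<Longrightarrow> f (x - y) = f x - f y"
  using clin_add[of f x "- y"] clin_neg[of f y] by simp

lemma clin_sum: "clin f \<Longrightarrow> f (\<Sum>i\<in>I. g i) = (\<Sum>i\<in>I. f (g i))"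
  by (induction I rule: infinite_finite_induct) (auto simp: clin_0 clin_add)

lemma clin_expand: "clin f \<Longrightarrow> f x = (\<Sum>i\<in>UNIV. x $ i * f (axis i 1))"
  by (subst basis_expansion[of x, symmetric]) (simp add: clin_sum clin_scale)

lemma clin_component [simp]: "clin (\<lambda>x. x $ i)"
  by (simp add: clin_def)

lemma clin_cmul [simp]: "clin f \<Longrightarrow> clin (\<lambda>x. c * f x)"
  and clin_cmul_right [simp]: "clin f \<Longrightarrow> clin (\<lambda>x. f x * c)"
  and clin_plus [simp]: "clin f \<Longrightarrow> clin g \<Longrightarrow> clin (\<lambda>x. f x + g x)"
  and clin_minus [simp]: "clin f \<Longrightarrow> clin g \<Longrightarrow> clin (\<lambda>x. f x - g x)"
  and clin_zero [simp]: "clin (\<lambda>x. 0)"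
  by (auto simp: clin_def algebra_simps)

lemma clin_continuous: "clin f \<Longrightarrow> continuous_on S f"
proof -
  assume f: "clin f"
  have "continuous_on S (\<lambda>x. \<Sum>i\<in>UNIV. x $ i * f (axis i 1))"
    by (intro continuous_intros)
  then show ?thesis by (simp add: clin_expand[OF f, symmetric])
qed

lemma subspace_Int_kernel:
  "vec.subspace X \<Longrightarrow> clin m \<Longrightarrow> vec.subspace (X \<inter> {x. m x = 0})"
  by (auto simp: vec.subspace_def clin_add clin_scale clin_0)

lemma of_real_smult: "of_real r *s x = r *\<^sub>R (x :: complex^'n)"
  unfolding vec_eq_iff by (simp only: vector_scaleR_component vector_smult_component) (simp add: scaleR_conv_of_real)

lemma subspace_scaleR: "vec.subspace X \<Longrightarrow> x \<in> X \<Longrightarrow> r *\<^sub>R x \<in> (X :: (complex^'n) set)"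
  unfolding of_real_smult[symmetric] by (rule vec.subspace_scale)

lemma clin_scaleR: "clin f \<Longrightarrow> f (r *\<^sub>R x) = of_real r * f x"
  unfolding of_real_smult[symmetric] by (rule clin_scale)

text \<open>Points with \<open>b = 0\<close> are limits of points off that hyperplane, along the
  direction \<open>e\<close>. This is what allows a factor \<open>b\<close> to be cancelled.\<close>

lemma zero_on_kernel:
  assumes "vec.subspace X" "e \<in> X" "clin b" "b e \<noteq> 0" "continuous_on UNIV g"
    and g: "\<And>x. x \<in> X \<Longrightarrow> b x \<noteq> 0 \<Longrightarrow> g x = (0::complex)" and x: "x \<in> X"
  shows "g x = 0"
proof (cases "b x = 0")
  case True
  have "((\<lambda>r. g (x + r *\<^sub>R e)) \<longlongrightarrow> g (x + 0 *\<^sub>R e)) (at (0::real))"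
  proof (rule isCont_tendsto_compose[of _ g])
    show "isCont g (x + 0 *\<^sub>R e)" using assms(5) by (simp add: continuous_on_eq_continuous_at)
    show "((\<lambda>r. x + r *\<^sub>R e) \<longlongrightarrow> x + 0 *\<^sub>R e) (at (0::real))" by (intro tendsto_intros)
  qed
  moreover have "\<forall>\<^sub>F r in at (0::real). g (x + r *\<^sub>R e) = 0"
  proof (rule eventually_mono[OF eventually_neq_at_within[of 0]])
    fix r :: real assume "r \<noteq> 0"
    then have "b (x + r *\<^sub>R e) \<noteq> 0"
      using True assms(3,4) by (simp add: clin_add clin_scaleR)
    then show "g (x + r *\<^sub>R e) = 0"
      using g vec.subspace_add[OF assms(1) x subspace_scaleR[OF assms(1,2)]] by blast
  qed
  ultimately have "((\<lambda>r. 0) \<longlongrightarrow> g (x + 0 *\<^sub>R e)) (at (0::real))"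
    by (rule Lim_transform_eventually)
  then show ?thesis by (simp add: tendsto_const_iff)
qed (use g x in auto)

text \<open>Multiplication by \<open>b\<close> preserves independence and its images vanish on
  \<open>b = 0\<close>, so the two counts add by \<open>has_indep_add\<close>. The later counts of
  products all rest on this inequality.\<close>

lemma has_indep_mult_step:
  assumes X: "vec.subspace X" "e \<in> X" "clin b" "b e \<noteq> 0"
    and G: "has_indep n X G" and cont: "\<And>g. g \<in> G \<Longrightarrow> continuous_on UNIV g"
    and mult: "\<And>g. g \<in> G \<Longrightarrow> \<exists>f\<in>J. \<forall>x\<in>X. f x = b x * g x"
    and k: "has_indep k (X \<inter> {x. b x = 0}) J"
  shows "has_indep (n + k) X J"
proof -
  obtain g where g: "\<And>i. i < n \<Longrightarrow> g i \<in> G" "indep_on {..<n} X g"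
    using has_indepE[OF G] by metis
  obtain f where f: "\<And>i. i < n \<Longrightarrow> f i \<in> J" "\<And>i x. i < n \<Longrightarrow> x \<in> X \<Longrightarrow> f i x = b x * g i x"
  proof -
    have "\<forall>i\<in>{..<n}. \<exists>f. f \<in> J \<and> (\<forall>x\<in>X. f x = b x * g i x)"
      using mult g(1) by blast
    from bchoice[OF this] show ?thesis using that by auto
  qed
  define K where "K = {f \<in> J. \<forall>x\<in>X \<inter> {x. b x = 0}. f x = 0}"
  have "indep_on {..<n} X f"
    unfolding indep_on_def
  proof (intro allI impI)
    fix c assume c: "\<forall>x\<in>X. (\<Sum>i<n. c i * f i x) = 0"
    have *: "(\<Sum>i<n. c i * f i x) = b x * (\<Sum>i<n. c i * g i x)" if "x \<in> X" for x
      using f(2) that by (simp add: sum_distrib_left mult_ac)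
    have "(\<Sum>i<n. c i * g i x) = 0" if "x \<in> X" for x
    proof (rule zero_on_kernel[OF X, of "\<lambda>x. \<Sum>i<n. c i * g i x"])
      show "continuous_on UNIV (\<lambda>x. \<Sum>i<n. c i * g i x)"
        using cont[OF g(1)] by (intro continuous_intros) simp
      show "(\<Sum>i<n. c i * g i y) = 0" if "y \<in> X" "b y \<noteq> 0" for y
        using *[OF that(1)] c that by simp
    qed (rule that)
    then show "\<forall>i\<in>{..<n}. c i = 0" using indep_onD[OF g(2), of c] by blast
  qed
  then have "has_indep n X K"
    unfolding has_indep_def using f by (intro exI[of _ f]) (simp add: K_def)
  then show ?thesis by (rule has_indep_add[OF _ k]) (simp_all add: K_def)
qed

text \<open>A relation among the \<open>f i\<close> that holds on \<open>m = 0\<close> is a multiple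
  of \<open>m\<close> on \<open>X\<close> (\<open>red\<close>). Such relations therefore form a
  space of dimension at most 1, and dropping an index \<open>k\<close> with
  \<open>c k \<noteq> 0\<close> removes them.\<close>

lemma has_indep_kernel:
  assumes ind: "has_indep (Suc n) X {f. clin f}" and X: "vec.subspace X" and m: "clin m"
  shows "has_indep n (X \<inter> {x. m x = 0}) {f. clin f}"
proof -
  let ?X = "X \<inter> {x. m x = 0}" and ?I = "{..<Suc n}"
  obtain f where f: "\<And>i. i < Suc n \<Longrightarrow> clin (f i)" "indep_on ?I X f"
    using has_indepE[OF ind] by auto
  have sub: "has_indep n ?X {f. clin f}" if "k < Suc n" "indep_on (?I - {k}) ?X f" for k
    using has_indepI[OF _ _ that(2), of "{f. clin f}"] f(1) that(1) by auto
  show ?thesis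
  proof (cases "indep_on ?I ?X f")
    case True
    then show ?thesis using sub[of 0] indep_on_subset[of ?I ?X f "?I - {0}"] by auto
  next
    case False
    then obtain c k where c: "\<And>x. x \<in> ?X \<Longrightarrow> (\<Sum>i\<in>?I. c i * f i x) = 0" and k: "k \<in> ?I" "c k \<noteq> 0"
      unfolding indep_on_def by blast
    have "\<exists>e\<in>X. m e \<noteq> 0"
      using indep_onD[OF f(2), of c k] c k by auto
    then obtain e0 where e0: "e0 \<in> X" "m e0 \<noteq> 0" by blast
    define e where "e = (1 / m e0) *s e0"
    have e: "e \<in> X" "m e = 1"
      using e0 X m by (auto simp: e_def clin_scale vec.subspace_scale)
    have red: "(\<Sum>i\<in>?I. d i * f i x) = m x * (\<Sum>i\<in>?I. d i * f i e)"
      if d: "\<And>x. x \<in> ?X \<Longrightarrow> (\<Sum>i\<in>?I. d i * f i x) = 0" and x: "x \<in> X" for d x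
    proof -
      have "x - m x *s e \<in> ?X"
        using x e X m by (simp add: clin_diff clin_scale vec.subspace_diff vec.subspace_scale)
      from d[OF this] have "(\<Sum>i\<in>?I. d i * (f i x - m x * f i e)) = 0"
        using f(1) by (simp add: clin_diff clin_scale)
      then have "(\<Sum>i\<in>?I. d i * f i x) - m x * (\<Sum>i\<in>?I. d i * f i e) = 0"
        by (simp only: right_diff_distrib sum_subtractf sum_distrib_left mult.left_commute)
      then show ?thesis by simp
    qed
    have "indep_on (?I - {k}) ?X f"
      unfolding indep_on_def
    proof (intro allI impI ballI)
      fix d j assume d: "\<forall>x\<in>?X. (\<Sum>i\<in>?I - {k}. d i * f i x) = 0" and j: "j \<in> ?I - {k}"
      define d0 where "d0 = d(k := 0)"
      have "(\<Sum>i\<in>?I. d0 i * f i x) = (\<Sum>i\<in>?I - {k}. d i * f i x)" for x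
        using k by (subst sum.remove[of ?I k]) (auto simp: d0_def intro!: sum.cong)
      then have d0: "(\<Sum>i\<in>?I. d0 i * f i x) = 0" if "x \<in> ?X" for x
        using d that by simp
      define D where "D = (\<Sum>i\<in>?I. d0 i * f i e)"
      define C where "C = (\<Sum>i\<in>?I. c i * f i e)"
      \<comment> \<open>On \<open>X\<close> both relations are multiples of \<open>m\<close>, with
        factors \<open>D\<close> and \<open>C\<close>. This combination cancels them, and its
        coefficient at \<open>k\<close> is \<open>- D * c k\<close>.\<close>
      have "(\<Sum>i\<in>?I. (C * d0 i - D * c i) * f i x) = 0" if "x \<in> X" for x
      proof -
        have "(\<Sum>i\<in>?I. (C * d0 i - D * c i) * f i x)
            = C * (\<Sum>i\<in>?I. d0 i * f i x) - D * (\<Sum>i\<in>?I. c i * f i x)"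
          by (simp only: left_diff_distrib sum_subtractf sum_distrib_left mult.assoc)
        also have "\<dots> = 0"
          using red[OF d0 that] red[OF c that] by (simp add: C_def D_def)
        finally show ?thesis .
      qed
      from indep_onD[OF f(2) this k(1)] have "D = 0" using k by (simp add: d0_def)
      then have "(\<Sum>i\<in>?I. d0 i * f i x) = 0" if "x \<in> X" for x
        using red[OF d0 that] by (simp add: D_def)
      from indep_onD[OF f(2) this, of j] show "d j = 0" using j by (auto simp: d0_def)
    qed
    then show ?thesis using sub k by auto
  qed
qed

lemma has_indep_UNIV: "has_indep CARD('n) (UNIV :: (complex^'n) set) {f. clin f}"
proof (rule has_indepI[of "UNIV :: 'n set" "\<lambda>i x. x $ i"])
  show "indep_on UNIV UNIV (\<lambda>i (x::complex^'n). x $ i)"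
    unfolding indep_on_def
  proof (intro allI impI ballI)
    fix c and i :: 'n assume "\<forall>x\<in>UNIV. (\<Sum>i\<in>UNIV. c i * (x::complex^'n) $ i) = 0"
    then have "(\<Sum>j\<in>UNIV. c j * (axis i 1 :: complex^'n) $ j) = 0" by blast
    then show "c i = 0" by (simp add: axis_def if_distrib cong: if_cong)
  qed
qed auto

lemma obtain_nonzero_form:
  assumes "has_indep (Suc n) X {f. clin f}"
  obtains l y where "clin l" "y \<in> X" "l y \<noteq> 0"
proof -
  obtain f where f: "\<And>i. i < Suc n \<Longrightarrow> clin (f i)" "indep_on {..<Suc n} X f"
    using has_indepE[OF assms] by auto
  have "\<exists>y\<in>X. f 0 y \<noteq> 0"
  proof (rule ccontr)
    assume "\<not> ?thesis"
    then have "(\<Sum>i<Suc n. (if i = 0 then 1 else 0) * f i x) = 0" if "x \<in> X" for x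
      using that by (intro sum.neutral) auto
    from indep_onD[OF f(2) this, of 0] show False by simp
  qed
  then show ?thesis using that f(1) by blast
qed

text \<open>If a vector \<open>y\<close> with \<open>l y \<noteq> 0\<close> is a multiple of
  \<open>w\<close>, then a nonzero vector in the kernel of \<open>l\<close> is not. For
  \<open>w = 0\<close> the result is simply a nonzero \<open>v\<close>.\<close>

lemma obtain_nonproportional:
  assumes "has_indep (Suc (Suc n)) X {f. clin f}" "vec.subspace X"
  obtains v where "v \<in> X" "\<And>c. v \<noteq> c *s w"
proof -
  obtain l y where l: "clin l" "y \<in> X" "l y \<noteq> 0"
    using obtain_nonzero_form[OF assms(1)] by metis
  show ?thesis
  proof (cases "\<exists>c. y = c *s w")
    case True
    have "has_indep (Suc n) (X \<inter> {x. l x = 0}) {f. clin f}"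
      by (rule has_indep_kernel[OF assms l(1)])
    from obtain_nonzero_form[OF this]
    obtain k z where k: "clin k" "z \<in> X \<inter> {x. l x = 0}" "k z \<noteq> 0" by blast
    from True obtain c where c: "y = c *s w" by blast
    have lw: "l w \<noteq> 0" using l(3) clin_scale[OF l(1), of c w] c by auto
    have "z \<noteq> d *s w" for d
    proof
      assume z: "z = d *s w"
      have "l z = d * l w" "k z = d * k w"
        using clin_scale[OF l(1)] clin_scale[OF k(1)] z by auto
      with lw k show False by auto
    qed
    then show ?thesis using that k(2) by blast
  qed (use that l in blast)
qed

section \<open>Linear families of quadrics\<close>

text \<open>The quadrics are \<open>p v x x\<close>. Carrying the polar form \<open>p v x y\<close>
  turns restriction to lines and division by a linear form into bilinear algebra.\<close>

definition quad_family :: "(complex^'m \<Rightarrow> complex^'n \<Rightarrow> complex^'n \<Rightarrow> complex) \<Rightarrow> bool" where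
  "quad_family p \<longleftrightarrow> (\<forall>x y. clin (\<lambda>v. p v x y)) \<and> (\<forall>v y. clin (\<lambda>x. p v x y)) \<and>
     (\<forall>v x. clin (\<lambda>y. p v x y)) \<and> (\<forall>v x y. p v x y = p v y x)"

definition members :: "(complex^'m \<Rightarrow> complex^'n \<Rightarrow> complex^'n \<Rightarrow> complex) \<Rightarrow> (complex^'n \<Rightarrow> complex) set" where
  "members p = range (\<lambda>v x. p v x x)"

text \<open>Single products rather than their sums: \<open>has_indep\<close> picks independent
  elements out of a spanning set.\<close>

definition multiples :: "(complex^'m \<Rightarrow> complex^'n \<Rightarrow> complex^'n \<Rightarrow> complex) \<Rightarrow> (complex^'n \<Rightarrow> complex) set" where
  "multiples p = {\<lambda>x. l x * p v x x | l v. clin l}"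

text \<open>Quotients by \<open>b\<close> on \<open>X\<close>: multiplying an independent set of them by \<open>b\<close> gives independent members of
  \<open>multiples p\<close> that vanish on \<open>b = 0\<close>. If \<open>p v\<close> vanishes on \<open>b = 0\<close>, then \<open>p v = b m\<close> for the linear form
  \<open>m = cofactor p b e v\<close>, where \<open>b e = 1\<close>, and all products of \<open>m\<close> with linear forms are such quotients.\<close>

definition divided :: "(complex^'m \<Rightarrow> complex^'n \<Rightarrow> complex^'n \<Rightarrow> complex) \<Rightarrow> (complex^'n) set \<Rightarrow>
    (complex^'n \<Rightarrow> complex) \<Rightarrow> (complex^'n \<Rightarrow> complex) set" where
  "divided p X b = {g. continuous_on UNIV g \<and> (\<exists>f\<in>multiples p. \<forall>x\<in>X. f x = b x * g x)}"

definition cofactor :: "(complex^'m \<Rightarrow> complex^'n \<Rightarrow> complex^'n \<Rightarrow> complex) \<Rightarrow>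
    (complex^'n \<Rightarrow> complex) \<Rightarrow> complex^'n \<Rightarrow> complex^'m \<Rightarrow> complex^'n \<Rightarrow> complex" where
  "cofactor p b e v x = 2 * p v x e - b x * p v e e"

lemma multiplesI: "clin l \<Longrightarrow> (\<lambda>x. l x * p v x x) \<in> multiples p"
  by (auto simp: multiples_def)

lemma membersI: "(\<lambda>x. p v x x) \<in> members p"
  by (auto simp: members_def)

context
  fixes p :: "complex^'m \<Rightarrow> complex^'n \<Rightarrow> complex^'n \<Rightarrow> complex"
  assumes p: "quad_family p"
begin

lemma clin_p1: "clin (\<lambda>v. p v x y)"
  and clin_p2: "clin (\<lambda>x. p v x y)"
  and clin_p3: "clin (\<lambda>y. p v x y)"
  and p_sym: "p v x y = p v y x"
  using p by (auto simp: quad_family_def)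

lemmas p_lin =
  clin_add[OF clin_p1] clin_scale[OF clin_p1] clin_add[OF clin_p2] clin_scale[OF clin_p2]
  clin_add[OF clin_p3] clin_scale[OF clin_p3] clin_0[OF clin_p1] clin_0[OF clin_p2] clin_0[OF clin_p3]
  clin_diff[OF clin_p1] clin_diff[OF clin_p2] clin_diff[OF clin_p3]

lemma continuous_p: "continuous_on S (\<lambda>x. p v x x)"
proof -
  have "p v x x = (\<Sum>i\<in>UNIV. \<Sum>j\<in>UNIV. x $ i * (x $ j * p v (axis i 1) (axis j 1)))" for x
    by (subst clin_expand[OF clin_p2]) (subst clin_expand[OF clin_p3], simp add: sum_distrib_left)
  then show ?thesis by (simp only:) (intro continuous_intros)
qed

lemma clin_cofactor: "clin b \<Longrightarrow> clin (cofactor p b e v)"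
  unfolding cofactor_def by (intro clin_minus clin_cmul clin_cmul_right clin_p2)

text \<open>\<open>p v\<close> vanishes at the projection \<open>x - b x *s e\<close> of
  \<open>x\<close> into \<open>b = 0\<close>; in the expansion there, every term other than
  \<open>p v x x\<close> has a factor \<open>b\<close>.\<close>

lemma p_eq_cofactor:
  assumes "vec.subspace X" "clin b" "e \<in> X" "b e = 1" "x \<in> X"
    and v: "\<And>x. x \<in> X \<Longrightarrow> b x = 0 \<Longrightarrow> p v x x = 0"
  shows "p v x x = b x * cofactor p b e v x"
proof -
  let ?y = "x - b x *s e"
  have "?y \<in> X" using assms(1,3,5) by (intro vec.subspace_diff vec.subspace_scale)
  moreover have "b ?y = 0" using assms(2,4) by (simp add: clin_diff clin_scale)
  ultimately have "p v ?y ?y = 0" by (rule v)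
  then have "p v x x - b x * p v x e - b x * (p v e x - b x * p v e e) = 0"
    by (simp add: p_lin algebra_simps)
  then show ?thesis by (simp add: cofactor_def p_sym[of v e x] algebra_simps)
qed

lemma members_subset_divided: "clin b \<Longrightarrow> members p \<subseteq> divided p X b"
  by (auto simp: members_def divided_def continuous_p intro!: bexI[OF _ multiplesI])

lemma cofactor_mult_in_divided:
  assumes "vec.subspace X" "clin b" "e \<in> X" "b e = 1" "clin l"
    and "\<And>x. x \<in> X \<Longrightarrow> b x = 0 \<Longrightarrow> p v x x = 0"
  shows "(\<lambda>x. cofactor p b e v x * l x) \<in> divided p X b"
  unfolding divided_def
proof (intro CollectI conjI bexI[OF _ multiplesI[of l p v]] ballI)
  show "continuous_on UNIV (\<lambda>x. cofactor p b e v x * l x)"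
    by (rule continuous_on_mult[OF clin_continuous[OF clin_cofactor[OF assms(2)]] clin_continuous[OF assms(5)]])
  fix x assume "x \<in> X"
  then have "p v x x = b x * cofactor p b e v x"
    by (rule p_eq_cofactor[OF assms(1-4) _ assms(6)])
  then show "l x * p v x x = b x * (cofactor p b e v x * l x)" by (simp only: mult_ac)
qed fact

text \<open>The products of the cofactor with linear forms give \<open>n\<close> dimensions on
  \<open>Y\<close>; the rest is counted where the cofactor vanishes. Allowing \<open>Y\<close> to be
  smaller than \<open>X\<close> lets the step be iterated.\<close>

lemma has_indep_divided_step:
  assumes X: "vec.subspace X" "clin b" "e \<in> X" "b e = 1"
    and v: "\<And>x. x \<in> X \<Longrightarrow> b x = 0 \<Longrightarrow> p v x x = 0"
    and Y: "vec.subspace Y" "Y \<subseteq> X" "y \<in> Y" "cofactor p b e v y \<noteq> 0"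
    and n: "has_indep n Y {l. clin l}"
    and k: "has_indep k (Y \<inter> {x. cofactor p b e v x = 0}) (divided p X b)"
  shows "has_indep (n + k) Y (divided p X b)"
proof (rule has_indep_mult_step[OF Y(1,3) clin_cofactor Y(4) n _ _ k])
  fix l :: "complex^'n \<Rightarrow> complex" assume "l \<in> {l. clin l}"
  then have l: "clin l" by simp
  show "continuous_on UNIV l" by (rule clin_continuous[OF l])
  show "\<exists>f\<in>divided p X b. \<forall>x\<in>Y. f x = cofactor p b e v x * l x"
    by (intro bexI[OF _ cofactor_mult_in_divided[OF X l v]] ballI refl)
qed fact

lemma has_indep_multiples_step:
  assumes X: "vec.subspace X" "clin b" "e \<in> X" "b e = 1"
    and k: "has_indep k X (divided p X b)"
    and r: "has_indep r (X \<inter> {x. b x = 0}) (multiples p)"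
  shows "has_indep (k + r) X (multiples p)"
proof (rule has_indep_mult_step[OF X(1,3,2) _ k _ _ r])
  show "b e \<noteq> 0" by (simp add: X(4))
  show "continuous_on UNIV g" and "\<exists>f\<in>multiples p. \<forall>x\<in>X. f x = b x * g x"
    if "g \<in> divided p X b" for g
    using that unfolding divided_def by blast+
qed

context
  assumes nz: "\<And>x. x \<noteq> 0 \<Longrightarrow> \<exists>v. p v x x \<noteq> 0"
begin

text \<open>On the projective line through \<open>y\<close> and \<open>u\<close>, a quadric that is
  nonzero at \<open>y\<close> still has a zero \<open>z\<close>, where some other member is
  nonzero.\<close>

lemma obtain_two_members:
  assumes "vec.subspace Y" "has_indep (Suc (Suc n)) Y {l. clin l}"
  obtains v w y z where "y \<in> Y" "z \<in> Y" "p v y y \<noteq> 0" "p v z z = 0" "p w z z \<noteq> 0"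
proof -
  obtain l y where y: "clin l" "y \<in> Y" "l y \<noteq> 0" using obtain_nonzero_form[OF assms(2)] by metis
  then have "y \<noteq> 0" using clin_0 by auto
  then obtain v where v: "p v y y \<noteq> 0" using nz by blast
  obtain u where u: "u \<in> Y" "\<And>c. u \<noteq> c *s y"
    using obtain_nonproportional[OF assms(2,1), of y] by metis
  \<comment> \<open>A root in \<open>s\<close> of the quadratic equation that makes
    \<open>p v\<close> vanish at \<open>u + s *s y\<close>.\<close>
  define s where "s = (- p v y u + csqrt (p v y u ^ 2 - p v y y * p v u u)) / p v y y"
  define z where "z = u + s *s y"
  have "(s * p v y y + p v y u)\<^sup>2 = p v y u ^ 2 - p v y y * p v u u"
    using v by (simp add: s_def)
  then have "p v y y * (s * (s * p v y y) + 2 * s * p v y u + p v u u) = 0"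
    by (simp add: power2_eq_square algebra_simps)
  then have "s * (s * p v y y) + 2 * s * p v y u + p v u u = 0" using v by simp
  then have "p v z z = 0"
    by (simp add: z_def p_lin p_sym[of v u y] algebra_simps)
  moreover have "z \<noteq> 0"
  proof
    assume "z = 0"
    then have "u = - (s *s y)" by (simp add: z_def eq_neg_iff_add_eq_0)
    then have "u = (- s) *s y" by (simp only: vector_smult_lneg)
    then show False using u(2) by blast
  qed
  moreover have "z \<in> Y"
    unfolding z_def by (intro vec.subspace_add[OF assms(1)] vec.subspace_scale[OF assms(1)] u y)
  ultimately show ?thesis using that[of y z v] nz y(2) v by blast
qed

lemma has_indep_members_2:
  assumes "vec.subspace Y" "has_indep (Suc (Suc n)) Y {l. clin l}"
  shows "has_indep 2 Y (members p)"
proof -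
  obtain v w y z where *: "y \<in> Y" "z \<in> Y" "p v y y \<noteq> 0" "p v z z = 0" "p w z z \<noteq> 0"
    using obtain_two_members[OF assms] by metis
  show ?thesis by (rule has_indep_2[where f = "\<lambda>x. p v x x" and g = "\<lambda>x. p w x x", OF membersI[of p v] membersI[of p w] *])
qed

lemma has_indep_members_1:
  assumes "has_indep (Suc n) Y {l. clin l}"
  shows "has_indep 1 Y (members p)"
proof -
  obtain l y where y: "clin l" "y \<in> Y" "l y \<noteq> 0" using obtain_nonzero_form[OF assms] by metis
  then have "y \<noteq> 0" using clin_0 by auto
  then obtain v where v: "p v y y \<noteq> 0" using nz by blast
  show ?thesis by (rule has_indep_1[where f = "\<lambda>x. p v x x", OF membersI[of p v] y(2) v])
qed

text \<open>The contributions are the multiples of the cofactor of \<open>p v\<close>, then the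
  members of the family on the zero set of that cofactor.\<close>

lemma has_indep_divided_one:
  assumes X: "vec.subspace X" "clin b" "e \<in> X" "b e = 1"
    and v: "\<And>x. x \<in> X \<Longrightarrow> b x = 0 \<Longrightarrow> p v x x = 0" and y: "y \<in> X" "p v y y \<noteq> 0"
    and n: "has_indep (Suc n) X {l. clin l}"
    and k: "\<And>Y. vec.subspace Y \<Longrightarrow> has_indep n Y {l. clin l} \<Longrightarrow> has_indep k Y (members p)"
  shows "has_indep (Suc n + k) X (divided p X b)"
proof (rule has_indep_divided_step[OF X v X(1) subset_refl y(1) _ n])
  show "cofactor p b e v y \<noteq> 0"
  proof -
    have "p v y y = b y * cofactor p b e v y" by (rule p_eq_cofactor[OF X y(1) v])
    then show ?thesis using y(2) by auto
  qed
  have c: "clin (cofactor p b e v)" by (rule clin_cofactor[OF X(2)])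
  show "has_indep k (X \<inter> {x. cofactor p b e v x = 0}) (divided p X b)"
    by (rule has_indep_mono[OF k[OF subspace_Int_kernel[OF X(1) c] has_indep_kernel[OF n X(1) c]]
        members_subset_divided[OF X(2)] subset_refl])
qed

text \<open>The two cofactors are independent linear forms. The contributions are the multiples of
  the first, those of the second on the zero set of the first, and the members of the family on the
  common zero set.\<close>

lemma has_indep_divided_two:
  assumes X: "vec.subspace X" "clin b" "e \<in> X" "b e = 1"
    and v: "\<And>x. x \<in> X \<Longrightarrow> b x = 0 \<Longrightarrow> p v x x = 0"
    and w: "\<And>x. x \<in> X \<Longrightarrow> b x = 0 \<Longrightarrow> p w x x = 0"
    and indep: "\<And>c d. (\<And>x. x \<in> X \<Longrightarrow> p (c *s v + d *s w) x x = 0) \<Longrightarrow> c = 0 \<and> d = 0"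
    and n: "has_indep (Suc (Suc n)) X {l. clin l}"
    and k: "\<And>Y. vec.subspace Y \<Longrightarrow> has_indep n Y {l. clin l} \<Longrightarrow> has_indep k Y (members p)"
  shows "has_indep (Suc (Suc n) + (Suc n + k)) X (divided p X b)"
proof -
  let ?m = "cofactor p b e v" and ?m' = "cofactor p b e w"
  have c: "clin ?m" "clin ?m'" by (rule clin_cofactor[OF X(2)])+
  have comb: "p (c *s v + d *s w) x x = b x * (c * ?m x + d * ?m' x)" if "x \<in> X" for c d x
  proof -
    have "p v x x = b x * ?m x" by (rule p_eq_cofactor[OF X that v])
    moreover have "p w x x = b x * ?m' x" by (rule p_eq_cofactor[OF X that w])
    ultimately
    show ?thesis by (simp add: p_lin distrib_left mult_ac)
  qed
  have ind: "\<exists>x\<in>X. c * ?m x + d * ?m' x \<noteq> 0" if "c \<noteq> 0 \<or> d \<noteq> 0" for c d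
  proof (rule ccontr)
    assume "\<not> ?thesis"
    then have "p (c *s v + d *s w) x x = 0" if "x \<in> X" for x
      using comb[OF that, of c d] that by auto
    then show False using indep[of c d] that by blast
  qed
  obtain y where y: "y \<in> X" "?m y \<noteq> 0" using ind[of 1 0] by auto
  \<comment> \<open>The nonzero value is the determinant of \<open>?m\<close> and \<open>?m'\<close>
    at \<open>y\<close> and \<open>x\<close>. Moving \<open>x\<close> along \<open>y\<close> into
    \<open>?m = 0\<close> then leaves \<open>?m'\<close> nonzero.\<close>
  obtain x where x: "x \<in> X" "- ?m' y * ?m x + ?m y * ?m' x \<noteq> 0" using ind[of "- ?m' y" "?m y"] y(2) by blast
  let ?Y = "X \<inter> {x. ?m x = 0}"
  define z where "z = x - (?m x / ?m y) *s y"
  have "?m z = 0"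
    using y(2) by (simp add: z_def clin_diff[OF c(1)] clin_scale[OF c(1)])
  moreover have "z \<in> X"
    unfolding z_def by (intro vec.subspace_diff[OF X(1)] vec.subspace_scale[OF X(1)] x y)
  ultimately have z: "z \<in> ?Y" by simp
  have "?m y * ?m' z = - ?m' y * ?m x + ?m y * ?m' x"
    using y(2) by (simp add: z_def clin_diff[OF c(2)] clin_scale[OF c(2)] right_diff_distrib)
  then have z': "?m' z \<noteq> 0" using x(2) by auto
  have Y: "vec.subspace ?Y" by (rule subspace_Int_kernel[OF X(1) c(1)])
  have nY: "has_indep (Suc n) ?Y {l. clin l}" by (rule has_indep_kernel[OF n X(1) c(1)])
  show ?thesis
  proof (rule has_indep_divided_step[OF X v X(1) subset_refl y(1,2) n])
    show "has_indep (Suc n + k) ?Y (divided p X b)"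
    proof (rule has_indep_divided_step[OF X w Y _ z z' nY])
      show "has_indep k (?Y \<inter> {x. ?m' x = 0}) (divided p X b)"
        by (rule has_indep_mono[OF k[OF subspace_Int_kernel[OF Y c(2)] has_indep_kernel[OF nY Y c(2)]]
            members_subset_divided[OF X(2)] subset_refl])
    qed auto
  qed
qed

end

end

lemma combination_eq_0:
  fixes v w :: "complex^'m"
  assumes "c *s v + d *s w = 0" "v \<noteq> 0" "\<And>c. w \<noteq> c *s v"
  shows "c = 0 \<and> d = 0"
proof (cases "d = 0")
  case True
  with assms(1,2) show ?thesis by simp
next
  case False
  have "w = (- c / d) *s v"
    unfolding vec_eq_iff
  proof
    fix i
    have "(c *s v + d *s w) $ i = 0" using assms(1) by simp
    then have "d * w $ i = - (c * v $ i)" by (simp add: eq_neg_iff_add_eq_0 add.commute)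
    then show "w $ i = ((- c / d) *s v) $ i" using False by (simp add: field_simps)
  qed
  with assms(3) show ?thesis by blast
qed

section \<open>Cubics generated by a family of quadrics in four variables without a common
  zero\<close>

context
  fixes p :: "complex^5 \<Rightarrow> complex^4 \<Rightarrow> complex^4 \<Rightarrow> complex"
  assumes p: "quad_family p" and nz: "\<And>x. x \<noteq> 0 \<Longrightarrow> \<exists>v. p v x x \<noteq> 0"
begin

text \<open>Projectively these are a plane and a line in 3-space; their vector space dimensions are
  3 and 2.\<close>

abbreviation (input) "hyper4 \<equiv> {x :: complex^4. x $ 4 = 0}"
abbreviation (input) "plane4 \<equiv> hyper4 \<inter> {x. x $ 3 = 0}"

lemma hyper4: "vec.subspace hyper4" "has_indep 3 hyper4 {l. clin l}"
  and plane4: "vec.subspace plane4" "has_indep 2 plane4 {l. clin l}"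
proof -
  have U: "vec.subspace (UNIV :: (complex^4) set)" by simp
  have 4: "has_indep (Suc 3) (UNIV :: (complex^4) set) {l. clin l}"
    using has_indep_UNIV[where 'n = 4] by (simp add: numeral_eq_Suc)
  show 1: "vec.subspace hyper4" using subspace_Int_kernel[OF U clin_component[of 4]] by simp
  show 2: "has_indep 3 hyper4 {l. clin l}" using has_indep_kernel[OF 4 U clin_component[of 4]] by simp
  show "vec.subspace plane4" by (rule subspace_Int_kernel[OF 1 clin_component])
  have "has_indep (Suc 2) hyper4 {l. clin l}" using 2 by (simp add: numeral_eq_Suc)
  from has_indep_kernel[OF this 1 clin_component]
  show "has_indep 2 plane4 {l. clin l}" .
qed

lemma line_in_plane4:
  assumes "x \<in> plane4" "z \<in> plane4" "z \<noteq> 0" "x $ 1 * z $ 2 - x $ 2 * z $ 1 = 0"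
  shows "\<exists>c. x = c *s z"
proof (cases "z $ 1 = 0")
  case True
  then have "z $ 2 \<noteq> 0" using assms(2,3) by (auto simp: vec_eq_iff forall_4)
  then have "x = (x $ 2 / z $ 2) *s z"
    using assms True by (auto simp: vec_eq_iff forall_4)
  then show ?thesis ..
next
  case False
  then have "x = (x $ 1 / z $ 1) *s z"
    using assms by (auto simp: vec_eq_iff forall_4 field_simps)
  then show ?thesis ..
qed

text \<open>All binary cubics arise. A member vanishing at \<open>z\<close> is a product of
  \<open>d\<close> and a cofactor; the quotients by \<open>d\<close> give 2 dimensions from
  multiples of the cofactor and 1 on its zero set, and a member nonzero at \<open>z\<close> gives
  the fourth.\<close>

lemma has_indep_multiples_plane4: "has_indep 4 plane4 (multiples p)"
proof -
  have C2: "has_indep (Suc (Suc 0)) plane4 {l. clin l}" using plane4(2) by (simp add: numeral_eq_Suc)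
  obtain v w y z where yz: "y \<in> plane4" "z \<in> plane4" "p v y y \<noteq> 0" "p v z z = 0" "p w z z \<noteq> 0"
    using obtain_two_members[OF p nz plane4(1) C2] by metis
  have z0: "z \<noteq> 0" using yz(5) p_lin[OF p] by auto
  \<comment> \<open>On \<open>plane4\<close> the zeros of \<open>d\<close> are the multiples of
    \<open>z\<close>.\<close>
  define d where "d x = x $ 1 * z $ 2 - x $ 2 * z $ 1" for x :: "complex^4"
  have d: "clin d" unfolding d_def by simp
  have v0: "p v x x = 0" if x: "x \<in> plane4" "d x = 0" for x
  proof -
    obtain c where "x = c *s z" using line_in_plane4[OF x(1) yz(2) z0] x(2) unfolding d_def by blast
    then show ?thesis using yz(4) by (simp add: p_lin[OF p])
  qed
  have dy: "d y \<noteq> 0" using v0[OF yz(1)] yz(3) by blast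
  define e where "e = (1 / d y) *s y"
  have e: "e \<in> plane4" "d e = 1"
    using dy by (simp_all add: e_def clin_scale[OF d] vec.subspace_scale[OF plane4(1) yz(1)])
      (use yz(1) in auto)
  have "has_indep (Suc 1 + 1) plane4 (divided p plane4 d)"
  proof (rule has_indep_divided_one[OF p nz plane4(1) d e v0 yz(1,3)])
    show "has_indep (Suc 1) plane4 {l. clin l}" using C2 by simp
    show "has_indep 1 Y (members p)" if "has_indep 1 Y {l. clin l}" for Y
      by (rule has_indep_members_1[OF p nz, of 0]) (use that in simp_all)
  qed
  moreover have "has_indep 1 (plane4 \<inter> {x. d x = 0}) (multiples p)"
  proof -
    obtain i where i: "z $ i \<noteq> 0" using z0 by (auto simp: vec_eq_iff)
    show ?thesis
      by (rule has_indep_1[of "\<lambda>x. x $ i * p w x x", OF multiplesI[OF clin_component[of i], of p w], of z])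
        (use i yz in \<open>auto simp: d_def\<close>)
  qed
  ultimately have "has_indep (Suc 1 + 1 + 1) plane4 (multiples p)"
    by (rule has_indep_multiples_step[OF p plane4(1) d e])
  then show ?thesis by (simp add: numeral_eq_Suc)
qed

text \<open>A binary quadric has three coefficients, so vanishing on \<open>plane4\<close> is three
  linear conditions on five parameters and leaves at least two dimensions.\<close>

lemma obtain_vanishing_on_plane4:
  obtains v where "\<And>x. x \<in> plane4 \<Longrightarrow> p v x x = 0" "\<And>c. v \<noteq> c *s w"
proof -
  let ?a = "axis 1 1 :: complex^4" and ?b = "axis 2 1 :: complex^4"
  let ?K1 = "UNIV \<inter> {v. p v ?a ?a = 0}"
  let ?K2 = "?K1 \<inter> {v. p v ?a ?b = 0}"
  let ?K3 = "?K2 \<inter> {v. p v ?b ?b = 0}"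
  have 0: "has_indep (Suc (Suc (Suc (Suc (Suc 0))))) (UNIV :: (complex^5) set) {l. clin l}"
    using has_indep_UNIV[where 'n = 5] by (simp add: numeral_eq_Suc)
  have U: "vec.subspace (UNIV :: (complex^5) set)" by simp
  note cl = clin_p1[OF p]
  have s1: "vec.subspace ?K1" by (rule subspace_Int_kernel[OF U cl])
  have s2: "vec.subspace ?K2" by (rule subspace_Int_kernel[OF s1 cl])
  have s3: "vec.subspace ?K3" by (rule subspace_Int_kernel[OF s2 cl])
  note 1 = has_indep_kernel[OF 0 U cl[of ?a ?a]]
  note 2 = has_indep_kernel[OF 1 s1 cl[of ?a ?b]]
  note 3 = has_indep_kernel[OF 2 s2 cl[of ?b ?b]]
  obtain v where v: "v \<in> ?K3" "\<And>c. v \<noteq> c *s w"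
    using obtain_nonproportional[OF 3 s3] by metis
  have "p v x x = 0" if "x \<in> plane4" for x
  proof -
    have x: "x = x $ 1 *s ?a + x $ 2 *s ?b"
      using that by (simp add: vec_eq_iff forall_4 axis_def)
    show ?thesis
      by (subst x, subst (2) x) (use v(1) in \<open>simp add: p_lin[OF p] p_sym[OF p, of v ?b ?a]\<close>)
  qed
  then show ?thesis using that v(2) by blast
qed

lemma axis3: "axis 3 1 \<in> hyper4" "(axis 3 1 :: complex^4) $ 3 = 1"
  by (simp_all add: axis_def)

lemma has_indep_multiples_hyper4_step:
  assumes "has_indep k hyper4 (divided p hyper4 (\<lambda>x. x $ 3))"
  shows "has_indep (k + 4) hyper4 (multiples p)"
  by (rule has_indep_multiples_step[OF p hyper4(1) clin_component axis3 assms has_indep_multiples_plane4])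

lemma has_indep_members_2': "vec.subspace Y \<Longrightarrow> has_indep 2 Y {l. clin l} \<Longrightarrow> has_indep 2 Y (members p)"
  by (rule has_indep_members_2[OF p nz, of _ 0]) (simp_all add: numeral_eq_Suc)

lemma has_indep_hyper4: "has_indep (Suc 2) hyper4 {l. clin l}" "has_indep (Suc (Suc 1)) hyper4 {l. clin l}"
  using hyper4(2) by (simp_all add: numeral_eq_Suc)

text \<open>The sum 2 + 4: two independent members times \<open>x $ 3\<close>, and the four cubics
  on \<open>plane4\<close>.\<close>

lemma has_indep_multiples_hyper4: "has_indep 6 hyper4 (multiples p)"
proof -
  have "has_indep 2 hyper4 (members p)"
    by (rule has_indep_members_2'[OF hyper4(1) has_indep_le[OF hyper4(2)]]) simp
  from has_indep_multiples_hyper4_step[OF has_indep_mono[OF this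
      members_subset_divided[OF p clin_component] subset_refl]]
  show ?thesis by simp
qed

text \<open>The quotients by \<open>x $ 3\<close> now number 3 + 2: the multiples of the cofactor of
  \<open>p v\<close>, and two members on its zero set. The other 4 come from
  \<open>plane4\<close>.\<close>

lemma has_indep_multiples_hyper4_1:
  assumes "\<And>x. x \<in> plane4 \<Longrightarrow> p v x x = 0" "y \<in> hyper4" "p v y y \<noteq> 0"
  shows "has_indep 9 hyper4 (multiples p)"
proof -
  have "has_indep (Suc 2 + 2) hyper4 (divided p hyper4 (\<lambda>x. x $ 3))"
    by (rule has_indep_divided_one[OF p nz hyper4(1) clin_component axis3 _ assms(2,3) has_indep_hyper4(1)
        has_indep_members_2']) (use assms(1) in auto)
  from has_indep_multiples_hyper4_step[OF this] show ?thesis by simp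
qed

text \<open>All ternary cubics arise: the quotients by \<open>x $ 3\<close> fill the 6 = 3 + 2 + 1
  dimensions of the ternary quadrics, and \<open>plane4\<close> adds 4.\<close>

lemma has_indep_multiples_hyper4_2:
  assumes "\<And>x. x \<in> plane4 \<Longrightarrow> p v x x = 0" "\<And>x. x \<in> plane4 \<Longrightarrow> p w x x = 0"
    and "\<And>c d. (\<And>x. x \<in> hyper4 \<Longrightarrow> p (c *s v + d *s w) x x = 0) \<Longrightarrow> c = 0 \<and> d = 0"
  shows "has_indep 10 hyper4 (multiples p)"
proof -
  have "has_indep (Suc (Suc 1) + (Suc 1 + 1)) hyper4 (divided p hyper4 (\<lambda>x. x $ 3))"
  proof (rule has_indep_divided_two[OF p nz hyper4(1) clin_component axis3, of v w])
    show "has_indep (Suc (Suc 1)) hyper4 {l. clin l}" by (rule has_indep_hyper4(2))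
    show "c = 0 \<and> d = 0" if "\<And>x. x \<in> hyper4 \<Longrightarrow> p (c *s v + d *s w) x x = 0" for c d
      by (rule assms(3)[OF that])
    show "has_indep 1 Y (members p)" if "has_indep 1 Y {l. clin l}" for Y
      by (rule has_indep_members_1[OF p nz, of 0]) (use that in simp_all)
  qed (use assms(1,2) in auto)
  from has_indep_multiples_hyper4_step[OF this] show ?thesis by simp
qed

lemma has_indep_multiples_UNIV_step:
  assumes "has_indep k UNIV (divided p UNIV (\<lambda>x. x $ 4))" "has_indep r hyper4 (multiples p)"
  shows "has_indep (k + r) UNIV (multiples p)"
  by (rule has_indep_multiples_step[OF p vec.subspace_UNIV clin_component _ _ assms(1), of "axis 4 1"])
    (use assms(2) in \<open>simp_all add: axis_def\<close>)

text \<open>Let \<open>N\<close> consist of the parameters whose quadric is divisible by the last coordinate. The more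
  such quadrics there are, the smaller the family is on the hyperplane, but the more quotients
  there are: the count is \<open>5 + 10\<close>, \<open>6 + 9\<close> or \<open>9 + 6\<close> if \<open>dim N\<close> is 0, 1 or at least 2.\<close>

lemma has_indep_multiples_15:
  assumes inj: "\<And>v. (\<And>x. p v x x = 0) \<Longrightarrow> v = 0"
  shows "has_indep 15 UNIV (multiples p)"
proof -
  let ?N = "{v. \<forall>x\<in>hyper4. p v x x = 0}"
  have e: "(axis 4 1 :: complex^4) $ 4 = 1" by simp
  have U: "has_indep (Suc 3) (UNIV :: (complex^4) set) {l. clin l}"
      "has_indep (Suc (Suc 2)) (UNIV :: (complex^4) set) {l. clin l}"
    using has_indep_UNIV[where 'n = 4] by (simp_all add: numeral_eq_Suc)
  consider (zero) "?N \<subseteq> {0}"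
    | (one) v where "v \<in> ?N" "v \<noteq> 0" "\<And>w. w \<in> ?N \<Longrightarrow> \<exists>c. w = c *s v"
    | (two) v w where "v \<in> ?N" "w \<in> ?N" "v \<noteq> 0" "\<And>c. w \<noteq> c *s v"
    by blast
  then show ?thesis
  proof cases
    case zero
    \<comment> \<open>Excluding multiples of 0 makes \<open>v\<close> nonzero. As no nonzero
      parameter gives a quadric vanishing on \<open>hyper4\<close>, \<open>v\<close> and
      \<open>w\<close> remain independent there.\<close>
    obtain v where v: "\<And>x. x \<in> plane4 \<Longrightarrow> p v x x = 0" "\<And>c. v \<noteq> c *s 0"
      using obtain_vanishing_on_plane4[of 0] by metis
    obtain w where w: "\<And>x. x \<in> plane4 \<Longrightarrow> p w x x = 0" "\<And>c. w \<noteq> c *s v"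
      using obtain_vanishing_on_plane4[of v] by metis
    have "has_indep 10 hyper4 (multiples p)"
    proof (rule has_indep_multiples_hyper4_2[OF v(1) w(1)])
      fix c d assume "\<And>x. x \<in> hyper4 \<Longrightarrow> p (c *s v + d *s w) x x = 0"
      then have "c *s v + d *s w = 0" using zero by blast
      then show "c = 0 \<and> d = 0" by (rule combination_eq_0[OF _ _ w(2)]) (use v(2) in auto)
    qed
    moreover have "has_indep (card (UNIV :: 5 set)) UNIV (members p)"
    proof (rule has_indepI[of _ "\<lambda>i x. p (axis i 1) x x"])
      show "indep_on UNIV UNIV (\<lambda>i x. p (axis i 1) x x)"
        unfolding indep_on_def
      proof (intro allI impI ballI)
        fix c :: "5 \<Rightarrow> complex" and i assume c: "\<forall>x\<in>UNIV. (\<Sum>i\<in>UNIV. c i * p (axis i 1) x x) = 0"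
        have "p (\<chi> i. c i) x x = 0" for x
          using c by (subst clin_expand[OF clin_p1[OF p]]) simp
        then have "(\<chi> i. c i) = 0" by (rule inj)
        then show "c i = 0" by (simp add: vec_eq_iff)
      qed
    qed (auto intro: membersI)
    ultimately have "has_indep (card (UNIV :: 5 set) + 10) UNIV (multiples p)"
      by (intro has_indep_multiples_UNIV_step has_indep_mono[OF _
          members_subset_divided[OF p clin_component] subset_refl])
    then show ?thesis by simp
  next
    case (one v)
    obtain w where w: "\<And>x. x \<in> plane4 \<Longrightarrow> p w x x = 0" "\<And>c. w \<noteq> c *s v"
      using obtain_vanishing_on_plane4[of v] by metis
    have "w \<notin> ?N" using one(3) w(2) by blast
    then obtain y where y: "y \<in> hyper4" "p w y y \<noteq> 0" by blast
    obtain y' where y': "p v y' y' \<noteq> 0" using inj[of v] one(2) by blast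
    \<comment> \<open>Four multiples of the cofactor of \<open>p v\<close>, and two members on its
      zero set.\<close>
    have "has_indep (Suc 3 + 2) UNIV (divided p UNIV (\<lambda>x. x $ 4))"
    proof (rule has_indep_divided_one[OF p nz vec.subspace_UNIV clin_component UNIV_I e _ UNIV_I y' U(1)])
      show "has_indep 2 Y (members p)" if "vec.subspace Y" "has_indep 3 Y {l. clin l}" for Y
        by (rule has_indep_members_2'[OF that(1) has_indep_le[OF that(2)]]) simp
    qed (use one in auto)
    from has_indep_multiples_UNIV_step[OF this has_indep_multiples_hyper4_1[OF w(1) y]]
    show ?thesis by simp
  next
    case (two v w)
    \<comment> \<open>Four multiples of one cofactor, three of the other on the zero set of the
      first, and two members on the common zero set.\<close>
    have "has_indep (Suc (Suc 2) + (Suc 2 + 2)) UNIV (divided p UNIV (\<lambda>x. x $ 4))"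
    proof (rule has_indep_divided_two[OF p nz vec.subspace_UNIV clin_component UNIV_I e _ _ _ U(2) has_indep_members_2'])
      fix c d assume "\<And>x. x \<in> UNIV \<Longrightarrow> p (c *s v + d *s w) x x = 0"
      then have "c *s v + d *s w = 0" by (intro inj) simp
      then show "c = 0 \<and> d = 0" by (rule combination_eq_0[OF _ two(3,4)])
    qed (use two in auto)
    from has_indep_multiples_UNIV_step[OF this has_indep_multiples_hyper4]
    show ?thesis by simp
  qed
qed

end

section \<open>Multiplication of linear forms by a quadric\<close>

text \<open>Arbitrary matrices represent quadrics redundantly, but the parameter space is then all
  of \<open>complex^5^5\<close>, where open sets and negligible sets can be compared.\<close>

definition quad_form :: "complex^5^5 \<Rightarrow> complex^5 \<Rightarrow> complex" where
  "quad_form M x = (\<Sum>i\<in>UNIV. \<Sum>j\<in>UNIV. M $ i $ j * (x $ i * x $ j))"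

definition bilinear_form :: "complex^5^5 \<Rightarrow> complex^5 \<Rightarrow> complex^5 \<Rightarrow> complex" where
  "bilinear_form M x y = (\<Sum>i\<in>UNIV. \<Sum>j\<in>UNIV. M $ i $ j * ((x $ i * y $ j + x $ j * y $ i) / 2))"

lemma bilinear_form_same: "bilinear_form M x x = quad_form M x"
  unfolding bilinear_form_def quad_form_def by (simp add: mult.commute)

lemma bilinear_form_sym: "bilinear_form M x y = bilinear_form M y x"
  unfolding bilinear_form_def by (simp add: algebra_simps)

lemma clin_sum': "(\<And>i. i \<in> I \<Longrightarrow> clin (f i)) \<Longrightarrow> clin (\<lambda>x. \<Sum>i\<in>I. f i x)"
  by (induction I rule: infinite_finite_induct) auto

lemma clin_bilinear_form: "clin (\<lambda>x. bilinear_form M x y)" "clin (\<lambda>y. bilinear_form M x y)"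
proof -
  show 1: "clin (\<lambda>x. bilinear_form M x y)" for y
  proof -
    have "clin (\<lambda>x. (x $ i * y $ j + x $ j * y $ i) / 2)" for i j
      using clin_cmul_right[OF clin_plus[OF clin_cmul_right[OF clin_component[of i]]
        clin_cmul_right[OF clin_component[of j]]], of "y $ j" "y $ i" "1 / 2"] by simp
    then show ?thesis unfolding bilinear_form_def by (intro clin_sum' clin_cmul)
  qed
  show "clin (\<lambda>y. bilinear_form M x y)"
    by (subst bilinear_form_sym) (rule 1)
qed

lemma quad_form_add_scale:
  "quad_form (\<chi> i j. M $ i $ j + t * N $ i $ j) x = quad_form M x + t * quad_form N x"
  unfolding quad_form_def
  by (simp add: distrib_right sum.distrib sum_distrib_left mult.assoc)

lemma clin_product_eq_quad_form:
  assumes "clin l" "clin m"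
  shows "l x * m x = quad_form (\<chi> i j. l (axis i 1) * m (axis j 1)) x"
  unfolding quad_form_def clin_expand[OF assms(1), of x] clin_expand[OF assms(2), of x]
  by (simp add: sum_product mult_ac)

definition products :: "(complex^'n \<Rightarrow> complex) set" where
  "products = {\<lambda>x. l x * m x | l m. clin l \<and> clin m}"

text \<open>The multiples of one linear form contribute the dimension of \<open>X\<close>; the
  products on its zero set follow by induction. The total is the dimension of the quadratic forms in
  \<open>n\<close> variables.\<close>

lemma has_indep_products:
  fixes X :: "(complex^'n) set"
  assumes "has_indep n X {l. clin l}" "vec.subspace X"
  shows "has_indep (n * (n + 1) div 2) X products"
  using assms
proof (induction n arbitrary: X)
  case 0
  show ?case by (simp add: has_indep_0)
next
  case (Suc n)
  obtain m e where m: "clin m" "e \<in> X" "m e \<noteq> 0" using obtain_nonzero_form[OF Suc.prems(1)] by metis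
  have "has_indep (n * (n + 1) div 2) (X \<inter> {x. m x = 0}) products"
    by (rule Suc.IH[OF has_indep_kernel[OF Suc.prems m(1)] subspace_Int_kernel[OF Suc.prems(2) m(1)]])
  then have "has_indep (Suc n + n * (n + 1) div 2) X products"
  proof (rule has_indep_mult_step[OF Suc.prems(2) m(2,1,3) Suc.prems(1), rotated 2])
    fix l :: "complex^'n \<Rightarrow> complex" assume "l \<in> {l. clin l}"
    then have l: "clin l" by simp
    show "continuous_on UNIV l" by (rule clin_continuous[OF l])
    show "\<exists>f\<in>products. \<forall>x\<in>X. f x = m x * l x"
      using l m(1) by (intro bexI[of _ "\<lambda>x. m x * l x"]) (auto simp: products_def)
  qed
  moreover have "Suc n * (Suc n + 1) div 2 = Suc n + n * (n + 1) div 2"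
  proof -
    have "Suc n * (Suc n + 1) = n * (n + 1) + Suc n * 2" by (simp add: algebra_simps)
    then show ?thesis by simp
  qed
  ultimately show ?case by simp
qed

text \<open>The form \<open>a\<close> and the coordinates other than \<open>k\<close> are a basis of
  the linear forms. In a generating set this lets the multiples of \<open>a\<close> be split
  off.\<close>

lemma clin_eliminate:
  assumes "clin a" "clin l" "a (axis k 1) \<noteq> 0"
  shows "l x = l (axis k 1) / a (axis k 1) * a x +
    (\<Sum>i\<in>UNIV - {k}. (l (axis i 1) - l (axis k 1) * a (axis i 1) / a (axis k 1)) * x $ i)"
proof -
  let ?c = "l (axis k 1) / a (axis k 1)"
  have "l x - ?c * a x = (\<Sum>i\<in>UNIV. x $ i * (l (axis i 1) - ?c * a (axis i 1)))"
    unfolding clin_expand[OF assms(1), of x] clin_expand[OF assms(2), of x]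
    by (simp add: right_diff_distrib sum_subtractf sum_distrib_left mult_ac)
  also have "\<dots> = (\<Sum>i\<in>UNIV - {k}. x $ i * (l (axis i 1) - ?c * a (axis i 1)))"
    using assms(3) by (subst sum.remove[of _ k]) auto
  finally show ?thesis by (simp add: algebra_simps)
qed

lemma obtain_nonzero_coefficient:
  assumes "clin a" "a e \<noteq> 0"
  obtains k where "a (axis k 1) \<noteq> 0"
proof -
  have "\<exists>k. a (axis k 1) \<noteq> 0"
  proof (rule ccontr)
    assume "\<not> ?thesis"
    then have "a e = 0" by (subst clin_expand[OF assms(1)]) simp
    with assms(2) show False by simp
  qed
  then show ?thesis using that by blast
qed

lemma has_indep_pullback:
  assumes "has_indep n UNIV M" "\<And>y. j y \<in> X" "\<And>f. f \<in> M \<Longrightarrow> \<exists>g\<in>N. \<forall>y. g (j y) = f y"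
  shows "has_indep n X N"
proof -
  obtain f where f: "\<And>i. i < n \<Longrightarrow> f i \<in> M" "indep_on {..<n} UNIV f"
    using has_indepE[OF assms(1)] by metis
  have "\<forall>i\<in>{..<n}. \<exists>g. g \<in> N \<and> (\<forall>y. g (j y) = f i y)"
    using assms(3) f(1) by blast
  from bchoice[OF this] obtain g where
    g: "\<And>i. i < n \<Longrightarrow> g i \<in> N" "\<And>i y. i < n \<Longrightarrow> g i (j y) = f i y" by blast
  have "indep_on {..<n} X g"
    unfolding indep_on_def
  proof (intro allI impI)
    fix c assume c: "\<forall>x\<in>X. (\<Sum>i<n. c i * g i x) = 0"
    have "(\<Sum>i<n. c i * f i y) = 0" for y
      using bspec[OF c assms(2)[of y]] g(2) by simp
    then show "\<forall>i\<in>{..<n}. c i = 0" using indep_onD[OF f(2), of c] by blast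
  qed
  then show ?thesis unfolding has_indep_def using g(1) by blast
qed

text \<open>The counts in four variables live on \<open>complex^4\<close>; \<open>r\<close> forgets
  the coordinate \<open>k\<close>, and \<open>j\<close> recovers it from
  \<open>a = 0\<close>.\<close>

lemma hyperplane_parametrization:
  fixes a :: "complex^5 \<Rightarrow> complex"
  assumes "clin a" "a (axis k 1) \<noteq> 0"
  shows "\<exists>(j :: complex^4 \<Rightarrow> complex^5) (r :: complex^5 \<Rightarrow> complex^4).
    (\<forall>i. clin (\<lambda>y. j y $ i)) \<and> (\<forall>s. clin (\<lambda>x. r x $ s)) \<and> (\<forall>y. r (j y) = y) \<and>
    (\<forall>y. a (j y) = 0) \<and> (\<forall>x. a x = 0 \<longrightarrow> j (r x) = x)"
proof -
  have "card (UNIV :: 4 set) = card (UNIV - {k})" by (simp add: card_Diff_singleton)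
  then obtain h where h: "bij_betw h (UNIV :: 4 set) (UNIV - {k})"
    using finite_same_card_bij[of "UNIV :: 4 set" "UNIV - {k}"] by auto
  define g where "g = the_inv_into UNIV h"
  have inj: "inj h" and hk: "h s \<noteq> k" for s using h by (auto simp: bij_betw_def)
  have gh: "g (h s) = s" for s unfolding g_def by (rule the_inv_into_f_f[OF inj UNIV_I])
  have hg: "h (g i) = i" if "i \<noteq> k" for i
    unfolding g_def by (rule f_the_inv_into_f[OF inj]) (use h that in \<open>auto simp: bij_betw_def\<close>)
  define r where "r x = (\<chi> s. x $ h s)" for x :: "complex^5"
  define j where "j y = (\<chi> i. if i = k then - (\<Sum>i\<in>UNIV - {k}. a (axis i 1) * y $ g i) / a (axis k 1)
      else y $ g i)" for y :: "complex^4"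
  have ax: "a x = x $ k * a (axis k 1) + (\<Sum>i\<in>UNIV - {k}. x $ i * a (axis i 1))" for x
    by (subst clin_expand[OF assms(1)]) (rule sum.remove, auto)
  show ?thesis
  proof (intro exI[of _ j] exI[of _ r] conjI allI impI)
    show "clin (\<lambda>y. j y $ i)" for i
    proof (cases "i = k")
      case True
      then have "j y $ i = (- 1 / a (axis k 1)) * (\<Sum>i\<in>UNIV - {k}. a (axis i 1) * y $ g i)" for y
        by (simp add: j_def)
      then show ?thesis by (simp only:) (intro clin_cmul clin_sum' clin_component)
    qed (simp add: j_def)
    show "clin (\<lambda>x. r x $ s)" for s by (simp add: r_def)
    show "r (j y) = y" for y by (simp add: vec_eq_iff r_def j_def hk gh)
    show "a (j y) = 0" for y
    proof -
      have "(\<Sum>i\<in>UNIV - {k}. j y $ i * a (axis i 1)) = (\<Sum>i\<in>UNIV - {k}. a (axis i 1) * y $ g i)"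
        by (intro sum.cong) (auto simp: j_def)
      moreover have "j y $ k * a (axis k 1) = - (\<Sum>i\<in>UNIV - {k}. a (axis i 1) * y $ g i)"
        using assms(2) by (simp add: j_def)
      ultimately show ?thesis unfolding ax[of "j y"] by simp
    qed
    show "j (r x) = x" if "a x = 0" for x
    proof -
      have "(\<Sum>i\<in>UNIV - {k}. a (axis i 1) * r x $ g i) = (\<Sum>i\<in>UNIV - {k}. x $ i * a (axis i 1))"
        by (intro sum.cong) (auto simp: r_def hg)
      also have "\<dots> = - (x $ k * a (axis k 1))" using that ax[of x] by (simp add: eq_neg_iff_add_eq_0 add.commute)
      finally show ?thesis using assms(2) by (simp add: vec_eq_iff j_def r_def hg)
    qed
  qed
qed

lemma clin_comp:
  assumes "clin l" "\<And>i. clin (\<lambda>x. r x $ i)"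
  shows "clin (\<lambda>x. l (r x))"
proof -
  have "r (x + y) = r x + r y" "r (c *s x) = c *s r x" for x y c
    using assms(2) by (auto simp: vec_eq_iff clin_def)
  then show ?thesis using assms(1) by (simp add: clin_def)
qed

lemma polarize_0:
  assumes p: "quad_family p" and X: "vec.subspace X"
    and v: "\<And>x. x \<in> X \<Longrightarrow> p v x x = 0" and xy: "x \<in> X" "y \<in> X"
  shows "p v x y = 0"
proof -
  have "p v (x + y) (x + y) = 0" by (intro v vec.subspace_add[OF X] xy)
  then have "2 * p v x y = 0"
    using v[OF xy(1)] v[OF xy(2)] by (simp add: p_lin[OF p] p_sym[OF p, of v y x])
  then show ?thesis by simp
qed

section \<open>Cubics spanned by a quadric and a family; quadrics of maximal rank\<close>

definition in_cubic_part :: "(complex^5 \<Rightarrow> complex^5 \<Rightarrow> complex^5 \<Rightarrow> complex) \<Rightarrow> (complex^5 \<Rightarrow> complex) \<Rightarrow> bool" where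
  "in_cubic_part \<Phi> f \<longleftrightarrow> (\<exists>L. (\<forall>i. clin (L i)) \<and> (\<forall>x. f x = (\<Sum>i\<in>UNIV. L i x * \<Phi> (axis i 1) x x)))"

text \<open>This is \<open>V Q + J\<^sub>3\<close> once \<open>\<Phi>\<close> is the polarization of
  the cubic, because \<open>\<Phi> (axis i 1) x x\<close> is then proportional to a partial
  derivative.\<close>

definition cubic_span :: "(complex^5 \<Rightarrow> complex^5 \<Rightarrow> complex^5 \<Rightarrow> complex) \<Rightarrow> complex^5^5 \<Rightarrow> (complex^5 \<Rightarrow> complex) set" where
  "cubic_span \<Phi> M = {f. \<exists>l g. clin l \<and> in_cubic_part \<Phi> g \<and> f = (\<lambda>x. l x * quad_form M x + g x)}"

text \<open>The upper bound ranges over all quadrics, so only the first conjunct depends on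
  \<open>M\<close>, and it persists under small perturbations.\<close>

definition maximal_rank :: "(complex^5 \<Rightarrow> complex^5 \<Rightarrow> complex^5 \<Rightarrow> complex) \<Rightarrow> nat \<Rightarrow> complex^5^5 \<Rightarrow> bool" where
  "maximal_rank \<Phi> n M \<longleftrightarrow> has_indep n UNIV (cubic_span \<Phi> M) \<and> (\<forall>N. \<not> has_indep (Suc n) UNIV (cubic_span \<Phi> N))"

lemma filterlim_line:
  "filterlim (\<lambda>t. \<chi> i j. M $ i $ j + t * N $ i $ j) (nhds (M :: complex^5^5)) (at 0)"
proof -
  have "((\<lambda>t. \<chi> i j. M $ i $ j + t * N $ i $ j) \<longlongrightarrow> (\<chi> i j. M $ i $ j + 0 * N $ i $ j)) (at 0)"
    by (intro tendsto_intros)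
  moreover have "(\<chi> i j. M $ i $ j + 0 * N $ i $ j) = M" by (simp add: vec_eq_iff)
  ultimately show ?thesis by simp
qed

context
  fixes \<Phi> :: "complex^5 \<Rightarrow> complex^5 \<Rightarrow> complex^5 \<Rightarrow> complex"
  assumes \<Phi>: "quad_family \<Phi>"
begin

lemma in_cubic_part_0: "in_cubic_part \<Phi> (\<lambda>x. 0)"
  unfolding in_cubic_part_def by (intro exI[of _ "\<lambda>_ _. 0"]) simp

lemma in_cubic_part_add: "in_cubic_part \<Phi> f \<Longrightarrow> in_cubic_part \<Phi> g \<Longrightarrow> in_cubic_part \<Phi> (\<lambda>x. f x + g x)"
  unfolding in_cubic_part_def
proof (elim exE conjE)
  fix L K assume *: "\<forall>i. clin (L i)" "\<forall>x. f x = (\<Sum>i\<in>UNIV. L i x * \<Phi> (axis i 1) x x)"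
    "\<forall>i. clin (K i)" "\<forall>x. g x = (\<Sum>i\<in>UNIV. K i x * \<Phi> (axis i 1) x x)"
  show "\<exists>L. (\<forall>i. clin (L i)) \<and> (\<forall>x. f x + g x = (\<Sum>i\<in>UNIV. L i x * \<Phi> (axis i 1) x x))"
    by (intro exI[of _ "\<lambda>i x. L i x + K i x"]) (use * in \<open>simp add: distrib_right sum.distrib\<close>)
qed

lemma in_cubic_part_cmult: "in_cubic_part \<Phi> f \<Longrightarrow> in_cubic_part \<Phi> (\<lambda>x. c * f x)"
  unfolding in_cubic_part_def
proof (elim exE conjE)
  fix L assume *: "\<forall>i. clin (L i)" "\<forall>x. f x = (\<Sum>i\<in>UNIV. L i x * \<Phi> (axis i 1) x x)"
  show "\<exists>L. (\<forall>i. clin (L i)) \<and> (\<forall>x. c * f x = (\<Sum>i\<in>UNIV. L i x * \<Phi> (axis i 1) x x))"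
    by (intro exI[of _ "\<lambda>i x. c * L i x"]) (use * in \<open>simp add: sum_distrib_left mult.assoc\<close>)
qed

lemma in_cubic_part_mult: "clin l \<Longrightarrow> in_cubic_part \<Phi> (\<lambda>x. l x * \<Phi> v x x)"
  unfolding in_cubic_part_def
proof (intro exI[of _ "\<lambda>i x. l x * v $ i"] conjI allI)
  fix x
  show "l x * \<Phi> v x x = (\<Sum>i\<in>UNIV. l x * v $ i * \<Phi> (axis i 1) x x)"
    by (subst clin_expand[OF clin_p1[OF \<Phi>]]) (simp add: sum_distrib_left mult.assoc)
qed simp

lemma cubic_span_I: "clin l \<Longrightarrow> in_cubic_part \<Phi> g \<Longrightarrow> (\<lambda>x. l x * quad_form M x + g x) \<in> cubic_span \<Phi> M"
  unfolding cubic_span_def by blast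

lemma cubic_span_cmult: "f \<in> cubic_span \<Phi> M \<Longrightarrow> (\<lambda>x. c * f x) \<in> cubic_span \<Phi> M"
proof -
  assume "f \<in> cubic_span \<Phi> M"
  then obtain l g where *: "clin l" "in_cubic_part \<Phi> g" "f = (\<lambda>x. l x * quad_form M x + g x)"
    unfolding cubic_span_def by blast
  have "(\<lambda>x. (c * l x) * quad_form M x + c * g x) \<in> cubic_span \<Phi> M"
    by (intro cubic_span_I clin_cmul in_cubic_part_cmult *)
  then show ?thesis by (simp add: *(3) distrib_left mult.assoc)
qed

lemma cubic_span_add: "f \<in> cubic_span \<Phi> M \<Longrightarrow> h \<in> cubic_span \<Phi> M \<Longrightarrow> (\<lambda>x. f x + h x) \<in> cubic_span \<Phi> M"
proof -
  assume "f \<in> cubic_span \<Phi> M" "h \<in> cubic_span \<Phi> M"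
  then obtain l g l' g' where *: "clin l" "in_cubic_part \<Phi> g" "f = (\<lambda>x. l x * quad_form M x + g x)"
    "clin l'" "in_cubic_part \<Phi> g'" "h = (\<lambda>x. l' x * quad_form M x + g' x)"
    unfolding cubic_span_def by blast
  have "(\<lambda>x. (l x + l' x) * quad_form M x + (g x + g' x)) \<in> cubic_span \<Phi> M"
    by (intro cubic_span_I clin_plus in_cubic_part_add *)
  then show ?thesis by (simp add: *(3,6) algebra_simps)
qed

lemma cubic_span_sum: "finite I \<Longrightarrow> (\<And>i. i \<in> I \<Longrightarrow> f i \<in> cubic_span \<Phi> M) \<Longrightarrow> (\<lambda>x. \<Sum>i\<in>I. c i * f i x) \<in> cubic_span \<Phi> M"
proof (induction I rule: finite_induct)
  case empty
  show ?case using cubic_span_I[OF clin_zero in_cubic_part_0] by simp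
next
  case (insert i I)
  then show ?case using cubic_span_add[OF cubic_span_cmult[of "f i" M "c i"]] by simp
qed

lemma in_cubic_part_expand:
  assumes "in_cubic_part \<Phi> g"
  shows "\<exists>c. \<forall>x. g x = (\<Sum>(i, j)\<in>UNIV. c (i, j) * (x $ j * \<Phi> (axis i 1) x x))"
proof -
  obtain L where L: "\<And>i. clin (L i)" "\<And>x. g x = (\<Sum>i\<in>UNIV. L i x * \<Phi> (axis i 1) x x)"
    using assms unfolding in_cubic_part_def by blast
  have "g x = (\<Sum>(i, j)\<in>UNIV. L i (axis j 1) * (x $ j * \<Phi> (axis i 1) x x))" for x
  proof -
    have "g x = (\<Sum>i\<in>UNIV. \<Sum>j\<in>UNIV. L i (axis j 1) * (x $ j * \<Phi> (axis i 1) x x))"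
      unfolding L(2) by (subst clin_expand[OF L(1)]) (simp only: sum_distrib_right mult.assoc mult.left_commute)
    then show ?thesis by (simp add: sum.cartesian_product)
  qed
  then show ?thesis by (intro exI[of _ "\<lambda>(i, j). L i (axis j 1)"]) simp
qed

text \<open>The generators are 5 products of coordinates with the quadric and 25 with the
  \<open>\<Phi> (axis i 1)\<close>. The bound makes a maximal rank exist.\<close>

lemma cubic_span_bound: "has_indep n UNIV (cubic_span \<Phi> M) \<Longrightarrow> n \<le> 30"
proof -
  assume ind: "has_indep n UNIV (cubic_span \<Phi> M)"
  let ?G = "UNIV <+> UNIV :: (5 + 5 \<times> 5) set"
  let ?h = "\<lambda>g x. case g of Inl i \<Rightarrow> x $ i * quad_form M x | Inr (i, j) \<Rightarrow> x $ j * \<Phi> (axis i 1) x x"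
  have "n \<le> card ?G"
  proof (rule has_indep_le_card[OF ind, of _ ?h])
    fix f assume "f \<in> cubic_span \<Phi> M"
    then obtain l g where *: "clin l" "in_cubic_part \<Phi> g" "f = (\<lambda>x. l x * quad_form M x + g x)"
      unfolding cubic_span_def by blast
    obtain c where c: "\<And>x. g x = (\<Sum>(i, j)\<in>UNIV. c (i, j) * (x $ j * \<Phi> (axis i 1) x x))"
      using in_cubic_part_expand[OF *(2)] by blast
    let ?c = "case_sum (\<lambda>i. l (axis i 1)) c"
    have "f x = (\<Sum>g\<in>?G. ?c g * ?h g x)" for x
    proof -
      have "l x * quad_form M x = (\<Sum>i\<in>UNIV. l (axis i 1) * (x $ i * quad_form M x))"
        by (subst clin_expand[OF *(1)]) (simp only: sum_distrib_right mult.assoc mult.left_commute)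
      then show ?thesis
        unfolding *(3) c by (subst sum.Plus) (simp_all add: case_prod_unfold)
    qed
    then show "\<exists>c. \<forall>x\<in>UNIV. f x = (\<Sum>g\<in>?G. c g * ?h g x)" by (intro exI[of _ ?c]) blast
  qed simp
  then show ?thesis by (simp add: card_Plus del: UNIV_Plus_UNIV)
qed

lemma cubic_span_bound_degenerate:
  assumes ind: "has_indep n UNIV (cubic_span \<Phi> M)" and a: "clin a" "a e \<noteq> 0" "in_cubic_part \<Phi> (\<lambda>x. a x * quad_form M x)"
  shows "n \<le> 29"
proof -
  obtain k where k: "a (axis k 1) \<noteq> 0" using obtain_nonzero_coefficient[OF a(1,2)] by metis
  let ?G = "(UNIV - {k}) <+> UNIV :: (5 + 5 \<times> 5) set"
  let ?h = "\<lambda>g x. case g of Inl i \<Rightarrow> x $ i * quad_form M x | Inr (i, j) \<Rightarrow> x $ j * \<Phi> (axis i 1) x x"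
  have "n \<le> card ?G"
  proof (rule has_indep_le_card[OF ind, of _ ?h])
    fix f assume "f \<in> cubic_span \<Phi> M"
    then obtain l g where *: "clin l" "in_cubic_part \<Phi> g" "f = (\<lambda>x. l x * quad_form M x + g x)"
      unfolding cubic_span_def by blast
    let ?b = "l (axis k 1) / a (axis k 1)"
    have "in_cubic_part \<Phi> (\<lambda>x. ?b * (a x * quad_form M x) + g x)"
      by (intro in_cubic_part_add in_cubic_part_cmult a *)
    from in_cubic_part_expand[OF this] obtain c where c:
      "\<And>x. ?b * (a x * quad_form M x) + g x = (\<Sum>(i, j)\<in>UNIV. c (i, j) * (x $ j * \<Phi> (axis i 1) x x))"
      by blast
    let ?d = "\<lambda>i. l (axis i 1) - l (axis k 1) * a (axis i 1) / a (axis k 1)"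
    let ?c = "case_sum ?d c"
    have "f x = (\<Sum>g\<in>?G. ?c g * ?h g x)" for x
    proof -
      have "f x = (\<Sum>i\<in>UNIV - {k}. ?d i * (x $ i * quad_form M x)) + (?b * (a x * quad_form M x) + g x)"
        unfolding *(3) by (subst clin_eliminate[OF a(1) *(1) k])
          (simp add: distrib_right sum_distrib_right mult.assoc)
      then show ?thesis
        unfolding c by (subst sum.Plus) (simp_all add: case_prod_unfold)
    qed
    then show "\<exists>c. \<forall>x\<in>UNIV. f x = (\<Sum>g\<in>?G. c g * ?h g x)" by (intro exI[of _ ?c]) blast
  qed simp
  then show ?thesis by (simp add: card_Plus card_Diff_singleton)
qed

lemma obtain_maximal:
  obtains n M where "maximal_rank \<Phi> n M"
proof -
  let ?S = "{n. \<exists>M. has_indep n UNIV (cubic_span \<Phi> M)}"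
  have "?S \<subseteq> {..30}" using cubic_span_bound by auto
  then have fin: "finite ?S" using finite_subset by blast
  have "0 \<in> ?S" by (simp add: has_indep_0)
  then have "Max ?S \<in> ?S" using Max_in[OF fin] by blast
  then obtain M where M: "has_indep (Max ?S) UNIV (cubic_span \<Phi> M)" by blast
  have "\<not> has_indep (Suc (Max ?S)) UNIV (cubic_span \<Phi> N)" for N
  proof
    assume "has_indep (Suc (Max ?S)) UNIV (cubic_span \<Phi> N)"
    then have "Suc (Max ?S) \<le> Max ?S" by (intro Max_ge[OF fin]) blast
    then show False by simp
  qed
  then show ?thesis using that M unfolding maximal_rank_def by blast
qed

lemma tendsto_quad_form: "((\<lambda>N. quad_form N x) \<longlongrightarrow> quad_form M x) (nhds M)"
proof -
  have "isCont (\<lambda>N. quad_form N x) M" unfolding quad_form_def by (intro continuous_intros)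
  then show ?thesis
    unfolding isCont_def tendsto_at_iff_tendsto_nhds[of "\<lambda>N. quad_form N x"] .
qed

text \<open>The linear forms and cubic parts of an independent family are frozen while the quadric
  varies, which makes the functions continuous in the matrix.\<close>

lemma eventually_cubic_span_indep:
  assumes "has_indep n UNIV (cubic_span \<Phi> M)"
  shows "\<forall>\<^sub>F N in nhds M. has_indep n UNIV (cubic_span \<Phi> N)"
proof -
  obtain f where f: "\<And>i. i < n \<Longrightarrow> f i \<in> cubic_span \<Phi> M" "indep_on {..<n} UNIV f"
    using has_indepE[OF assms] by metis
  have "\<forall>i\<in>{..<n}. \<exists>l. \<exists>g. clin l \<and> in_cubic_part \<Phi> g \<and> f i = (\<lambda>x. l x * quad_form M x + g x)"
    using f(1) unfolding cubic_span_def by blast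
  from bchoice[OF this] obtain l where
    "\<forall>i\<in>{..<n}. \<exists>g. clin (l i) \<and> in_cubic_part \<Phi> g \<and> f i = (\<lambda>x. l i x * quad_form M x + g x)" by blast
  from bchoice[OF this] obtain g where
    lg: "\<And>i. i < n \<Longrightarrow> clin (l i) \<and> in_cubic_part \<Phi> (g i) \<and> f i = (\<lambda>x. l i x * quad_form M x + g i x)" by blast
  have "\<forall>\<^sub>F N in nhds M. indep_on {..<n} UNIV (\<lambda>i x. l i x * quad_form N x + g i x)"
  proof (rule indep_on_eventually[OF f(2)])
    fix i x assume "i < n"
    then show "((\<lambda>N. l i x * quad_form N x + g i x) \<longlongrightarrow> f i x) (nhds M)"
      using lg by simp (intro tendsto_intros tendsto_quad_form)
  qed
  then show ?thesis
  proof (rule eventually_mono)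
    fix N assume "indep_on {..<n} UNIV (\<lambda>i x. l i x * quad_form N x + g i x)"
    then show "has_indep n UNIV (cubic_span \<Phi> N)"
      unfolding has_indep_def using lg cubic_span_I
      by (intro exI[of _ "\<lambda>i x. l i x * quad_form N x + g i x"]) blast
  qed
qed

lemma eventually_maximal: "maximal_rank \<Phi> n M \<Longrightarrow> \<forall>\<^sub>F N in nhds M. maximal_rank \<Phi> n N"
  unfolding maximal_rank_def using eventually_cubic_span_indep by (auto elim: eventually_mono)

text \<open>Perturbing along \<open>M + t N\<close> keeps a maximal independent family independent and would
  enlarge it by \<open>a N = (a (M + t N) - a M) / t\<close>.\<close>

lemma maximal_tangent:
  assumes max: "maximal_rank \<Phi> n M" and a: "clin a" "in_cubic_part \<Phi> (\<lambda>x. a x * quad_form M x)"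
  shows "(\<lambda>x. a x * quad_form N x) \<in> cubic_span \<Phi> M"
proof (rule ccontr)
  assume notin: "(\<lambda>x. a x * quad_form N x) \<notin> cubic_span \<Phi> M"
  define P where "P t = (\<chi> i j. M $ i $ j + t * N $ i $ j)" for t
  have P: "quad_form (P t) x = quad_form M x + t * quad_form N x" for t x
    unfolding P_def by (rule quad_form_add_scale)
  have "has_indep n UNIV (cubic_span \<Phi> M)" using max by (simp add: maximal_rank_def)
  then obtain f where f: "\<And>i. i < n \<Longrightarrow> f i \<in> cubic_span \<Phi> M" "indep_on {..<n} UNIV f"
    using has_indepE by metis
  have "\<forall>i\<in>{..<n}. \<exists>l. \<exists>g. clin l \<and> in_cubic_part \<Phi> g \<and> f i = (\<lambda>x. l x * quad_form M x + g x)"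
    using f(1) unfolding cubic_span_def by blast
  from bchoice[OF this] obtain l where
    "\<forall>i\<in>{..<n}. \<exists>g. clin (l i) \<and> in_cubic_part \<Phi> g \<and> f i = (\<lambda>x. l i x * quad_form M x + g x)" by blast
  from bchoice[OF this] obtain g where
    lg: "\<And>i. i < n \<Longrightarrow> clin (l i) \<and> in_cubic_part \<Phi> (g i) \<and> f i = (\<lambda>x. l i x * quad_form M x + g i x)" by blast
  \<comment> \<open>At \<open>t = 0\<close> the additional function, at index \<open>n\<close>, lies
    outside \<open>cubic_span \<Phi> M\<close>, which contains the span of the others; hence
    \<open>F 0\<close> is independent.\<close>
  define F where "F t i x = (if i = n then a x * quad_form N x else l i x * quad_form (P t) x + g i x)" for t i x
  have "indep_on {..<Suc n} UNIV (F 0)"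
    unfolding indep_on_def
  proof (intro allI impI)
    fix c assume c: "\<forall>x\<in>UNIV. (\<Sum>i<Suc n. c i * F 0 i x) = 0"
    have F0: "F 0 i x = f i x" if "i < n" for i x using lg[OF that] that by (simp add: F_def P)
    have c': "(\<Sum>i<n. c i * f i x) + c n * (a x * quad_form N x) = 0" for x
      using c F0 by (simp add: F_def)
    have cn: "c n = 0"
    proof (rule ccontr)
      assume cn: "c n \<noteq> 0"
      have "(\<lambda>x. (- 1 / c n) * (\<Sum>i<n. c i * f i x)) \<in> cubic_span \<Phi> M"
        by (rule cubic_span_cmult[OF cubic_span_sum]) (use f(1) in auto)
      moreover have "(- 1 / c n) * (\<Sum>i<n. c i * f i x) = a x * quad_form N x" for x
      proof -
        have "(\<Sum>i<n. c i * f i x) = - (c n * (a x * quad_form N x))"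
          using c'[of x] by (simp add: eq_neg_iff_add_eq_0)
        then show ?thesis using cn by simp
      qed
      ultimately show False using notin by simp
    qed
    then have "c i = 0" if "i < n" for i
      using indep_onD[OF f(2), of c i] c' that by simp
    with cn show "\<forall>i\<in>{..<Suc n}. c i = 0" by (auto simp: less_Suc_eq)
  qed
  then have "\<forall>\<^sub>F t in at 0. indep_on {..<Suc n} UNIV (F t)"
  proof (rule indep_on_eventually)
    fix i x
    have "((\<lambda>t. quad_form (P t) x) \<longlongrightarrow> quad_form (P 0) x) (at 0)"
      unfolding P by (intro tendsto_intros)
    then show "((\<lambda>t. F t i x) \<longlongrightarrow> F 0 i x) (at 0)"
      unfolding F_def by (cases "i = n") (auto intro!: tendsto_intros)
  qed
  moreover have "\<forall>\<^sub>F t in at 0. t \<noteq> (0::complex)" by (rule eventually_neq_at_within)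
  ultimately have "\<forall>\<^sub>F t in at 0. indep_on {..<Suc n} UNIV (F t) \<and> t \<noteq> 0" by (rule eventually_conj)
  then obtain t where t: "indep_on {..<Suc n} UNIV (F t)" "t \<noteq> 0"
    using eventually_happens'[of "at (0::complex)"] by auto
  have "F t i \<in> cubic_span \<Phi> (P t)" if "i < Suc n" for i
  proof (cases "i = n")
    case True
    have "(\<lambda>x. (1 / t * a x) * quad_form (P t) x + (- 1 / t) * (a x * quad_form M x)) \<in> cubic_span \<Phi> (P t)"
      by (intro cubic_span_I clin_cmul in_cubic_part_cmult a)
    moreover have "(\<lambda>x. (1 / t * a x) * quad_form (P t) x + (- 1 / t) * (a x * quad_form M x)) = F t i"
      using t(2) True by (auto simp: F_def P field_simps)
    ultimately show ?thesis by simp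
  next
    case False
    then have "i < n" using that by simp
    from lg[OF this] False show ?thesis
      using cubic_span_I[of "l i" "g i" "P t"] by (simp add: F_def[abs_def])
  qed
  then have "has_indep (Suc n) UNIV (cubic_span \<Phi> (P t))"
    unfolding has_indep_def using t(1) by blast
  with max show False by (simp add: maximal_rank_def)
qed

end

section \<open>Quadrics of maximal rank when the family comes from a smooth cubic\<close>

lemma quadratic_root:
  fixes a b c :: complex
  assumes "a \<noteq> 0"
  obtains s where "a * s\<^sup>2 + 2 * b * s + c = 0"
proof
  let ?s = "(- b + csqrt (b\<^sup>2 - a * c)) / a"
  have "(?s * a + b)\<^sup>2 = b\<^sup>2 - a * c" using assms by simp
  then have "a * (a * ?s\<^sup>2 + 2 * b * ?s + c) = 0"
    by (simp only: power2_eq_square) algebra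
  then show "a * ?s\<^sup>2 + 2 * b * ?s + c = 0" using assms by simp
qed

context
  fixes \<Phi> :: "complex^5 \<Rightarrow> complex^5 \<Rightarrow> complex^5 \<Rightarrow> complex"
  assumes \<Phi>: "quad_family \<Phi>" and sym: "\<And>u v w. \<Phi> u v w = \<Phi> v u w"
    and nz: "\<And>x. x \<noteq> 0 \<Longrightarrow> \<exists>v. \<Phi> v x x \<noteq> 0"
begin

text \<open>If \<open>\<Phi> u\<close> and \<open>\<Phi> v\<close> both vanish on the hyperplane \<open>a = 0\<close>, then a suitable combination
  of \<open>u\<close> and \<open>v\<close> is a singular point.\<close>

lemma vanishing_on_hyperplane_proportional:
  assumes a: "clin a" "a e \<noteq> 0"
    and u: "\<And>x. a x = 0 \<Longrightarrow> \<Phi> u x x = 0" "u \<noteq> 0" and v: "\<And>x. a x = 0 \<Longrightarrow> \<Phi> v x x = 0"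
  shows "\<exists>c. v = c *s u"
proof (rule ccontr)
  assume "\<not> ?thesis"
  then have vu: "v \<noteq> c *s u" for c by blast
  have H: "vec.subspace {x. a x = 0}" using subspace_Int_kernel[OF vec.subspace_UNIV a(1)] by simp
  have polar: "\<Phi> u x y = 0" "\<Phi> v x y = 0" if "a x = 0" "a y = 0" for x y
    using polarize_0[OF \<Phi> H, of _ x y] u v that by auto
  have swap: "\<Phi> x w w = \<Phi> w x w" for x w by (rule sym)
  \<comment> \<open>The first condition makes \<open>\<Phi> x w w\<close> vanish for
    \<open>x\<close> on the hyperplane, the second for a vector \<open>t\<close> off it. Together
    they cover every \<open>x\<close>, and \<open>nz\<close> forces \<open>w = 0\<close>.\<close>
  have off: "w = 0" if w: "\<And>x. a x = 0 \<Longrightarrow> \<Phi> w x w = 0" and t: "a t \<noteq> 0" "\<Phi> t w w = 0" for t w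
  proof (rule ccontr)
    assume "w \<noteq> 0"
    then obtain x where x: "\<Phi> x w w \<noteq> 0" using nz by blast
    let ?y = "x - (a x / a t) *s t"
    have "a ?y = 0" using t(1) by (simp add: clin_diff[OF a(1)] clin_scale[OF a(1)])
    then have "\<Phi> ?y w w = 0" using w swap by simp
    then show False using x t(2) by (simp add: p_lin[OF \<Phi>])
  qed
  \<comment> \<open>For \<open>w\<close> on the hyperplane and \<open>t\<close> off it, both
    conditions of \<open>off\<close> are values of the two vanishing polar forms at points of the
    hyperplane.\<close>
  have mixed: "w = 0" if "\<And>x y. a x = 0 \<Longrightarrow> a y = 0 \<Longrightarrow> \<Phi> t x y = 0"
    "\<And>x y. a x = 0 \<Longrightarrow> a y = 0 \<Longrightarrow> \<Phi> w x y = 0" "a t \<noteq> 0" "a w = 0" for t w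
    by (rule off[OF _ that(3)]) (use that in auto)
  show False
  proof (cases "a u = 0")
    case False
    \<comment> \<open>With \<open>u\<close> off the hyperplane, \<open>v\<close> is moved into it
      along \<open>u\<close>; the quadric of the combination still vanishes on the
      hyperplane.\<close>
    let ?w = "v - (a v / a u) *s u"
    have "?w = 0"
      by (rule mixed[OF polar(1) _ False])
        (use False polar in \<open>auto simp: p_lin[OF \<Phi>] clin_diff[OF a(1)] clin_scale[OF a(1)]\<close>)
    then show False using vu by simp
  next
    case u0: True
    show False
    proof (cases "a v = 0")
      case False
      have "u = 0" by (rule mixed[OF polar(2,1) False u0])
      with u(2) show False by simp
    next
      case v0: True
      \<comment> \<open>Every \<open>w\<close> in the span of \<open>u\<close> and \<open>v\<close>
        meets the first condition of \<open>off\<close>; the second is a quadratic equation on this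
        span, solvable over the complex numbers.\<close>
      have "\<exists>w. w \<noteq> 0 \<and> (\<exists>c d. w = c *s v + d *s u) \<and> \<Phi> e w w = 0"
      proof (cases "\<Phi> e u u = 0")
        case True
        then show ?thesis using u(2) by (intro exI[of _ u] conjI exI[of _ 0] exI[of _ 1]) auto
      next
        case False
        then obtain s where s: "\<Phi> e u u * s\<^sup>2 + 2 * \<Phi> e u v * s + \<Phi> e v v = 0"
          by (rule quadratic_root)
        have "v + s *s u \<noteq> 0"
        proof
          assume "v + s *s u = 0"
          then have "v = - (s *s u)" by (simp add: eq_neg_iff_add_eq_0)
          then have "v = (- s) *s u" by (simp only: vector_smult_lneg)
          then show False using vu by blast
        qed
        moreover have "\<Phi> e (v + s *s u) (v + s *s u) = 0"
          using s by (simp add: p_lin[OF \<Phi>] p_sym[OF \<Phi>, of e v u] power2_eq_square algebra_simps)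
        ultimately show ?thesis by (intro exI[of _ "v + s *s u"] conjI exI[of _ 1] exI[of _ s]) auto
      qed
      then obtain w c d where w: "w \<noteq> 0" "w = c *s v + d *s u" "\<Phi> e w w = 0" by blast
      have aw: "a w = 0" using u0 v0 by (simp add: w(2) clin_add[OF a(1)] clin_scale[OF a(1)])
      have "\<Phi> w x y = 0" if "a x = 0" "a y = 0" for x y
        using polar[OF that] by (simp add: w(2) p_lin[OF \<Phi>])
      then have "w = 0" by (intro off[OF _ a(2) w(3)]) (use aw in auto)
      with w(1) show False by simp
    qed
  qed
qed

text \<open>By maximality \<open>cubic_span \<Phi> M\<close> contains all multiples of \<open>a\<close>, which account for 15 dimensions. If the
  quadric does not lie in the span of the family and the multiples of \<open>a\<close>, then the family, together
  with the quadric, still has dimension 5 on \<open>a = 0\<close> (even if some \<open>\<Phi> u\<close> vanishes there: the parameter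
  \<open>u\<close> is then reassigned to the quadric), which gives another 15.\<close>

lemma maximal_indecomposable_False:
  assumes max: "maximal_rank \<Phi> n M" and a: "clin a" "a e \<noteq> 0" "in_cubic_part \<Phi> (\<lambda>x. a x * quad_form M x)"
    and indec: "\<And>m v. clin m \<Longrightarrow> \<exists>x. quad_form M x \<noteq> a x * m x + \<Phi> v x x"
  shows False
proof -
  obtain k where k: "a (axis k 1) \<noteq> 0" using obtain_nonzero_coefficient[OF a(1,2)] by metis
  \<comment> \<open>If the quadric agreed with some \<open>\<Phi> v\<close> on \<open>a = 0\<close>,
    the difference would be divisible by \<open>a\<close>; the quotient \<open>m\<close> is found as
    in \<open>p_eq_cofactor\<close>.\<close>
  have indec': "\<exists>x. a x = 0 \<and> quad_form M x \<noteq> \<Phi> v x x" for v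
  proof (rule ccontr)
    assume contra: "\<not> ?thesis"
    define p where "p w x y = bilinear_form M x y - \<Phi> v x y" for w :: "complex^5" and x y
    define e' where "e' = (1 / a e) *s e"
    have e': "a e' = 1" using a(2) by (simp add: e'_def clin_scale[OF a(1)])
    define m where "m x = 2 * (bilinear_form M x e' - \<Phi> v x e') - a x * (bilinear_form M e' e' - \<Phi> v e' e')" for x
    have m: "clin m" unfolding m_def
      by (intro clin_minus clin_cmul clin_cmul_right clin_bilinear_form clin_p2[OF \<Phi>] a)
    have "quad_form M x = a x * m x + \<Phi> v x x" for x
    proof -
      let ?y = "x - a x *s e'"
      have "a ?y = 0" by (simp add: clin_diff[OF a(1)] clin_scale[OF a(1)] e')
      then have "bilinear_form M ?y ?y - \<Phi> v ?y ?y = 0"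
        using contra by (simp add: bilinear_form_same)
      then have "quad_form M x - \<Phi> v x x = a x * m x"
        by (simp add: p_lin[OF \<Phi>] clin_diff[OF clin_bilinear_form(1)] clin_diff[OF clin_bilinear_form(2)]
            clin_scale[OF clin_bilinear_form(1)] clin_scale[OF clin_bilinear_form(2)] bilinear_form_same[symmetric]
            bilinear_form_sym[of M e' x] p_sym[OF \<Phi>, of v e' x] m_def algebra_simps)
      then show ?thesis by (simp add: algebra_simps)
    qed
    with indec[OF m, of v] show False by blast
  qed
  \<comment> \<open>\<open>\<phi> v\<close> is the coefficient of the quadric in the modified
    family. On the hyperplane this family has to be injective in \<open>v\<close> and without a
    common zero.\<close>
  have "\<exists>\<phi>. clin \<phi> \<and> (\<forall>v. (\<forall>x. a x = 0 \<longrightarrow> \<Phi> v x x + \<phi> v * quad_form M x = 0) \<longrightarrow> v = 0) \<and>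
      (\<forall>x. x \<noteq> 0 \<longrightarrow> a x = 0 \<longrightarrow> (\<exists>v. \<Phi> v x x + \<phi> v * quad_form M x \<noteq> 0))"
  proof (cases "\<exists>u. u \<noteq> 0 \<and> (\<forall>x. a x = 0 \<longrightarrow> \<Phi> u x x = 0)")
    case False
    then show ?thesis using nz by (intro exI[of _ "\<lambda>_. 0"]) auto
  next
    case True
    then obtain u where u: "u \<noteq> 0" "\<And>x. a x = 0 \<Longrightarrow> \<Phi> u x x = 0" by blast
    obtain i where i: "u $ i \<noteq> 0" using u(1) by (auto simp: vec_eq_iff)
    define \<phi> where "\<phi> v = (1 / u $ i) * v $ i" for v :: "complex^5"
    have \<phi>: "clin \<phi>" unfolding \<phi>_def by (intro clin_cmul clin_component)
    have \<phi>u: "\<phi> u = 1" using i by (simp add: \<phi>_def)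
    show ?thesis
    proof (intro exI[of _ \<phi>] conjI allI impI)
      fix v assume v: "\<forall>x. a x = 0 \<longrightarrow> \<Phi> v x x + \<phi> v * quad_form M x = 0"
      \<comment> \<open>Otherwise the quadric itself would agree with a member on
        \<open>a = 0\<close>. Once \<open>\<phi> v = 0\<close>, \<open>v\<close> is a multiple of
        \<open>u\<close>, and \<open>\<phi> u = 1\<close> leaves only 0.\<close>
      have \<phi>v: "\<phi> v = 0"
      proof (rule ccontr)
        assume nz': "\<phi> v \<noteq> 0"
        have "quad_form M x = \<Phi> ((- 1 / \<phi> v) *s v) x x" if "a x = 0" for x
        proof -
          have "\<phi> v * quad_form M x = - \<Phi> v x x"
            using v that by (simp add: eq_neg_iff_add_eq_0 add.commute)
          then show ?thesis using nz'
            unfolding clin_scale[OF clin_p1[OF \<Phi>], of "- 1 / \<phi> v" v] by (simp add: field_simps)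
        qed
        with indec' show False by blast
      qed
      then have "\<exists>c. v = c *s u"
        using v by (intro vanishing_on_hyperplane_proportional[OF a(1,2) u(2,1)]) simp_all
      then obtain c where "v = c *s u" by blast
      then show "v = 0" using \<phi>v \<phi>u by (simp add: clin_scale[OF \<phi>])
    next
      fix x assume x: "x \<noteq> 0" "a x = 0"
      show "\<exists>v. \<Phi> v x x + \<phi> v * quad_form M x \<noteq> 0"
      proof (rule ccontr)
        assume "\<not> ?thesis"
        then have *: "\<Phi> v x x + \<phi> v * quad_form M x = 0" for v by blast
        \<comment> \<open>The parameter \<open>u\<close> isolates the quadric, as
          \<open>\<Phi> u\<close> vanishes here; a common zero would thus be one of the original
          family.\<close>
        have "quad_form M x = 0" using *[of u] u(2)[OF x(2)] \<phi>u by simp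
        then have "\<Phi> v x x = 0" for v using *[of v] by simp
        then show False using nz[OF x(1)] by blast
      qed
    qed (rule \<phi>)
  qed
  then obtain \<phi> where \<phi>: "clin \<phi>"
    and inj': "\<forall>v. (\<forall>x. a x = 0 \<longrightarrow> \<Phi> v x x + \<phi> v * quad_form M x = 0) \<longrightarrow> v = 0"
    and bpf': "\<forall>x. x \<noteq> 0 \<longrightarrow> a x = 0 \<longrightarrow> (\<exists>v. \<Phi> v x x + \<phi> v * quad_form M x \<noteq> 0)"
    by (elim exE conjE)
  have inj: "v = 0" if "\<And>x. a x = 0 \<Longrightarrow> \<Phi> v x x + \<phi> v * quad_form M x = 0" for v
    using inj' that by simp
  have bpf: "\<exists>v. \<Phi> v x x + \<phi> v * quad_form M x \<noteq> 0" if "x \<noteq> 0" "a x = 0" for x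
    using bpf' that by simp
  from hyperplane_parametrization[OF a(1) k]
  obtain j :: "complex^4 \<Rightarrow> complex^5" and r :: "complex^5 \<Rightarrow> complex^4" where
    param: "\<forall>i. clin (\<lambda>y. j y $ i)" "\<forall>s. clin (\<lambda>x. r x $ s)" "\<forall>y. r (j y) = y"
      "\<forall>y. a (j y) = 0" "\<forall>x. a x = 0 \<longrightarrow> j (r x) = x"
    by (elim exE conjE)
  have j: "clin (\<lambda>y. j y $ i)" for i using param(1) by blast
  have r: "clin (\<lambda>x. r x $ s)" for s using param(2) by blast
  have rj: "r (j y) = y" for y using param(3) by blast
  have aj: "a (j y) = 0" for y using param(4) by blast
  have jr: "j (r x) = x" if "a x = 0" for x using param(5) that by blast
  define p where "p v y z = \<Phi> v (j y) (j z) + \<phi> v * bilinear_form M (j y) (j z)" for v y z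
  have p: "quad_family p"
    unfolding quad_family_def
  proof (intro conjI allI)
    show "clin (\<lambda>v. p v x y)" for x y
      unfolding p_def by (rule clin_plus[OF clin_p1[OF \<Phi>] clin_cmul_right[OF \<phi>]])
    show "clin (\<lambda>x. p v x y)" for v y
      unfolding p_def
      by (rule clin_plus[OF clin_comp[OF clin_p2[OF \<Phi>] j] clin_cmul[OF clin_comp[OF clin_bilinear_form(1) j]]])
    show "clin (\<lambda>y. p v x y)" for v x
      unfolding p_def
      by (rule clin_plus[OF clin_comp[OF clin_p3[OF \<Phi>] j] clin_cmul[OF clin_comp[OF clin_bilinear_form(2) j]]])
    show "p v x y = p v y x" for v x y
      unfolding p_def by (simp only: p_sym[OF \<Phi>, of v "j x"] bilinear_form_sym[of M "j x"])
  qed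
  have pj: "p v y y = \<Phi> v (j y) (j y) + \<phi> v * quad_form M (j y)" for v y
    by (simp add: p_def bilinear_form_same)
  have "has_indep 15 UNIV (multiples p)"
  proof (rule has_indep_multiples_15[OF p])
    fix y :: "complex^4" assume y: "y \<noteq> 0"
    have r0: "r 0 = 0" unfolding vec_eq_iff using clin_0[OF r] by simp
    have "j y \<noteq> 0"
    proof
      assume "j y = 0"
      then have "r (j y) = 0" by (simp only: r0)
      with y show False by (simp only: rj)
    qed
    then show "\<exists>v. p v y y \<noteq> 0" unfolding pj by (rule bpf[OF _ aj])
  next
    fix v assume v: "\<And>y. p v y y = 0"
    show "v = 0"
    proof (rule inj)
      fix x assume "a x = 0"
      then show "\<Phi> v x x + \<phi> v * quad_form M x = 0" using v[of "r x"] unfolding pj by (simp only: jr)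
    qed
  qed
  then have H: "has_indep 15 {x. a x = 0} (cubic_span \<Phi> M)"
  proof (rule has_indep_pullback[of _ _ j])
    fix f assume "f \<in> multiples p"
    then obtain l v where lv: "clin l" "f = (\<lambda>y. l y * p v y y)" by (auto simp: multiples_def)
    have l: "clin (\<lambda>x. l (r x))" by (rule clin_comp[OF lv(1) r])
    show "\<exists>g\<in>cubic_span \<Phi> M. \<forall>y. g (j y) = f y"
    proof (intro bexI allI)
      show "(\<lambda>x. (\<phi> v * l (r x)) * quad_form M x + l (r x) * \<Phi> v x x) \<in> cubic_span \<Phi> M"
        by (intro cubic_span_I[OF \<Phi>] clin_cmul l in_cubic_part_mult[OF \<Phi>])
      show "(\<phi> v * l (r (j y))) * quad_form M (j y) + l (r (j y)) * \<Phi> v (j y) (j y) = f y" for y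
        by (simp add: lv(2) pj rj algebra_simps)
    qed
  qed (simp add: aj)
  have "has_indep (5 * (5 + 1) div 2) (UNIV :: (complex^5) set) products"
    using has_indep_products[OF has_indep_UNIV[where 'n = 5]] by simp
  then have 15: "has_indep 15 (UNIV :: (complex^5) set) products" by simp
  \<comment> \<open>The products of \<open>a\<close> with all quadrics and the cubics on
    \<open>a = 0\<close> give 30, against the bound 29 of
    \<open>cubic_span_bound_degenerate\<close>.\<close>
  have "has_indep (15 + 15) UNIV (cubic_span \<Phi> M)"
  proof (rule has_indep_mult_step[OF vec.subspace_UNIV UNIV_I a(1,2) 15])
    fix g :: "complex^5 \<Rightarrow> complex" assume "g \<in> products"
    then obtain l m where lm: "clin l" "clin m" "g = (\<lambda>x. l x * m x)" by (auto simp: products_def)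
    show "continuous_on UNIV g"
      unfolding lm(3) by (intro continuous_on_mult clin_continuous lm)
    show "\<exists>f\<in>cubic_span \<Phi> M. \<forall>x\<in>UNIV. f x = a x * g x"
      using maximal_tangent[OF \<Phi> max a(1,3)] clin_product_eq_quad_form[OF lm(1,2)]
      by (intro bexI[of _ "\<lambda>x. a x * quad_form (\<chi> i j. l (axis i 1) * m (axis j 1)) x"])
        (simp_all add: lm(3))
  qed (use H in simp)
  from cubic_span_bound_degenerate[OF \<Phi> this a] show False by simp
qed

text \<open>Since the multiples of \<open>a\<close> are listed separately, \<open>l\<close> can
  avoid the coordinate \<open>k\<close>. The generators number 4 + 5 + 5, one short of the dimension
  of all quadrics.\<close>

lemma decomposable_bound:
  assumes ind: "has_indep n UNIV {\<lambda>x. l x * m x + a x * l' x + \<Phi> v x x | l l' v. clin l \<and> clin l'}"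
    and a: "clin a" "a e \<noteq> 0" and m: "clin m"
  shows "n \<le> 14"
proof -
  obtain k where k: "a (axis k 1) \<noteq> 0" using obtain_nonzero_coefficient[OF a] by metis
  let ?G = "(UNIV - {k}) <+> (UNIV <+> UNIV) :: (5 + (5 + 5)) set"
  let ?h = "\<lambda>g x. case g of Inl i \<Rightarrow> x $ i * m x
    | Inr g' \<Rightarrow> (case g' of Inl j \<Rightarrow> x $ j * a x | Inr j \<Rightarrow> \<Phi> (axis j 1) x x)"
  have "n \<le> card ?G"
  proof (rule has_indep_le_card[OF ind, of _ ?h])
    fix f assume "f \<in> {\<lambda>x. l x * m x + a x * l' x + \<Phi> v x x | l l' v. clin l \<and> clin l'}"
    then obtain l l' v where *: "clin l" "clin l'" "f = (\<lambda>x. l x * m x + a x * l' x + \<Phi> v x x)"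
      by blast
    let ?b = "l (axis k 1) / a (axis k 1)"
    let ?d = "\<lambda>i. l (axis i 1) - l (axis k 1) * a (axis i 1) / a (axis k 1)"
    let ?c = "case_sum ?d (case_sum (\<lambda>j. l' (axis j 1) + ?b * m (axis j 1)) (\<lambda>j. v $ j))"
    have "f x = (\<Sum>g\<in>?G. ?c g * ?h g x)" for x
    proof -
      have 1: "l x * m x = ?b * (a x * m x) + (\<Sum>i\<in>UNIV - {k}. ?d i * (x $ i * m x))"
        by (subst clin_eliminate[OF a(1) *(1) k]) (simp only: distrib_right sum_distrib_right mult.assoc)
      have "clin (\<lambda>x. l' x + ?b * m x)" by (intro clin_plus clin_cmul * m)
      then have 2: "(l' x + ?b * m x) * a x
          = (\<Sum>j\<in>UNIV. (l' (axis j 1) + ?b * m (axis j 1)) * (x $ j * a x))"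
        by (subst clin_expand[of "\<lambda>x. l' x + ?b * m x"])
          (simp_all only: sum_distrib_right mult.assoc mult.left_commute)
      have 3: "\<Phi> v x x = (\<Sum>j\<in>UNIV. v $ j * \<Phi> (axis j 1) x x)"
        by (rule clin_expand[OF clin_p1[OF \<Phi>]])
      have "f x = (\<Sum>i\<in>UNIV - {k}. ?d i * (x $ i * m x)) + ((l' x + ?b * m x) * a x + \<Phi> v x x)"
        unfolding *(3) 1 by (simp add: algebra_simps)
      then show ?thesis
        unfolding 2 3 by (simp add: sum.Plus del: UNIV_Plus_UNIV)
    qed
    then show "\<exists>c. \<forall>x\<in>UNIV. f x = (\<Sum>g\<in>?G. c g * ?h g x)" by (intro exI[of _ ?c]) blast
  qed simp
  then show ?thesis by (simp add: card_Plus card_Diff_singleton del: UNIV_Plus_UNIV)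
qed

text \<open>By \<open>maximal_indecomposable_False\<close> only quadrics of the form
  \<open>a m + \<Phi> u\<close> remain. They add nothing to the family on \<open>a = 0\<close>, so
  the contradiction is sought at a nearby quadric with the same \<open>a\<close>.\<close>

lemma maximal_injective:
  assumes max: "maximal_rank \<Phi> n M" and a: "clin a" "in_cubic_part \<Phi> (\<lambda>x. a x * quad_form M x)"
  shows "a x = 0"
proof (rule ccontr)
  assume ax: "a x \<noteq> 0"
  have "\<exists>m v. clin m \<and> (\<forall>x. quad_form M x = a x * m x + \<Phi> v x x)"
    using maximal_indecomposable_False[OF max a(1) ax a(2)] by blast
  then obtain m u where m: "clin m" and M: "\<And>x. quad_form M x = a x * m x + \<Phi> u x x" by blast
  \<comment> \<open>Every quadric is a multiple of \<open>m\<close> plus some \<open>R\<close> with \<open>a R\<close> in the ideal. These \<open>R\<close> cannot all be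
    decomposable, as the multiples of \<open>m\<close> and of \<open>a\<close> and the family together span at most
    \<open>5 + 5 - 1 + 5 < 15\<close> dimensions. Perturbing \<open>M\<close> by such an \<open>R\<close> removes the decomposition.\<close>
  have "\<exists>R. in_cubic_part \<Phi> (\<lambda>x. a x * quad_form R x) \<and>
    \<not> (\<exists>m v. clin m \<and> (\<forall>x. quad_form R x = a x * m x + \<Phi> v x x))"
  proof (rule ccontr)
    assume contra: "\<not> ?thesis"
    have "products \<subseteq> {\<lambda>x. l x * m x + a x * l' x + \<Phi> v x x | l l' v. clin l \<and> clin l'}"
    proof
      fix f :: "complex^5 \<Rightarrow> complex" assume "f \<in> products"
      then obtain k k' where kk: "clin k" "clin k'" "f = (\<lambda>x. k x * k' x)" by (auto simp: products_def)
      define N where "N = (\<chi> i j. k (axis i 1) * k' (axis j 1))"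
      have N: "quad_form N x = k x * k' x" for x
        unfolding N_def by (rule clin_product_eq_quad_form[OF kk(1,2), symmetric])
      from maximal_tangent[OF \<Phi> max a, where N = N] obtain l g where
        lg: "clin l" "in_cubic_part \<Phi> g" "(\<lambda>x. a x * quad_form N x) = (\<lambda>x. l x * quad_form M x + g x)"
        unfolding cubic_span_def by blast
      define L where "L = (\<chi> i j. l (axis i 1) * m (axis j 1))"
      have L: "quad_form L x = l x * m x" for x
        unfolding L_def by (rule clin_product_eq_quad_form[OF lg(1) m, symmetric])
      \<comment> \<open>From \<open>a N = l (a m + \<Phi> u) + g\<close>, the product of
        \<open>a\<close> with \<open>N - l m\<close> lies in the cubic part.\<close>
      define R where "R = (\<chi> i j. N $ i $ j + (- 1) * L $ i $ j)"
      have R: "quad_form R x = k x * k' x - l x * m x" for x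
        unfolding R_def quad_form_add_scale N L by simp
      have "in_cubic_part \<Phi> (\<lambda>x. l x * \<Phi> u x x + g x)"
        by (intro in_cubic_part_add[OF \<Phi>] in_cubic_part_mult[OF \<Phi>] lg)
      moreover have "l x * \<Phi> u x x + g x = a x * quad_form R x" for x
        using fun_cong[OF lg(3), of x] unfolding R N M by (simp add: algebra_simps)
      ultimately have "in_cubic_part \<Phi> (\<lambda>x. a x * quad_form R x)" by simp
      with contra obtain l' v where l': "clin l'" "\<And>x. quad_form R x = a x * l' x + \<Phi> v x x" by blast
      have "f = (\<lambda>x. l x * m x + a x * l' x + \<Phi> v x x)"
      proof
        fix x show "f x = l x * m x + a x * l' x + \<Phi> v x x"
          using l'(2)[of x] unfolding R kk(3) by (simp add: algebra_simps)
      qed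
      then show "f \<in> {\<lambda>x. l x * m x + a x * l' x + \<Phi> v x x | l l' v. clin l \<and> clin l'}"
        using lg(1) l'(1) by blast
    qed
    moreover have "has_indep (5 * (5 + 1) div 2) (UNIV :: (complex^5) set) products"
      using has_indep_products[OF has_indep_UNIV[where 'n = 5]] by simp
    ultimately have "has_indep 15 UNIV {\<lambda>x. l x * m x + a x * l' x + \<Phi> v x x | l l' v. clin l \<and> clin l'}"
      using has_indep_mono[OF _ _ subset_refl] by force
    from decomposable_bound[OF this a(1) ax m] show False by simp
  qed
  then obtain R where R: "in_cubic_part \<Phi> (\<lambda>x. a x * quad_form R x)"
    "\<And>m v. clin m \<Longrightarrow> \<exists>x. quad_form R x \<noteq> a x * m x + \<Phi> v x x" by blast
  define P where "P t = (\<chi> i j. M $ i $ j + t * R $ i $ j)" for t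
  have P: "quad_form (P t) x = quad_form M x + t * quad_form R x" for t x
    unfolding P_def by (rule quad_form_add_scale)
  have "\<forall>\<^sub>F t in at 0. maximal_rank \<Phi> n (P t)"
    using eventually_compose_filterlim[OF eventually_maximal[OF \<Phi> max] filterlim_line[of M R]]
    unfolding P_def .
  moreover have "\<forall>\<^sub>F t in at 0. t \<noteq> (0::complex)" by (rule eventually_neq_at_within)
  ultimately have "\<forall>\<^sub>F t in at 0. maximal_rank \<Phi> n (P t) \<and> t \<noteq> 0" by (rule eventually_conj)
  then obtain t where t: "maximal_rank \<Phi> n (P t)" "t \<noteq> 0"
    using eventually_happens'[of "at (0::complex)"] by auto
  show False
  proof (rule maximal_indecomposable_False[OF t(1) a(1) ax])
    have "in_cubic_part \<Phi> (\<lambda>x. a x * quad_form M x + t * (a x * quad_form R x))"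
      by (intro in_cubic_part_add[OF \<Phi>] in_cubic_part_cmult[OF \<Phi>] a R)
    then show "in_cubic_part \<Phi> (\<lambda>x. a x * quad_form (P t) x)" by (simp add: P algebra_simps)
    fix k :: "complex^5 \<Rightarrow> complex" and v assume k: "clin k"
    show "\<exists>x. quad_form (P t) x \<noteq> a x * k x + \<Phi> v x x"
    proof (rule ccontr)
      assume "\<not> ?thesis"
      then have *: "quad_form M x + t * quad_form R x = a x * k x + \<Phi> v x x" for x
        unfolding P by blast
      \<comment> \<open>Subtracting the decomposition of \<open>M\<close> from that of
        \<open>P t\<close> would decompose \<open>R\<close>.\<close>
      have "quad_form R x = a x * ((1 / t) * (k x - m x)) + \<Phi> ((1 / t) *s (v - u)) x x" for x
      proof -
        have tR: "t * quad_form R x = a x * (k x - m x) + (\<Phi> v x x - \<Phi> u x x)"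
          using *[of x] unfolding M by (simp add: algebra_simps)
        have "quad_form R x = (1 / t) * (t * quad_form R x)" using t(2) by simp
        also have "\<dots> = a x * ((1 / t) * (k x - m x)) + \<Phi> ((1 / t) *s (v - u)) x x"
          unfolding tR clin_scale[OF clin_p1[OF \<Phi>]] clin_diff[OF clin_p1[OF \<Phi>]]
          by (simp only: distrib_left mult.left_commute)
        finally show ?thesis .
      qed
      moreover have "clin (\<lambda>x. (1 / t) * (k x - m x))" by (intro clin_cmul clin_minus k m)
      ultimately show False using R(2) by blast
    qed
  qed
qed

end

section \<open>Quadrics tangent to the cubic\<close>

lemma differentiable_vec:
  fixes f :: "'a::real_normed_vector \<Rightarrow> complex^5^5"
  assumes "\<And>i j. (\<lambda>z. f z $ i $ j) differentiable (at x within S)"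
  shows "f differentiable (at x within S)"
proof -
  have "(\<lambda>z. f z \<bullet> b) differentiable (at x within S)" if b: "b \<in> Basis" for b
  proof -
    have "\<exists>i. \<exists>v\<in>Basis. b = axis i v" using b by (subst (asm) Basis_vec_def) blast
    then obtain i v where v: "v \<in> Basis" "b = axis i v" by blast
    have "\<exists>j. \<exists>c\<in>Basis. v = axis j c" using v(1) by (subst (asm) Basis_vec_def) blast
    then obtain j c where "v = axis j c" by blast
    then have eq: "f z \<bullet> b = f z $ i $ j \<bullet> c" for z by (simp add: v(2) inner_axis)
    obtain D where "((\<lambda>z. f z $ i $ j) has_derivative D) (at x within S)"
      using assms[of i j] unfolding differentiable_def by blast
    from bounded_linear.has_derivative[OF bounded_linear_inner_left this, of c]
    show ?thesis unfolding eq differentiable_def by blast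
  qed
  then show ?thesis by (subst differentiable_componentwise_within) blast
qed

lemma bounded_linear_entry: "bounded_linear (\<lambda>M :: complex^5^5. M $ i $ j)"
  by (rule bounded_linear_compose[OF bounded_linear_vec_nth bounded_linear_vec_nth])

lemma clin_linear: "clin f \<Longrightarrow> linear f"
  by (intro linearI) (simp_all only: clin_add clin_scaleR scaleR_conv_of_real[of _ "f _"])

text \<open>Storing the affine coordinates of the point in a matrix row makes the source of the
  parametrization of tangent quadrics the same space as its target.\<close>

definition chart_point :: "5 \<Rightarrow> complex^5^5 \<Rightarrow> complex^5" where
  "chart_point k Z = (\<chi> j. if j = k then 1 else Z $ k $ j)"

text \<open>The sum over \<open>j\<close> is the gradient of \<open>quad_form M\<close>. Pairing it
  with \<open>x\<close> shows that the quadric vanishes at \<open>x\<close> too, by Euler's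
  identity.\<close>

definition tangent_at :: "(complex^5 \<Rightarrow> complex^5 \<Rightarrow> complex^5 \<Rightarrow> complex) \<Rightarrow> complex^5^5 \<Rightarrow> complex^5 \<Rightarrow> bool" where
  "tangent_at \<Phi> M x \<longleftrightarrow> \<Phi> x x x = 0 \<and>
    (\<exists>c. \<forall>i. (\<Sum>j\<in>UNIV. (M $ i $ j + M $ j $ i) * x $ j) = c * \<Phi> (axis i 1) x x)"

context
  fixes \<Phi> :: "complex^5 \<Rightarrow> complex^5 \<Rightarrow> complex^5 \<Rightarrow> complex"
  assumes \<Phi>: "quad_family \<Phi>" and sym: "\<And>u v w. \<Phi> u v w = \<Phi> v u w"
    and nz: "\<And>x. x \<noteq> 0 \<Longrightarrow> \<exists>v. \<Phi> v x x \<noteq> 0"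
begin

lemma has_derivative_cube:
  "((\<lambda>x. \<Phi> x x x) has_derivative (\<lambda>h. 3 * \<Phi> h x x)) (at x)"
proof -
  have bil: "bounded_bilinear (\<Phi> v)" for v
    unfolding bilinear_conv_bounded_bilinear[symmetric] bilinear_def
    using clin_linear[OF clin_p2[OF \<Phi>]] clin_linear[OF clin_p3[OF \<Phi>]] by blast
  have ex: "\<Phi> u y z = (\<Sum>i\<in>UNIV. u $ i * \<Phi> (axis i 1) y z)" for u y z
    by (rule clin_expand[OF clin_p1[OF \<Phi>]])
  have "((\<lambda>x. \<Sum>i\<in>UNIV. x $ i * \<Phi> (axis i 1) x x) has_derivative
      (\<lambda>h. \<Sum>i\<in>UNIV. x $ i * (\<Phi> (axis i 1) x h + \<Phi> (axis i 1) h x) + h $ i * \<Phi> (axis i 1) x x)) (at x)"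
    by (intro has_derivative_sum has_derivative_mult bounded_bilinear.FDERIV[OF bil] has_derivative_ident
        bounded_linear_imp_has_derivative bounded_linear_vec_nth)
  moreover have "(\<Sum>i\<in>UNIV. x $ i * (\<Phi> (axis i 1) x h + \<Phi> (axis i 1) h x) + h $ i * \<Phi> (axis i 1) x x)
      = 3 * \<Phi> h x x" for h
  proof -
    have "(\<Sum>i\<in>UNIV. x $ i * (\<Phi> (axis i 1) x h + \<Phi> (axis i 1) h x) + h $ i * \<Phi> (axis i 1) x x)
        = \<Phi> x x h + \<Phi> x h x + \<Phi> h x x"
      unfolding ex[of x x h] ex[of x h x] ex[of h x x] by (simp add: distrib_left sum.distrib)
    also have "\<dots> = 3 * \<Phi> h x x"
      using p_sym[OF \<Phi>, of x x h] sym[of x h x] by simp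
    finally show ?thesis .
  qed
  ultimately show ?thesis unfolding ex[of _ _ _, symmetric] by simp
qed

text \<open>At each zero in the chart some derivative in a direction \<open>j \<noteq> k\<close> is
  nonzero. For each such \<open>j\<close>, a map with injective derivative sends that piece of the
  zero set into a hyperplane.\<close>

lemma negligible_chart: "negligible {Z. \<Phi> (chart_point k Z) (chart_point k Z) (chart_point k Z) = 0}"
proof -
  let ?X = "chart_point k"
  define X' where "X' h = (\<chi> j. if j = k then 0 else h $ k $ j)" for h :: "complex^5^5"
  have X_eq: "?X Z = X' Z + axis k 1" for Z
    by (simp add: chart_point_def X'_def vec_eq_iff axis_def)
  have linX': "linear X'" by (intro linearI) (simp_all add: X'_def vec_eq_iff)
  have derX: "(?X has_derivative X') (at Z)" for Z
    unfolding X_eq[abs_def]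
    using has_derivative_add_const[OF bounded_linear_imp_has_derivative[of X']] linX'
    by (simp add: linear_conv_bounded_linear)
  let ?f = "\<lambda>Z. \<Phi> (?X Z) (?X Z) (?X Z)"
  let ?f' = "\<lambda>Z h. 3 * \<Phi> (X' h) (?X Z) (?X Z)"
  have derf: "(?f has_derivative ?f' Z) (at Z)" for Z
    by (rule has_derivative_compose[OF derX has_derivative_cube])
  have neg: "negligible {Z \<in> {Z. \<Phi> (axis j 1) (?X Z) (?X Z) \<noteq> 0}. ?f Z = 0}" if jk: "j \<noteq> k" for j
  proof -
    define E where "E c = axis k (axis j c)" for c :: complex
    have E: "E c $ a $ b = (if a = k \<and> b = j then c else 0)" for c a b
      by (simp add: E_def axis_def)
    have linE: "bounded_linear E"
      unfolding linear_conv_bounded_linear[symmetric]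
      by (intro linearI) (simp_all add: vec_eq_iff E)
    \<comment> \<open>replacing the entry \<open>(k, j)\<close> by the value of the cubic straightens its zero set\<close>
    define g where "g Z = Z + E (?f Z - Z $ k $ j)" for Z
    define g' where "g' Z h = h + E (?f' Z h - h $ k $ j)" for Z h
    have derg: "(g has_derivative g' Z) (at Z)" for Z
      unfolding g_def[abs_def] g'_def[abs_def]
      by (intro has_derivative_add has_derivative_ident bounded_linear.has_derivative[OF linE]
          has_derivative_diff derf bounded_linear_imp_has_derivative bounded_linear_entry)
    have gkj: "g Z $ k $ j = ?f Z" for Z by (simp add: g_def E)
    \<comment> \<open>The inner product is real, so this hyperplane is the vanishing of the real
      part of the entry \<open>(k, j)\<close>. For \<open>g Z\<close> that entry is the value of the
      cubic.\<close>
    have "negligible {Z \<in> {Z. \<Phi> (axis j 1) (?X Z) (?X Z) \<noteq> 0}. g Z \<in> {Y. axis k (axis j 1) \<bullet> Y = 0}}"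
    proof (rule negligible_differentiable_vimage)
      show "negligible {Y. axis k (axis j (1::complex)) \<bullet> Y = 0}"
        by (rule negligible_hyperplane) (simp add: axis_eq_0_iff)
      show "(g has_derivative g' Z) (at Z within {Z. \<Phi> (axis j 1) (?X Z) (?X Z) \<noteq> 0})" for Z
        by (rule has_derivative_at_withinI[OF derg])
      fix Z assume "Z \<in> {Z. \<Phi> (axis j 1) (?X Z) (?X Z) \<noteq> 0}"
      then have nzj: "\<Phi> (axis j 1) (?X Z) (?X Z) \<noteq> 0" by simp
      have lin: "linear (g' Z)" by (rule has_derivative_linear[OF derg])
      show "inj (g' Z)"
        unfolding linear_injective_0[OF lin]
      proof (intro allI impI)
        fix h assume h: "g' Z h = 0"
        have "g' Z h $ a $ b = 0" for a b by (simp add: h)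
        then have ab: "h $ a $ b + (if a = k \<and> b = j then ?f' Z h - h $ k $ j else 0) = 0" for a b
          by (simp add: g'_def E)
        have other: "h $ a $ b = 0" if "\<not> (a = k \<and> b = j)" for a b
          using ab[of a b] that by simp
        have "X' h = h $ k $ j *s axis j 1"
          using jk other[of k] by (auto simp: X'_def vec_eq_iff axis_def)
        then have "?f' Z h = 3 * (h $ k $ j * \<Phi> (axis j 1) (?X Z) (?X Z))"
          by (simp add: clin_scale[OF clin_p1[OF \<Phi>]])
        moreover have "?f' Z h = 0" using ab[of k j] by simp
        ultimately have "h $ k $ j = 0" using nzj by simp
        then show "h = 0" using other unfolding vec_eq_iff by (metis zero_index)
      qed
    qed
    then show ?thesis
    proof (rule negligible_subset)
      show "{Z \<in> {Z. \<Phi> (axis j 1) (?X Z) (?X Z) \<noteq> 0}. ?f Z = 0} \<subseteq>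
          {Z \<in> {Z. \<Phi> (axis j 1) (?X Z) (?X Z) \<noteq> 0}. g Z \<in> {Y. axis k (axis j 1) \<bullet> Y = 0}}"
        by (auto simp: inner_axis' gkj)
    qed
  qed
  have "{Z. ?f Z = 0} \<subseteq> (\<Union>j\<in>UNIV - {k}. {Z \<in> {Z. \<Phi> (axis j 1) (?X Z) (?X Z) \<noteq> 0}. ?f Z = 0})"
  proof
    fix Z assume "Z \<in> {Z. ?f Z = 0}"
    then have Z: "?f Z = 0" by simp
    \<comment> \<open>If all derivatives with \<open>j \<noteq> k\<close> vanished, Euler's identity
      at a point with \<open>k\<close>-th coordinate 1 would annihilate the last one as
      well.\<close>
    have "\<exists>j\<in>UNIV - {k}. \<Phi> (axis j 1) (?X Z) (?X Z) \<noteq> 0"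
    proof (rule ccontr)
      assume "\<not> ?thesis"
      then have 0: "\<Phi> (axis j 1) (?X Z) (?X Z) = 0" if "j \<noteq> k" for j using that by blast
      have ex: "\<Phi> v (?X Z) (?X Z) = v $ k * \<Phi> (axis k 1) (?X Z) (?X Z)" for v
      proof -
        have "\<Phi> v (?X Z) (?X Z) = (\<Sum>i\<in>UNIV. v $ i * \<Phi> (axis i 1) (?X Z) (?X Z))"
          by (rule clin_expand[OF clin_p1[OF \<Phi>]])
        also have "\<dots> = v $ k * \<Phi> (axis k 1) (?X Z) (?X Z) + (\<Sum>i\<in>UNIV - {k}. v $ i * \<Phi> (axis i 1) (?X Z) (?X Z))"
          by (rule sum.remove) auto
        also have "(\<Sum>i\<in>UNIV - {k}. v $ i * \<Phi> (axis i 1) (?X Z) (?X Z)) = 0"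
          using 0 by (intro sum.neutral) auto
        finally show ?thesis by simp
      qed
      have Xk: "?X Z $ k = 1" by (simp add: chart_point_def)
      then have "\<Phi> (axis k 1) (?X Z) (?X Z) = 0" using ex[of "?X Z"] Z by simp
      then have "\<Phi> v (?X Z) (?X Z) = 0" for v using ex[of v] by simp
      moreover have "?X Z \<noteq> 0" using Xk by auto
      ultimately show False using nz by blast
    qed
    then show "Z \<in> (\<Union>j\<in>UNIV - {k}. {Z \<in> {Z. \<Phi> (axis j 1) (?X Z) (?X Z) \<noteq> 0}. ?f Z = 0})"
      using Z by blast
  qed
  moreover have "negligible (\<Union>j\<in>UNIV - {k}. {Z \<in> {Z. \<Phi> (axis j 1) (?X Z) (?X Z) \<noteq> 0}. ?f Z = 0})"
    using neg by (intro negligible_Union) auto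
  ultimately show ?thesis by (rule negligible_subset[rotated])
qed

lemma negligible_tangent_chart: "negligible {M. \<exists>x. x $ k = 1 \<and> tangent_at \<Phi> M x}"
proof -
  let ?X = "chart_point k"
  let ?S = "{Z. \<Phi> (?X Z) (?X Z) (?X Z) = 0}"
  \<comment> \<open>\<open>t Z i\<close> is the value that tangency equation \<open>i\<close> forces
    on \<open>M $ k $ i\<close>. Equation \<open>k\<close> then gives \<open>s Z\<close>, halved
    because \<open>M $ k $ k\<close> occurs twice in it.\<close>
  define t where "t Z i = Z $ k $ k * \<Phi> (axis i 1) (?X Z) (?X Z) - Z $ i $ k
    - (\<Sum>l\<in>UNIV - {k}. (Z $ i $ l + Z $ l $ i) * ?X Z $ l)" for Z i
  define s where "s Z = (Z $ k $ k * \<Phi> (axis k 1) (?X Z) (?X Z)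
    - (\<Sum>l\<in>UNIV - {k}. (t Z l + Z $ l $ k) * ?X Z $ l)) / 2" for Z
  \<comment> \<open>Row \<open>k\<close> of \<open>Z\<close> holds the other coordinates of the point and, at \<open>(k, k)\<close>, the multiplier. As
    the \<open>k\<close>-th coordinate is 1, the tangency condition can be solved for row \<open>k\<close> of \<open>M\<close>.\<close>
  define \<Psi> where "\<Psi> Z = (\<chi> i j. if i \<noteq> k then Z $ i $ j else if j \<noteq> k then t Z j else s Z)" for Z
  have d_entry: "(\<lambda>Z. Z $ i $ j) differentiable (at Z within S)" for i j :: 5 and Z :: "complex^5^5" and S
    by (rule bounded_linear_imp_differentiable[OF bounded_linear_entry])
  have d_X: "(\<lambda>Z. ?X Z $ l) differentiable (at Z within S)" for l Z S
    unfolding chart_point_def by (cases "l = k") (simp_all add: d_entry)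
  have d_\<Phi>: "(\<lambda>Z. \<Phi> v (?X Z) (?X Z)) differentiable (at Z within S)" for v Z S
  proof -
    have eq: "\<Phi> v x x = (\<Sum>i\<in>UNIV. \<Sum>j\<in>UNIV. x $ i * (x $ j * \<Phi> v (axis i 1) (axis j 1)))" for x
      by (subst clin_expand[OF clin_p2[OF \<Phi>]])
        (subst clin_expand[OF clin_p3[OF \<Phi>]], simp add: sum_distrib_left)
    show ?thesis unfolding eq
      by (intro differentiable_sum ballI finite differentiable_mult differentiable_const d_X)
  qed
  have d_t: "(\<lambda>Z. t Z i) differentiable (at Z within S)" for i Z S
    unfolding t_def
    by (intro differentiable_diff differentiable_sum ballI finite differentiable_mult differentiable_add
        d_entry d_X d_\<Phi>)
  have d_s: "s differentiable (at Z within S)" for Z S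
    unfolding s_def divide_inverse
    by (intro differentiable_diff differentiable_sum ballI finite differentiable_mult differentiable_add
        d_entry d_X d_\<Phi> d_t differentiable_const)
  have "\<Psi> differentiable_on ?S"
    unfolding differentiable_on_def
  proof (intro ballI differentiable_vec)
    fix Z i j
    show "(\<lambda>Z. \<Psi> Z $ i $ j) differentiable (at Z within ?S)"
      by (cases "i = k"; cases "j = k") (simp_all add: \<Psi>_def d_entry d_t d_s)
  qed
  then have "negligible (\<Psi> ` ?S)"
    by (intro negligible_differentiable_image_negligible negligible_chart) auto
  moreover have "{M. \<exists>x. x $ k = 1 \<and> tangent_at \<Phi> M x} \<subseteq> \<Psi> ` ?S"
  proof
    fix M assume "M \<in> {M. \<exists>x. x $ k = 1 \<and> tangent_at \<Phi> M x}"
    then obtain x c where x: "x $ k = 1" "\<Phi> x x x = 0"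
      and c: "\<And>i. (\<Sum>j\<in>UNIV. (M $ i $ j + M $ j $ i) * x $ j) = c * \<Phi> (axis i 1) x x"
      unfolding tangent_at_def by blast
    have c': "(M $ i $ k + M $ k $ i) + (\<Sum>j\<in>UNIV - {k}. (M $ i $ j + M $ j $ i) * x $ j)
        = c * \<Phi> (axis i 1) x x" for i
      using c[of i] x(1) by (subst (asm) sum.remove[of _ k]) auto
    \<comment> \<open>Row \<open>k\<close> of \<open>M\<close> is overwritten by the point and the
      multiplier; \<open>t\<close> and \<open>s\<close> recover the lost entries.\<close>
    define Z where "Z = (\<chi> i j. if i \<noteq> k then M $ i $ j else if j = k then c else x $ j)"
    have XZ: "?X Z = x" using x(1) by (simp add: Z_def chart_point_def vec_eq_iff)
    have tZ: "t Z i = M $ k $ i" if "i \<noteq> k" for i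
    proof -
      have "(\<Sum>l\<in>UNIV - {k}. (Z $ i $ l + Z $ l $ i) * x $ l) = (\<Sum>l\<in>UNIV - {k}. (M $ i $ l + M $ l $ i) * x $ l)"
        using that by (intro sum.cong) (auto simp: Z_def)
      then have "t Z i = c * \<Phi> (axis i 1) x x - M $ i $ k - (\<Sum>l\<in>UNIV - {k}. (M $ i $ l + M $ l $ i) * x $ l)"
        using that unfolding t_def XZ by (simp add: Z_def)
      then show ?thesis unfolding c'[of i, symmetric] by simp
    qed
    have sZ: "s Z = M $ k $ k"
    proof -
      have "(\<Sum>l\<in>UNIV - {k}. (t Z l + Z $ l $ k) * x $ l) = (\<Sum>l\<in>UNIV - {k}. (M $ k $ l + M $ l $ k) * x $ l)"
        using tZ by (intro sum.cong) (auto simp: Z_def)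
      then have "s Z = (c * \<Phi> (axis k 1) x x - (\<Sum>l\<in>UNIV - {k}. (M $ k $ l + M $ l $ k) * x $ l)) / 2"
        unfolding s_def XZ by (simp add: Z_def)
      then show ?thesis unfolding c'[of k, symmetric] by simp
    qed
    have "\<Psi> Z = M" by (simp add: \<Psi>_def vec_eq_iff tZ sZ) (simp add: Z_def)
    moreover have "Z \<in> ?S" using x(2) by (simp add: XZ)
    ultimately show "M \<in> \<Psi> ` ?S" by blast
  qed
  ultimately show ?thesis by (rule negligible_subset)
qed

lemma negligible_tangent: "negligible {M. \<exists>x. x \<noteq> 0 \<and> tangent_at \<Phi> M x}"
proof -
  have "{M. \<exists>x. x \<noteq> 0 \<and> tangent_at \<Phi> M x} \<subseteq> (\<Union>k\<in>UNIV. {M. \<exists>x. x $ k = 1 \<and> tangent_at \<Phi> M x})"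
  proof
    fix M assume "M \<in> {M. \<exists>x. x \<noteq> 0 \<and> tangent_at \<Phi> M x}"
    then obtain x c where x: "x \<noteq> 0" "\<Phi> x x x = 0"
      and c: "\<And>i. (\<Sum>j\<in>UNIV. (M $ i $ j + M $ j $ i) * x $ j) = c * \<Phi> (axis i 1) x x"
      unfolding tangent_at_def by blast
    obtain k where k: "x $ k \<noteq> 0" using x(1) by (auto simp: vec_eq_iff)
    define y where "y = (1 / x $ k) *s x"
    have "y $ k = 1" using k by (simp add: y_def)
    moreover have "tangent_at \<Phi> M y"
      unfolding tangent_at_def
    \<comment> \<open>The gradients of quadric and cubic have degrees 1 and 2, so dividing the point
      by \<open>x $ k\<close> multiplies the multiplier by \<open>x $ k\<close>.\<close>
    proof (intro conjI exI[of _ "c * x $ k"] allI)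
      show "\<Phi> y y y = 0" using x(2) by (simp add: y_def p_lin[OF \<Phi>])
      fix i
      have "(\<Sum>j\<in>UNIV. (M $ i $ j + M $ j $ i) * y $ j) = (1 / x $ k) * (\<Sum>j\<in>UNIV. (M $ i $ j + M $ j $ i) * x $ j)"
        unfolding sum_distrib_left by (intro sum.cong) (simp_all add: y_def)
      also have "\<dots> = c * x $ k * \<Phi> (axis i 1) y y"
        using k by (simp add: c y_def p_lin[OF \<Phi>])
      finally show "(\<Sum>j\<in>UNIV. (M $ i $ j + M $ j $ i) * y $ j) = c * x $ k * \<Phi> (axis i 1) y y" .
    qed
    ultimately show "M \<in> (\<Union>k\<in>UNIV. {M. \<exists>x. x $ k = 1 \<and> tangent_at \<Phi> M x})" by blast
  qed
  moreover have "negligible (\<Union>k\<in>UNIV. {M. \<exists>x. x $ k = 1 \<and> tangent_at \<Phi> M x})"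
    using negligible_tangent_chart by (intro negligible_Union) auto
  ultimately show ?thesis by (rule negligible_subset[rotated])
qed

theorem exists_good_quadric:
  "\<exists>M. (\<forall>x. x \<noteq> 0 \<longrightarrow> \<not> tangent_at \<Phi> M x) \<and>
    (\<forall>a. clin a \<longrightarrow> in_cubic_part \<Phi> (\<lambda>x. a x * quad_form M x) \<longrightarrow> (\<forall>x. a x = 0))"
proof -
  obtain n M0 where "maximal_rank \<Phi> n M0" using obtain_maximal[OF \<Phi>] by blast
  from eventually_maximal[OF \<Phi> this] obtain S where
    S: "open S" "M0 \<in> S" "\<And>M. M \<in> S \<Longrightarrow> maximal_rank \<Phi> n M"
    unfolding eventually_nhds by blast
  have "\<not> negligible S" using open_not_negligible[OF S(1)] S(2) by blast
  then have "\<not> S \<subseteq> {M. \<exists>x. x \<noteq> 0 \<and> tangent_at \<Phi> M x}"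
    using negligible_subset[OF negligible_tangent] by blast
  then obtain M where M: "M \<in> S" "\<And>x. x \<noteq> 0 \<Longrightarrow> \<not> tangent_at \<Phi> M x" by blast
  show ?thesis
    using M(2) maximal_injective[OF \<Phi> sym nz S(3)[OF M(1)]] by blast
qed

end

section \<open>Polynomials as functions\<close>

definition basis_exp :: "5 \<Rightarrow> monomial" where
  "basis_exp i = Poly_Mapping.single i 1"

lemma lookup_basis_exp: "Poly_Mapping.lookup (basis_exp i) j = (if j = i then 1 else 0)"
  by (simp add: basis_exp_def lookup_single when_def)

definition monomial_value :: "complex^5 \<Rightarrow> monomial \<Rightarrow> complex" where
  "monomial_value x m = (\<Prod>i\<in>UNIV. (x $ i) ^ Poly_Mapping.lookup m i)"

lemma monomial_value_0 [simp]: "monomial_value x 0 = 1"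
  by (simp add: monomial_value_def)

lemma monomial_value_add: "monomial_value x (m + n) = monomial_value x m * monomial_value x n"
  by (simp add: monomial_value_def lookup_add power_add prod.distrib)

lemma monomial_value_basis_exp [simp]: "monomial_value x (basis_exp i) = x $ i"
proof -
  have "monomial_value x (basis_exp i) = (\<Prod>j\<in>UNIV. if j = i then x $ j else 1)"
    unfolding monomial_value_def by (intro prod.cong) (auto simp: lookup_basis_exp)
  then show ?thesis by simp
qed

lemma monomial_value_scale: "monomial_value (t *s x) m = t ^ total_degree m * monomial_value x m"
  by (simp add: monomial_value_def total_degree_def power_mult_distrib prod.distrib power_sum)

lemma eval_poly_superset:
  assumes "finite S" "Poly_Mapping.keys p \<subseteq> S"
  shows "eval_poly p x = (\<Sum>m\<in>S. Poly_Mapping.lookup p m * monomial_value x m)"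
  unfolding eval_poly_def monomial_value_def[symmetric]
  by (rule sum.mono_neutral_left) (use assms in \<open>auto simp: in_keys_iff\<close>)

lemma eval_poly_eq_sum: "eval_poly p x = (\<Sum>m\<in>Poly_Mapping.keys p. Poly_Mapping.lookup p m * monomial_value x m)"
  by (rule eval_poly_superset) auto

lemma eval_poly_0 [simp]: "eval_poly 0 x = 0"
  by (simp add: eval_poly_def)

lemma eval_poly_single [simp]: "eval_poly (Poly_Mapping.single m c) x = c * monomial_value x m"
  by (subst eval_poly_superset[of "{m}"]) auto

lemma eval_poly_add: "eval_poly (p + q) x = eval_poly p x + eval_poly q x"
proof -
  let ?S = "Poly_Mapping.keys p \<union> Poly_Mapping.keys q"
  have "eval_poly (p + q) x = (\<Sum>m\<in>?S. Poly_Mapping.lookup (p + q) m * monomial_value x m)"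
    by (rule eval_poly_superset) (simp_all add: keys_add)
  moreover have "eval_poly p x = (\<Sum>m\<in>?S. Poly_Mapping.lookup p m * monomial_value x m)"
    "eval_poly q x = (\<Sum>m\<in>?S. Poly_Mapping.lookup q m * monomial_value x m)"
    by (rule eval_poly_superset; simp)+
  ultimately show ?thesis by (simp add: lookup_add distrib_right sum.distrib)
qed

lemma eval_poly_sum: "eval_poly (\<Sum>i\<in>I. p i) x = (\<Sum>i\<in>I. eval_poly (p i) x)"
  by (induction I rule: infinite_finite_induct) (simp_all add: eval_poly_add)

lemma sum_singles: "(\<Sum>m\<in>Poly_Mapping.keys p. Poly_Mapping.single m (Poly_Mapping.lookup p m)) = p"
proof (rule poly_mapping_eqI)
  fix n
  have "Poly_Mapping.lookup (\<Sum>m\<in>Poly_Mapping.keys p. Poly_Mapping.single m (Poly_Mapping.lookup p m)) n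
      = (\<Sum>m\<in>Poly_Mapping.keys p. if m = n then Poly_Mapping.lookup p m else 0)"
    unfolding lookup_sum lookup_single when_def ..
  also have "\<dots> = (if n \<in> Poly_Mapping.keys p then Poly_Mapping.lookup p n else 0)"
    by (rule sum.delta) simp
  also have "\<dots> = Poly_Mapping.lookup p n" by (simp add: in_keys_iff)
  finally show "Poly_Mapping.lookup (\<Sum>m\<in>Poly_Mapping.keys p. Poly_Mapping.single m (Poly_Mapping.lookup p m)) n
      = Poly_Mapping.lookup p n" .
qed

lemma polynomial_induct [case_names zero single add]:
  fixes p :: polynomial
  assumes "P 0" "\<And>m c. P (Poly_Mapping.single m c)" "\<And>p q. P p \<Longrightarrow> P q \<Longrightarrow> P (p + q)"
  shows "P p"
proof -
  have sums: "P (\<Sum>m\<in>I. Poly_Mapping.single m (c m))" if "finite I" for I c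
    using that
  proof (induction I rule: finite_induct)
    case empty
    show ?case using assms(1) by simp
  next
    case (insert m I)
    then have "(\<Sum>m\<in>insert m I. Poly_Mapping.single m (c m)) =
        Poly_Mapping.single m (c m) + (\<Sum>m\<in>I. Poly_Mapping.single m (c m))" by simp
    then show ?case using assms(3)[OF assms(2) insert.IH] by (simp only:)
  qed
  have "P (\<Sum>m\<in>Poly_Mapping.keys p. Poly_Mapping.single m (Poly_Mapping.lookup p m))"
    by (rule sums) (rule finite_keys)
  then show ?thesis by (simp only: sum_singles)
qed

lemma eval_poly_mult: "eval_poly (p * q) x = eval_poly p x * eval_poly q x"
proof (induction p rule: polynomial_induct)
  case (single m c)
  show ?case
    by (induction q rule: polynomial_induct)
      (simp_all add: mult_single monomial_value_add eval_poly_add distrib_left)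
qed (simp_all add: eval_poly_add distrib_right)

section \<open>Formal partial derivatives, degrees and Euler's identity\<close>

lemma partial_deriv_superset:
  assumes "finite S" "Poly_Mapping.keys p \<subseteq> S"
  shows "partial_deriv i p = (\<Sum>m\<in>S. Poly_Mapping.single (m - basis_exp i)
    (of_nat (Poly_Mapping.lookup m i) * Poly_Mapping.lookup p m))"
  unfolding partial_deriv_def basis_exp_def[symmetric]
  by (rule sum.mono_neutral_left) (use assms in \<open>auto simp: in_keys_iff\<close>)

lemma partial_deriv_0 [simp]: "partial_deriv i 0 = 0"
  by (simp add: partial_deriv_def)

lemma partial_deriv_single:
  "partial_deriv i (Poly_Mapping.single m c) =
    Poly_Mapping.single (m - basis_exp i) (of_nat (Poly_Mapping.lookup m i) * c)"
  by (subst partial_deriv_superset[of "{m}"]) auto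

lemma partial_deriv_add: "partial_deriv i (p + q) = partial_deriv i p + partial_deriv i q"
proof -
  let ?S = "Poly_Mapping.keys p \<union> Poly_Mapping.keys q"
  let ?t = "\<lambda>p. \<Sum>m\<in>?S. Poly_Mapping.single (m - basis_exp i) (of_nat (Poly_Mapping.lookup m i) * Poly_Mapping.lookup p m)"
  have "partial_deriv i (p + q) = ?t (p + q)"
    by (rule partial_deriv_superset) (simp_all add: keys_add)
  moreover have "partial_deriv i p = ?t p" "partial_deriv i q = ?t q"
    by (rule partial_deriv_superset; simp)+
  ultimately show ?thesis by (simp add: lookup_add distrib_left single_add sum.distrib)
qed

lemma partial_deriv_sum: "partial_deriv i (\<Sum>j\<in>J. p j) = (\<Sum>j\<in>J. partial_deriv i (p j))"
  by (induction J rule: infinite_finite_induct) (simp_all add: partial_deriv_add)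

lemma partial_deriv_commute: "partial_deriv i (partial_deriv j p) = partial_deriv j (partial_deriv i p)"
proof (induction p rule: polynomial_induct)
  case (single m c)
  show ?case
  proof (cases "i = j")
    case False
    then show ?thesis
      by (simp add: partial_deriv_single lookup_minus lookup_basis_exp cancel_ab_semigroup_add_class.diff_right_commute[of m]
          mult.left_commute)
  qed simp
qed (simp_all add: partial_deriv_add)

lemma split_monomial:
  assumes "Poly_Mapping.lookup m i \<noteq> 0"
  shows "m = (m - basis_exp i) + basis_exp i"
proof (rule poly_mapping_eqI)
  fix j
  show "Poly_Mapping.lookup m j = Poly_Mapping.lookup (m - basis_exp i + basis_exp i) j"
    using assms by (simp add: lookup_add lookup_minus lookup_basis_exp)
qed

lemma total_degree_add: "total_degree (m + n) = total_degree m + total_degree n"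
  by (simp add: total_degree_def lookup_add sum.distrib)

lemma total_degree_basis_exp [simp]: "total_degree (basis_exp i) = 1"
proof -
  have "total_degree (basis_exp i) = (\<Sum>j\<in>UNIV. if j = i then 1 else 0)"
    unfolding total_degree_def by (intro sum.cong) (auto simp: lookup_basis_exp)
  then show ?thesis by simp
qed

lemma total_degree_0_iff: "total_degree m = 0 \<longleftrightarrow> m = 0"
  by (auto simp: total_degree_def intro!: poly_mapping_eqI)

lemma total_degree_1:
  assumes "total_degree m = 1"
  obtains i where "m = basis_exp i"
proof -
  have "\<exists>i. Poly_Mapping.lookup m i \<noteq> 0"
  proof (rule ccontr)
    assume "\<not> ?thesis"
    then have "total_degree m = 0" by (simp add: total_degree_def)
    with assms show False by simp
  qed
  then obtain i where i: "m = (m - basis_exp i) + basis_exp i" using split_monomial by blast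
  then have "total_degree (m - basis_exp i) = 0"
    using assms total_degree_add[of "m - basis_exp i" "basis_exp i"] by simp
  then show ?thesis using that i by (simp add: total_degree_0_iff)
qed

lemma eval_poly_partial_deriv:
  "eval_poly (partial_deriv i p) x = (\<Sum>m\<in>Poly_Mapping.keys p.
    Poly_Mapping.lookup p m * (of_nat (Poly_Mapping.lookup m i) * monomial_value x (m - basis_exp i)))"
  by (simp add: partial_deriv_def basis_exp_def[symmetric] eval_poly_sum mult_ac del: One_nat_def)

lemma euler:
  assumes "p \<in> forms k"
  shows "(\<Sum>i\<in>UNIV. x $ i * eval_poly (partial_deriv i p) x) = of_nat k * eval_poly p x"
proof -
  have 1: "x $ i * (of_nat (Poly_Mapping.lookup m i) * monomial_value x (m - basis_exp i)) = of_nat (Poly_Mapping.lookup m i) * monomial_value x m" for i m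
  proof (cases "Poly_Mapping.lookup m i = 0")
    case False
    have "monomial_value x m = monomial_value x (m - basis_exp i) * x $ i"
      by (subst split_monomial[OF False]) (simp only: monomial_value_add monomial_value_basis_exp)
    then show ?thesis by simp
  qed simp
  have "(\<Sum>i\<in>UNIV. x $ i * eval_poly (partial_deriv i p) x) = (\<Sum>m\<in>Poly_Mapping.keys p. \<Sum>i\<in>UNIV.
      Poly_Mapping.lookup p m * (x $ i * (of_nat (Poly_Mapping.lookup m i) * monomial_value x (m - basis_exp i))))"
    unfolding eval_poly_partial_deriv sum_distrib_left
    by (subst sum.swap) (simp only: mult.left_commute)
  also have "\<dots> = (\<Sum>m\<in>Poly_Mapping.keys p. of_nat (total_degree m) * (Poly_Mapping.lookup p m * monomial_value x m))"
    unfolding 1 total_degree_def of_nat_sum sum_distrib_right by (simp only: mult.left_commute)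
  also have "\<dots> = (\<Sum>m\<in>Poly_Mapping.keys p. of_nat k * (Poly_Mapping.lookup p m * monomial_value x m))"
    using assms by (intro sum.cong) (auto simp: forms_def)
  finally show ?thesis by (simp only: eval_poly_eq_sum sum_distrib_left)
qed

lemma forms_partial_deriv:
  assumes "p \<in> forms (Suc k)"
  shows "partial_deriv i p \<in> forms k"
  unfolding forms_def
proof (intro CollectI ballI)
  fix n assume "n \<in> Poly_Mapping.keys (partial_deriv i p)"
  then have "n \<in> (\<Union>m\<in>Poly_Mapping.keys p. Poly_Mapping.keys (Poly_Mapping.single (m - basis_exp i)
      (of_nat (Poly_Mapping.lookup m i) * Poly_Mapping.lookup p m)))"
    unfolding partial_deriv_def basis_exp_def[symmetric] by (rule subsetD[OF keys_sum])
  then obtain m where m: "m \<in> Poly_Mapping.keys p"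
    "n \<in> Poly_Mapping.keys (Poly_Mapping.single (m - basis_exp i) (of_nat (Poly_Mapping.lookup m i) * Poly_Mapping.lookup p m))"
    by (elim UN_E)
  then have n: "n = m - basis_exp i" "Poly_Mapping.lookup m i \<noteq> 0" by (auto split: if_splits)
  have "total_degree m = total_degree n + 1"
    by (subst split_monomial[OF n(2)]) (simp only: total_degree_add total_degree_basis_exp n(1))
  moreover have "total_degree m = Suc k" using assms m(1) by (simp add: forms_def)
  ultimately show "total_degree n = k" by simp
qed

lemma eval_forms_0:
  assumes "p \<in> forms 0"
  shows "eval_poly p x = eval_poly p y"
proof -
  have "Poly_Mapping.keys p \<subseteq> {0}" using assms by (auto simp: forms_def total_degree_0_iff)
  then show ?thesis by (simp add: eval_poly_superset[of "{0}"])
qed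

lemma eval_forms_scale:
  assumes "p \<in> forms k"
  shows "eval_poly p (t *s x) = t ^ k * eval_poly p x"
  unfolding eval_poly_eq_sum sum_distrib_left
  using assms by (intro sum.cong) (auto simp: monomial_value_scale forms_def)

text \<open>The component of degree 1 of an arbitrary polynomial. Ideal coefficients need not be
  homogeneous, and this is the part of them that acts in degree 3.\<close>

definition linear_part :: "polynomial \<Rightarrow> complex^5 \<Rightarrow> complex" where
  "linear_part h x = (\<Sum>i\<in>UNIV. Poly_Mapping.lookup h (basis_exp i) * x $ i)"

lemma clin_linear_part: "clin (linear_part h)"
  unfolding linear_part_def by (intro clin_sum' clin_cmul clin_component)

lemma sum_degree_1:
  assumes "finite S"
  shows "(\<Sum>m\<in>{m \<in> S. total_degree m = 1}. if m \<in> Poly_Mapping.keys h then Poly_Mapping.lookup h m * monomial_value x m else 0)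
    = (\<Sum>i\<in>{i. basis_exp i \<in> S}. Poly_Mapping.lookup h (basis_exp i) * x $ i)"
proof -
  have eq: "{m \<in> S. total_degree m = 1} = basis_exp ` {i. basis_exp i \<in> S}"
  proof (intro equalityI subsetI)
    fix m assume "m \<in> {m \<in> S. total_degree m = 1}"
    then show "m \<in> basis_exp ` {i. basis_exp i \<in> S}" by (auto simp del: One_nat_def elim!: total_degree_1)
  qed (auto simp del: One_nat_def)
  have inj: "inj_on basis_exp {i. basis_exp i \<in> S}"
    
  proof (rule inj_onI)
    fix i j assume "basis_exp i = basis_exp j"
    then have "Poly_Mapping.lookup (basis_exp i) i = Poly_Mapping.lookup (basis_exp j) i" by simp
    then show "i = j" by (simp add: lookup_basis_exp split: if_splits)
  qed
  show ?thesis
    unfolding eq sum.reindex[OF inj] by (intro sum.cong) (auto simp: in_keys_iff)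
qed

lemma linear_part_eq:
  "linear_part h x = (\<Sum>m\<in>{m \<in> Poly_Mapping.keys h. total_degree m = 1}. Poly_Mapping.lookup h m * monomial_value x m)"
proof -
  have "(\<Sum>m\<in>{m \<in> Poly_Mapping.keys h. total_degree m = 1}. Poly_Mapping.lookup h m * monomial_value x m) =
    (\<Sum>m\<in>{m \<in> Poly_Mapping.keys h. total_degree m = 1}. if m \<in> Poly_Mapping.keys h then Poly_Mapping.lookup h m * monomial_value x m else 0)"
    by (intro sum.cong) auto
  also have "\<dots> = (\<Sum>i\<in>{i. basis_exp i \<in> Poly_Mapping.keys h}. Poly_Mapping.lookup h (basis_exp i) * x $ i)"
    by (rule sum_degree_1) simp
  also have "\<dots> = linear_part h x"
    unfolding linear_part_def by (rule sum.mono_neutral_left) (auto simp: in_keys_iff)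
  finally show ?thesis by simp
qed

lemma eval_forms_1: "p \<in> forms 1 \<Longrightarrow> eval_poly p x = linear_part p x"
  unfolding linear_part_eq eval_poly_eq_sum by (intro sum.cong) (auto simp: forms_def)

lemma forms_1_eq_0:
  assumes "p \<in> forms 1" "\<And>x. eval_poly p x = 0"
  shows "p = 0"
proof (rule poly_mapping_eqI)
  fix m
  have 0: "Poly_Mapping.lookup p (basis_exp i) = 0" for i
  proof -
    have "linear_part p (axis i 1) = 0" using assms by (simp add: eval_forms_1[symmetric])
    then show ?thesis by (simp add: linear_part_def axis_def if_distrib cong: if_cong)
  qed
  show "Poly_Mapping.lookup p m = Poly_Mapping.lookup 0 m"
  proof (cases "m \<in> Poly_Mapping.keys p")
    case True
    then have "total_degree m = 1" using assms(1) by (simp add: forms_def)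
    then show ?thesis using 0 by (auto simp del: One_nat_def elim!: total_degree_1)
  qed (simp add: in_keys_iff)
qed

text \<open>Along the line through \<open>x\<close> a monomial of degree \<open>d\<close> scales by
  \<open>t ^ d\<close>, so the derivative at 0 sees degree 1 only.\<close>

lemma has_field_derivative_eval:
  "((\<lambda>t. eval_poly h (t *s x)) has_field_derivative linear_part h x) (at 0)"
proof -
  have pow: "((\<lambda>t. t ^ n * c) has_field_derivative (if n = 1 then c else 0)) (at (0::complex))" for n c
  proof -
    have "((\<lambda>t. t ^ n * c) has_field_derivative (of_nat n * (0 ^ (n - 1)) * c)) (at (0::complex))"
      by (auto intro!: derivative_eq_intros)
    moreover have "of_nat n * (0 ^ (n - 1)) * c = (if n = 1 then c else 0)"
      by (cases n; cases "n - 1") auto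
    ultimately show ?thesis by simp
  qed
  have "((\<lambda>t. \<Sum>m\<in>Poly_Mapping.keys h. t ^ total_degree m * (Poly_Mapping.lookup h m * monomial_value x m)) has_field_derivative
      (\<Sum>m\<in>Poly_Mapping.keys h. if total_degree m = 1 then Poly_Mapping.lookup h m * monomial_value x m else 0)) (at 0)"
    by (intro DERIV_sum pow)
  moreover have "eval_poly h (t *s x) = (\<Sum>m\<in>Poly_Mapping.keys h. t ^ total_degree m * (Poly_Mapping.lookup h m * monomial_value x m))" for t
    unfolding eval_poly_eq_sum monomial_value_scale by (simp only: mult.left_commute)
  moreover have "(\<Sum>m\<in>Poly_Mapping.keys h. if total_degree m = 1 then Poly_Mapping.lookup h m * monomial_value x m else 0) = linear_part h x"
    unfolding linear_part_eq by (subst sum.inter_filter) simp_all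
  ultimately show ?thesis by simp
qed

text \<open>The degree 3 part of an identity \<open>f = \<Sum> h\<^sub>i q\<^sub>i\<close> is found by differentiating it along the line through \<open>x\<close>.\<close>

lemma linear_parts_of_cubic:
  assumes f: "f \<in> forms 1" "g \<in> forms 2" and q: "\<And>i. i \<in> I \<Longrightarrow> q i \<in> forms 2"
    and eq: "f * g = (\<Sum>i\<in>I. h i * q i)"
  shows "eval_poly f x * eval_poly g x = (\<Sum>i\<in>I. linear_part (h i) x * eval_poly (q i) x)"
proof -
  \<comment> \<open>The right-hand side at \<open>t *s x\<close>, with the factor
    \<open>t ^ 2\<close> of the quadrics divided out; the left-hand side then becomes linear in
    \<open>t\<close>.\<close>
  define G where "G t = (\<Sum>i\<in>I. eval_poly (h i) (t *s x) * eval_poly (q i) x)" for t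
  have G: "G t = t * (eval_poly f x * eval_poly g x)" if "t \<noteq> 0" for t
  proof -
    have "eval_poly (f * g) (t *s x) = eval_poly (\<Sum>i\<in>I. h i * q i) (t *s x)" by (simp only: eq)
    then have "t ^ 1 * eval_poly f x * (t ^ 2 * eval_poly g x) =
        (\<Sum>i\<in>I. eval_poly (h i) (t *s x) * (t ^ 2 * eval_poly (q i) x))"
      unfolding eval_poly_mult eval_poly_sum eval_forms_scale[OF f(1)] eval_forms_scale[OF f(2)]
      by (simp add: eval_forms_scale[OF q])
    then have "t ^ 2 * (t * (eval_poly f x * eval_poly g x)) = t ^ 2 * G t"
      by (simp add: G_def sum_distrib_left mult_ac)
    then show ?thesis using that by simp
  qed
  have dG: "(G has_field_derivative (\<Sum>i\<in>I. linear_part (h i) x * eval_poly (q i) x)) (at 0)"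
    unfolding G_def[abs_def] by (intro DERIV_sum DERIV_cmult_right has_field_derivative_eval)
  \<comment> \<open>Division by \<open>t ^ 2\<close> excluded 0, so this value comes from
    continuity.\<close>
  have G0: "G 0 = 0"
  proof -
    have "(G \<longlongrightarrow> G 0) (at 0)" using DERIV_isCont[OF dG] by (simp add: isCont_def)
    moreover have "((\<lambda>t. t * (eval_poly f x * eval_poly g x)) \<longlongrightarrow> 0 * (eval_poly f x * eval_poly g x)) (at 0)"
      by (intro tendsto_intros)
    then have "(G \<longlongrightarrow> 0 * (eval_poly f x * eval_poly g x)) (at 0)"
      by (rule Lim_transform_eventually) (auto simp: eventually_at_filter G)
    ultimately show ?thesis using tendsto_unique[of "at (0::complex)" G] by fastforce
  qed
  have "G = (\<lambda>t. t * (eval_poly f x * eval_poly g x))"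
  proof
    fix t show "G t = t * (eval_poly f x * eval_poly g x)" using G G0 by (cases "t = 0") auto
  qed
  then have "(G has_field_derivative eval_poly f x * eval_poly g x) (at 0)"
    by (auto intro!: derivative_eq_intros)
  then show ?thesis using DERIV_unique[OF _ dG] by simp
qed

section \<open>The Jacobian ideal and the polynomial of a matrix\<close>

lemma module_mult: "module ((*) :: polynomial \<Rightarrow> polynomial \<Rightarrow> polynomial)"
  by (rule module.intro) (simp_all add: algebra_simps)

text \<open>Combinations with arbitrary polynomial coefficients form a submodule containing the
  generators. Indexing them by the variables makes coinciding derivatives harmless.\<close>

lemma jacobian_ideal_explicit:
  assumes "p \<in> jacobian_ideal F"
  shows "\<exists>h. p = (\<Sum>i\<in>UNIV. h i * partial_deriv i F)"
proof -
  let ?T = "{p. \<exists>h. p = (\<Sum>i\<in>UNIV. h i * partial_deriv i F)}"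
  have "module.subspace (*) ?T"
    unfolding module.subspace_def[OF module_mult]
  proof (intro conjI ballI allI)
    show "0 \<in> ?T" by (intro CollectI exI[of _ "\<lambda>_. 0"]) simp
    fix p assume "p \<in> ?T"
    then obtain h where h: "p = (\<Sum>i\<in>UNIV. h i * partial_deriv i F)" by blast
    show "p + q \<in> ?T" if q: "q \<in> ?T" for q
    proof -
      obtain k where "q = (\<Sum>i\<in>UNIV. k i * partial_deriv i F)" using q by blast
      then show ?thesis
        using h by (intro CollectI exI[of _ "\<lambda>i. h i + k i"]) (simp add: distrib_right sum.distrib)
    qed
    show "c * p \<in> ?T" for c
      using h by (intro CollectI exI[of _ "\<lambda>i. c * h i"]) (simp add: sum_distrib_left mult.assoc)
  qed
  moreover have "range (\<lambda>i. partial_deriv i F) \<subseteq> ?T"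
  proof (intro subsetI, elim rangeE)
    fix p i assume p: "p = partial_deriv i F"
    have "(\<Sum>j\<in>UNIV. (if j = i then 1 else 0) * partial_deriv j F) = (\<Sum>j\<in>UNIV. if j = i then partial_deriv j F else 0)"
      by (intro sum.cong) auto
    then show "p \<in> ?T" using p by (intro CollectI exI[of _ "\<lambda>j. if j = i then 1 else 0"]) simp
  qed
  ultimately have "jacobian_ideal F \<subseteq> ?T"
    unfolding jacobian_ideal_def by (intro module.span_minimal[OF module_mult])
  then show ?thesis using assms by blast
qed

definition quadric :: "complex^5^5 \<Rightarrow> polynomial" where
  "quadric M = (\<Sum>i\<in>UNIV. \<Sum>j\<in>UNIV. Poly_Mapping.single (basis_exp i + basis_exp j) (M $ i $ j))"

lemma eval_quadric: "eval_poly (quadric M) x = quad_form M x"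
  by (simp add: quadric_def eval_poly_sum monomial_value_add quad_form_def)

lemma quadric_forms: "quadric M \<in> forms 2"
  unfolding forms_def
proof (intro CollectI ballI)
  fix m assume "m \<in> Poly_Mapping.keys (quadric M)"
  then have "m \<in> (\<Union>i\<in>UNIV. Poly_Mapping.keys (\<Sum>j\<in>UNIV. Poly_Mapping.single (basis_exp i + basis_exp j) (M $ i $ j)))"
    unfolding quadric_def by (rule subsetD[OF keys_sum])
  then obtain i where "m \<in> Poly_Mapping.keys (\<Sum>j\<in>UNIV. Poly_Mapping.single (basis_exp i + basis_exp j) (M $ i $ j))"
    by (elim UN_E)
  then have "m \<in> (\<Union>j\<in>UNIV. Poly_Mapping.keys (Poly_Mapping.single (basis_exp i + basis_exp j) (M $ i $ j)))"
    by (rule subsetD[OF keys_sum])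
  then obtain j where "m \<in> Poly_Mapping.keys (Poly_Mapping.single (basis_exp i + basis_exp j) (M $ i $ j))"
    by (elim UN_E)
  then have "m = basis_exp i + basis_exp j" by (auto split: if_splits)
  then show "total_degree m = 2" by (simp only: total_degree_add total_degree_basis_exp)
qed

lemma gradient_quadric:
  "eval_poly (partial_deriv l (quadric M)) x = (\<Sum>j\<in>UNIV. (M $ l $ j + M $ j $ l) * x $ j)"
proof -
  have "eval_poly (partial_deriv l (Poly_Mapping.single (basis_exp i + basis_exp j) c)) x =
      (if i = l then c * x $ j else 0) + (if j = l then c * x $ i else 0)" for i j c
  proof -
    have "basis_exp i + basis_exp j - basis_exp l = (if i = l then basis_exp j else basis_exp i)" if "i = l \<or> j = l"
      using that by auto
    then show ?thesis
      by (auto simp: partial_deriv_single lookup_add lookup_basis_exp)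
  qed
  then have "eval_poly (partial_deriv l (quadric M)) x = (\<Sum>i\<in>UNIV. \<Sum>j\<in>UNIV.
      (if i = l then M $ i $ j * x $ j else 0) + (if j = l then M $ i $ j * x $ i else 0))"
    by (simp add: quadric_def partial_deriv_sum eval_poly_sum)
  also have "\<dots> = (\<Sum>i\<in>UNIV. if i = l then \<Sum>j\<in>UNIV. M $ i $ j * x $ j else 0) + (\<Sum>i\<in>UNIV. M $ i $ l * x $ i)"
    unfolding sum.distrib by (intro arg_cong2[of _ _ _ _ "(+)"] sum.cong) auto
  finally show ?thesis by (simp add: distrib_right sum.distrib)
qed

theorem theorem1p4:
  fixes F :: polynomial
  assumes "F \<in> forms 3" and "smooth_form F"
  shows "\<exists>Q\<in>forms 2. smooth_complete_intersection F Q \<and>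
           linear_colon (jacobian_piece F 3) Q = {0}"
proof -
  \<comment> \<open>Third derivatives of a cubic are constant, so 0 is just a convenient point. They
    are the coefficients of the symmetric trilinear form \<open>\<Phi>\<close>, which is 6 times
    \<open>F\<close> on the diagonal.\<close>
  define T where "T i j k = eval_poly (partial_deriv k (partial_deriv j (partial_deriv i F))) 0" for i j k
  define \<Phi> where "\<Phi> x y z = (\<Sum>i\<in>UNIV. \<Sum>j\<in>UNIV. \<Sum>k\<in>UNIV. T i j k * (x $ i * (y $ j * z $ k)))" for x y z
  have F1: "partial_deriv i F \<in> forms 2" for i
    by (rule forms_partial_deriv) (use assms(1) in \<open>simp add: numeral_3_eq_3 numeral_2_eq_2\<close>)
  have F2: "partial_deriv j (partial_deriv i F) \<in> forms 1" for i j
    by (rule forms_partial_deriv) (use F1 in \<open>simp add: numeral_2_eq_2\<close>)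
  have F3: "partial_deriv k (partial_deriv j (partial_deriv i F)) \<in> forms 0" for i j k
    by (rule forms_partial_deriv) (use F2 in simp)
  have T: "eval_poly (partial_deriv k (partial_deriv j (partial_deriv i F))) x = T i j k" for i j k x
    unfolding T_def by (rule eval_forms_0[OF F3])
  have T12: "T i j k = T j i k" for i j k
    unfolding T_def by (simp only: partial_deriv_commute[of j i])
  have T23: "T i j k = T i k j" for i j k
    unfolding T_def by (simp only: partial_deriv_commute[of k j])
  have \<Phi>: "quad_family \<Phi>"
    unfolding quad_family_def
  proof (intro conjI allI)
    show "clin (\<lambda>x. \<Phi> x y z)" for y z
      unfolding \<Phi>_def by (intro clin_sum' clin_cmul clin_cmul_right clin_component)
    show "clin (\<lambda>y. \<Phi> x y z)" for x z
      unfolding \<Phi>_def by (intro clin_sum' clin_cmul clin_cmul_right clin_component)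
    show "clin (\<lambda>z. \<Phi> x y z)" for x y
      unfolding \<Phi>_def by (intro clin_sum' clin_cmul clin_cmul_right clin_component)
    fix x y z
    have "\<Phi> x y z = (\<Sum>i\<in>UNIV. \<Sum>k\<in>UNIV. \<Sum>j\<in>UNIV. T i j k * (x $ i * (y $ j * z $ k)))"
      unfolding \<Phi>_def by (rule sum.cong[OF refl], rule sum.swap)
    also have "\<dots> = \<Phi> x z y"
      unfolding \<Phi>_def by (intro sum.cong refl) (simp only: T23 mult.left_commute mult.commute)
    finally show "\<Phi> x y z = \<Phi> x z y" .
  qed
  have sym: "\<Phi> x y z = \<Phi> y x z" for x y z
  proof -
    have "\<Phi> x y z = (\<Sum>j\<in>UNIV. \<Sum>i\<in>UNIV. \<Sum>k\<in>UNIV. T i j k * (x $ i * (y $ j * z $ k)))"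
      unfolding \<Phi>_def by (rule sum.swap)
    also have "\<dots> = \<Phi> y x z"
      unfolding \<Phi>_def by (intro sum.cong refl) (simp only: T12[of _ _ _] mult.left_commute)
    finally show ?thesis .
  qed
  \<comment> \<open>Euler's identity is applied twice, to the second derivatives in degree 1 and to
    the first derivatives in degree 2.\<close>
  have \<Phi>1: "\<Phi> (axis i 1) x x = 2 * eval_poly (partial_deriv i F) x" for i x
  proof -
    have "\<Phi> (axis i 1) x x = (\<Sum>i'\<in>UNIV. if i' = i then \<Sum>j\<in>UNIV. \<Sum>k\<in>UNIV. T i' j k * (x $ j * x $ k) else 0)"
      unfolding \<Phi>_def by (intro sum.cong) (auto simp: axis_def)
    also have "\<dots> = (\<Sum>j\<in>UNIV. x $ j * (\<Sum>k\<in>UNIV. x $ k * T i j k))"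
      by (simp add: sum_distrib_left mult_ac)
    also have "\<dots> = (\<Sum>j\<in>UNIV. x $ j * eval_poly (partial_deriv j (partial_deriv i F)) x)"
      using euler[OF F2, of x] by (simp add: T)
    also have "\<dots> = 2 * eval_poly (partial_deriv i F) x"
      using euler[OF F1, of x i] by simp
    finally show ?thesis .
  qed
  have \<Phi>0: "\<Phi> x x x = 6 * eval_poly F x" for x
  proof -
    have "\<Phi> x x x = (\<Sum>i\<in>UNIV. x $ i * \<Phi> (axis i 1) x x)" by (rule clin_expand[OF clin_p1[OF \<Phi>]])
    also have "\<dots> = 2 * (\<Sum>i\<in>UNIV. x $ i * eval_poly (partial_deriv i F) x)"
      unfolding \<Phi>1 sum_distrib_left by (simp only: mult.left_commute)
    also have "\<dots> = 6 * eval_poly F x" unfolding euler[OF assms(1)] by simp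
    finally show ?thesis .
  qed
  have smooth: "\<exists>i. eval_poly (partial_deriv i F) x \<noteq> 0" if "x \<noteq> 0" for x
    using assms(2) that unfolding smooth_form_def by blast
  have nz: "\<exists>v. \<Phi> v x x \<noteq> 0" if x: "x \<noteq> 0" for x
  proof -
    obtain i where "eval_poly (partial_deriv i F) x \<noteq> 0" using smooth[OF x] by blast
    then have "\<Phi> (axis i 1) x x \<noteq> 0" by (simp add: \<Phi>1)
    then show ?thesis by blast
  qed
  obtain M where M: "\<And>x. x \<noteq> 0 \<Longrightarrow> \<not> tangent_at \<Phi> M x"
    and inj: "\<And>a x. clin a \<Longrightarrow> in_cubic_part \<Phi> (\<lambda>x. a x * quad_form M x) \<Longrightarrow> a x = 0"
    using exists_good_quadric[OF \<Phi> sym nz] by blast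
  have "smooth_complete_intersection F (quadric M)"
    unfolding smooth_complete_intersection_def
  proof (intro allI impI)
    fix x a b assume x: "x \<noteq> 0" "eval_poly F x = 0"
      and ab: "a *s gradient F x + b *s gradient (quadric M) x = 0"
    have eq: "a * eval_poly (partial_deriv i F) x + b * (\<Sum>j\<in>UNIV. (M $ i $ j + M $ j $ i) * x $ j) = 0" for i
    proof -
      have "(a *s gradient F x + b *s gradient (quadric M) x) $ i = 0" by (simp only: ab zero_index)
      then show ?thesis by (simp add: gradient_def gradient_quadric)
    qed
    have "b = 0"
    proof (rule ccontr)
      assume b: "b \<noteq> 0"
      have cancel: "s = c / b" if "b * s = c" for s c :: complex
        using b that by auto
      have "tangent_at \<Phi> M x"
        unfolding tangent_at_def
      \<comment> \<open>The 2 compensates the factor in \<open>\<Phi>1\<close>.\<close>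
      proof (intro conjI exI[of _ "- a / (2 * b)"] allI)
        show "\<Phi> x x x = 0" using x(2) by (simp add: \<Phi>0)
        fix i
        have "b * (\<Sum>j\<in>UNIV. (M $ i $ j + M $ j $ i) * x $ j) = - (a * eval_poly (partial_deriv i F) x)"
          using eq[of i] by (simp add: eq_neg_iff_add_eq_0 add.commute)
        then have "(\<Sum>j\<in>UNIV. (M $ i $ j + M $ j $ i) * x $ j) = - (a * eval_poly (partial_deriv i F) x) / b"
          by (rule cancel)
        then show "(\<Sum>j\<in>UNIV. (M $ i $ j + M $ j $ i) * x $ j) = - a / (2 * b) * \<Phi> (axis i 1) x x"
          by (simp add: \<Phi>1)
      qed
      with M[OF x(1)] show False ..
    qed
    \<comment> \<open>With \<open>b = 0\<close>, what remains is \<open>a\<close> times the gradient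
      of \<open>F\<close>, which is nonzero by smoothness.\<close>
    moreover obtain i where "eval_poly (partial_deriv i F) x \<noteq> 0" using smooth[OF x(1)] by blast
    ultimately show "a = 0 \<and> b = 0" using eq[of i] by simp
  qed
  moreover have "linear_colon (jacobian_piece F 3) (quadric M) = {0}"
  proof (intro equalityI subsetI)
    fix a assume "a \<in> linear_colon (jacobian_piece F 3) (quadric M)"
    then have a: "a \<in> forms 1" "a * quadric M \<in> jacobian_ideal F"
      by (auto simp: linear_colon_def jacobian_piece_def)
    obtain h where h: "a * quadric M = (\<Sum>i\<in>UNIV. h i * partial_deriv i F)"
      using jacobian_ideal_explicit[OF a(2)] by blast
    \<comment> \<open>The \<open>h i\<close> are arbitrary polynomials, so their linear parts are
      taken; 1/2 again compensates the factor in \<open>\<Phi>1\<close>.\<close>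
    have lin: "linear_part a x * quad_form M x = (\<Sum>i\<in>UNIV. (1 / 2 * linear_part (h i) x) * \<Phi> (axis i 1) x x)" for x
      using linear_parts_of_cubic[OF a(1) quadric_forms F1 h, of x]
      by (simp add: eval_quadric eval_forms_1[OF a(1)] \<Phi>1)
    have "in_cubic_part \<Phi> (\<lambda>x. linear_part a x * quad_form M x)"
      unfolding in_cubic_part_def
      by (intro exI[of _ "\<lambda>i x. 1 / 2 * linear_part (h i) x"] conjI allI clin_cmul clin_linear_part lin)
    then have "linear_part a x = 0" for x by (rule inj[OF clin_linear_part])
    then have "a = 0" by (intro forms_1_eq_0[OF a(1)]) (simp add: eval_forms_1[OF a(1)])
    then show "a \<in> {0}" by simp
  next
    fix a :: polynomial assume "a \<in> {0}"
    moreover have "(0 :: polynomial) \<in> jacobian_ideal F"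
      unfolding jacobian_ideal_def by (rule module.span_zero[OF module_mult])
    ultimately show "a \<in> linear_colon (jacobian_piece F 3) (quadric M)"
      by (simp add: linear_colon_def jacobian_piece_def forms_def)
  qed
  ultimately show ?thesis using quadric_forms by blast
qed

end
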